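(* \textsc{Decision Threading} is in NP. Here \textsc{Decision Threading} is: given a graph $G$, turn costs $\alpha$ for $G$, and a nonnegative real number $c$, decide whether there exists a threading $T$ of $G$ with $\alpha(T)\le c$.
   Context: All graphs are connected with minimum degree at least $2$; $G=(V,E)$. A turn at a vertex $v$ is an unordered pair of distinct edges both incident to $v$. Turn costs for $G$ are a function $\alpha$ assigning a nonnegative real number to every turn of $G$. For a closed walk $W$ with cyclic vertex sequence $v_1,\dots,v_\ell$, its turn cost $\alpha(W)$ is the sum of $\alpha(v_{i-1}v_i,v_iv_{i+1})$ over all consecutive pairs of edges, indices taken cyclically. The junction graph $J(v)$ induced by a closed walk at vertex $v$ has one vertex for each edge incident to $v$, and an edge between two of these vertices every time the walk visits $v$ immediately in between traversing the corresponding two edges. A threading of $G$ is a closed walk in $G$ that traverses every edge at least once, has no U-turns (never traverses the same edge twice in immediate succession, cyclically), and induces a connected junction graph at every vertex.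
   Formalization: Turn costs and the bound c range over nonnegative rationals, given as fractions in binary, instead of arbitrary nonnegative reals, which have no finite encoding, so that membership in NP would be undefined for them. *)

theory Defs
  imports Complex_Main "HOL-Library.Multiset" "HOL-Computational_Algebra.Polynomial"
begin

section \<open>Graphs, turn costs and threadings\<close>

definition incident :: "'v set set \<Rightarrow> 'v \<Rightarrow> 'v set set" where
  "incident E v = {e \<in> E. v \<in> e}"

definition connected_graph :: "'v set \<Rightarrow> 'v set set \<Rightarrow> bool" where
  "connected_graph V E \<longleftrightarrow> V \<noteq> {} \<and> (\<forall>u\<in>V. \<forall>v\<in>V. (u, v) \<in> {(a, b). {a, b} \<in> E}\<^sup>*)"

text \<open>The standing assumptions on graphs: finite, simple, connected, of minimum degree at least 2.\<close>

definition threadable_graph :: "'v set \<Rightarrow> 'v set set \<Rightarrow> bool" where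
  "threadable_graph V E \<longleftrightarrow>
     finite V \<and> (\<forall>e\<in>E. e \<subseteq> V \<and> card e = 2) \<and> connected_graph V E \<and>
     (\<forall>v\<in>V. 2 \<le> card (incident E v))"

definition turns_at :: "'v set set \<Rightarrow> 'v \<Rightarrow> 'v set set set" where
  "turns_at E v = {{e, f} | e f. e \<in> incident E v \<and> f \<in> incident E v \<and> e \<noteq> f}"

text \<open>Two distinct edges of a simple graph share at most one vertex, so the pair of edges
  already determines the vertex of the turn.\<close>

definition turns :: "'v set \<Rightarrow> 'v set set \<Rightarrow> 'v set set set" where
  "turns V E = (\<Union>v\<in>V. turns_at E v)"

text \<open>A closed walk is given by its cyclic vertex sequence, a list; indices are read modulo its
  length. Between the edges with numbers \<open>i\<close> and \<open>Suc i\<close> it visits the vertex number \<open>Suc i\<close>.\<close>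

definition walk_vertex :: "'v list \<Rightarrow> nat \<Rightarrow> 'v" where
  "walk_vertex W i = W ! (i mod length W)"

definition walk_edge :: "'v list \<Rightarrow> nat \<Rightarrow> 'v set" where
  "walk_edge W i = {walk_vertex W i, walk_vertex W (Suc i)}"

definition closed_walk :: "'v set \<Rightarrow> 'v set set \<Rightarrow> 'v list \<Rightarrow> bool" where
  "closed_walk V E W \<longleftrightarrow> W \<noteq> [] \<and> set W \<subseteq> V \<and> (\<forall>i<length W. walk_edge W i \<in> E)"

definition turn_cost :: "('v set set \<Rightarrow> real) \<Rightarrow> 'v list \<Rightarrow> real" where
  "turn_cost \<alpha> W = (\<Sum>i<length W. \<alpha> {walk_edge W i, walk_edge W (Suc i)})"

text \<open>The junction graph is a multigraph: its vertices are the edges at \<open>v\<close>, and it has one edge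
  for every visit of the walk to \<open>v\<close>.\<close>

definition junction_edges :: "'v list \<Rightarrow> 'v \<Rightarrow> 'v set set multiset" where
  "junction_edges W v =
     {# {walk_edge W i, walk_edge W (Suc i)}.
        i \<in># filter_mset (\<lambda>i. walk_vertex W (Suc i) = v) (mset [0..<length W]) #}"

definition junction_graph :: "'v set set \<Rightarrow> 'v list \<Rightarrow> 'v \<Rightarrow> 'v set set \<times> 'v set set multiset" where
  "junction_graph E W v = (incident E v, junction_edges W v)"

definition connected_multigraph :: "'a set \<times> 'a set multiset \<Rightarrow> bool" where
  "connected_multigraph J \<longleftrightarrow> connected_graph (fst J) (set_mset (snd J))"

definition threading :: "'v set \<Rightarrow> 'v set set \<Rightarrow> 'v list \<Rightarrow> bool" where
  "threading V E W \<longleftrightarrow>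
     closed_walk V E W \<and>
     (\<forall>e\<in>E. \<exists>i<length W. walk_edge W i = e) \<and>
     (\<forall>i<length W. walk_edge W i \<noteq> walk_edge W (Suc i)) \<and>
     (\<forall>v\<in>V. connected_multigraph (junction_graph E W v))"

definition threading_instance :: "'v set \<Rightarrow> 'v set set \<Rightarrow> ('v set set \<Rightarrow> real) \<Rightarrow> real \<Rightarrow> bool" where
  "threading_instance V E \<alpha> c \<longleftrightarrow>
     threadable_graph V E \<and> (\<forall>t\<in>turns V E. 0 \<le> \<alpha> t) \<and> 0 \<le> c"

definition threading_within :: "'v set \<Rightarrow> 'v set set \<Rightarrow> ('v set set \<Rightarrow> real) \<Rightarrow> real \<Rightarrow> bool" where
  "threading_within V E \<alpha> c \<longleftrightarrow> (\<exists>T. threading V E T \<and> turn_cost \<alpha> T \<le> c)"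


section \<open>Turing machines and NP\<close>

text \<open>Deterministic machines with any fixed number of two-way infinite tapes. States and tape
  symbols are initial segments of the natural numbers. State 0 is initial; states 1 and 2 are
  halting, with 1 accepting and 2 rejecting. Symbol 0 is the blank, 1 and 2 are the input bits 0
  and 1, and 3 separates an input from a certificate. A tape is a pair of lists, the cells to the
  left of the head (nearest first) and the cells from the head onwards; all cells beyond either
  list are blank.\<close>

datatype move = Left | Stay | Right

record tm =
  num_tapes :: nat
  num_states :: nat
  num_symbols :: nat
  delta :: "nat \<Rightarrow> nat list \<Rightarrow> nat \<times> (nat \<times> move) list"

definition turing_machine :: "tm \<Rightarrow> bool" where
  "turing_machine M \<longleftrightarrow>
     1 \<le> num_tapes M \<and> 3 \<le> num_states M \<and> 4 \<le> num_symbols M \<and>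
     (\<forall>q<num_states M. \<forall>ss. length ss = num_tapes M \<longrightarrow> set ss \<subseteq> {..<num_symbols M} \<longrightarrow>
        fst (delta M q ss) < num_states M \<and>
        length (snd (delta M q ss)) = num_tapes M \<and>
        (\<forall>(s, d)\<in>set (snd (delta M q ss)). s < num_symbols M))"

type_synonym tape = "nat list \<times> nat list"
type_synonym config = "nat \<times> tape list"

fun head_symbol :: "tape \<Rightarrow> nat" where
  "head_symbol (l, []) = 0"
| "head_symbol (l, s # r) = s"

fun write_symbol :: "nat \<Rightarrow> tape \<Rightarrow> tape" where
  "write_symbol s (l, r) = (l, s # tl r)"

fun move_head :: "move \<Rightarrow> tape \<Rightarrow> tape" where
  "move_head Stay t = t"
| "move_head Left ([], r) = ([], 0 # r)"
| "move_head Left (s # l, r) = (l, s # r)"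
| "move_head Right (l, []) = (0 # l, [])"
| "move_head Right (l, s # r) = (s # l, r)"

definition step :: "tm \<Rightarrow> config \<Rightarrow> config" where
  "step M = (\<lambda>(q, ts).
     if q \<in> {1, 2} then (q, ts)
     else let (q', acts) = delta M q (map head_symbol ts)
          in (q', map2 (\<lambda>(s, d) t. move_head d (write_symbol s t)) acts ts))"

definition initial_config :: "tm \<Rightarrow> nat list \<Rightarrow> config" where
  "initial_config M w = (0, ([], w) # replicate (num_tapes M - 1) ([], []))"

definition state_after :: "tm \<Rightarrow> nat list \<Rightarrow> nat \<Rightarrow> nat" where
  "state_after M w n = fst ((step M ^^ n) (initial_config M w))"

definition halts_within :: "tm \<Rightarrow> nat list \<Rightarrow> nat \<Rightarrow> bool" where
  "halts_within M w n \<longleftrightarrow> state_after M w n \<in> {1, 2}"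

definition accepts :: "tm \<Rightarrow> nat list \<Rightarrow> bool" where
  "accepts M w \<longleftrightarrow> (\<exists>n. state_after M w n = 1)"

definition bit_symbol :: "bool \<Rightarrow> nat" where
  "bit_symbol b = (if b then 2 else 1)"

definition pair_word :: "bool list \<Rightarrow> bool list \<Rightarrow> nat list" where
  "pair_word x y = map bit_symbol x @ [3] @ map bit_symbol y"

text \<open>NP by polynomial-time verifiers with polynomially bounded certificates.\<close>

definition NP :: "bool list set set" where
  "NP = {L. \<exists>M (p :: nat poly) (q :: nat poly).
     turing_machine M \<and>
     (\<forall>x y. halts_within M (pair_word x y) (poly p (length (pair_word x y)))) \<and>
     (\<forall>x. x \<in> L \<longleftrightarrow> (\<exists>y. length y \<le> poly q (length x) \<and> accepts M (pair_word x y)))}"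


section \<open>The decision problem as a language\<close>

text \<open>Binary digits, least significant first, without superfluous zeros.\<close>

fun nat_bits :: "nat \<Rightarrow> bool list" where
  "nat_bits n = (if n = 0 then [] else odd n # nat_bits (n div 2))"

declare nat_bits.simps [simp del]

text \<open>Self-delimiting: every binary digit is preceded by a 1, and a 0 marks the end.\<close>

definition encode_nat :: "nat \<Rightarrow> bool list" where
  "encode_nat n = concat (map (\<lambda>b. [True, b]) (nat_bits n)) @ [False]"

text \<open>Rational numbers are given as fractions, not necessarily in lowest terms.\<close>

definition fraction :: "nat \<times> nat \<Rightarrow> real" where
  "fraction r = real (fst r) / real (snd r)"

definition encode_fraction :: "nat \<times> nat \<Rightarrow> bool list" where
  "encode_fraction r = encode_nat (fst r) @ encode_nat (snd r)"

text \<open>A graph with vertices \<open>{..<n}\<close> is encoded by \<open>n\<close> in unary and the part of its adjacency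
  matrix below the diagonal; then follow the costs of all turns, ordered by the middle vertex
  \<open>v\<close> and the two outer vertices \<open>a < b\<close>, and finally the bound.\<close>

definition encode :: "nat \<Rightarrow> nat set set \<Rightarrow> (nat set set \<Rightarrow> nat \<times> nat) \<Rightarrow> nat \<times> nat \<Rightarrow> bool list" where
  "encode n E \<alpha> c =
     replicate n True @ [False] @
     [{u, v} \<in> E. v \<leftarrow> [0..<n], u \<leftarrow> [0..<v]] @
     concat [encode_fraction (\<alpha> {{a, v}, {v, b}}).
             v \<leftarrow> [0..<n], b \<leftarrow> [0..<n], a \<leftarrow> [0..<b], {a, v} \<in> E \<and> {v, b} \<in> E] @
     encode_fraction c"

definition DECISION_THREADING :: "bool list set" where
  "DECISION_THREADING = {encode n E \<alpha> c | n E \<alpha> c.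
     (\<forall>t\<in>turns {..<n} E. 0 < snd (\<alpha> t)) \<and> 0 < snd c \<and>
     threading_instance {..<n} E (\<lambda>t. fraction (\<alpha> t)) (fraction c) \<and>
     threading_within {..<n} E (\<lambda>t. fraction (\<alpha> t)) (fraction c)}"

end

theory Submission
  imports Defs
begin

text \<open>Whether a closed walk is a threading depends only on the set of its transitions \<open>(a, v, b)\<close>.
  Hence a segment of the closed walk between two occurrences of the same directed edge can be
  cut out without increasing the cost, as long as no transition disappears, and a threading of
  length at most \<open>n\<^sup>2 (n\<^sup>3 + 1)\<close> of no larger cost always exists. The certificate consists of such a
  walk, ranks witnessing that the junction graphs are connected, the positions of the costs in the
  input, a common denominator of all costs with the resulting numerators, and the carries of all
  multiplications and additions. With this data, every condition becomes a formula of bounded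
  arithmetic over the input word, whose only operations are addition, multiplication, comparison,
  word access and sums over polynomially bounded ranges. Such formulas are evaluated in unary by
  loop programs on stacks, and these are compiled to multitape Turing machines.\<close>

section \<open>Loop programs on stacks and their Turing machines\<close>

text \<open>The machine model has no arithmetic, and values are held in unary. Hence every quantity
  in a formula must stay polynomially small, while the costs of an instance are binary numbers of
  exponential size. They therefore never occur as values: only their digits do, equalities between
  them are checked column by column, and guessed carries make each check local. Rational costs pose
  a second obstacle, since their sum must be compared with the bound; a common denominator turns
  this into a comparison of integers. The product of all denominators serves, because their codes
  occupy disjoint parts of the input word, so that it has at most as many bits as the word has
  letters; the scaled numerators fit into twice that many. Soundness has to show moreover that the
  word is literally an encoding, not only that some numbers can be read from it, which is why the
  positions of all codes are guessed and the shape of every code is checked. Cuts of the walk are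
  made at directed edges and not at vertices, as turn costs and junction graphs see three
  consecutive vertices.\<close>

datatype com = Skip | Push nat nat | Pop nat | Seq com com | IfTop nat nat com com | Loop nat com

type_synonym store = "nat \<Rightarrow> nat list"

definition top_symbol :: "nat list \<Rightarrow> nat" where
  "top_symbol xs = (case xs of [] \<Rightarrow> 0 | x # _ \<Rightarrow> x)"

definition pop :: "nat \<Rightarrow> store \<Rightarrow> store" where
  "pop i \<sigma> = \<sigma>(i := tl (\<sigma> i))"

primrec exec :: "com \<Rightarrow> store \<Rightarrow> store" where
  "exec Skip = (\<lambda>\<sigma>. \<sigma>)"
| "exec (Push i a) = (\<lambda>\<sigma>. \<sigma>(i := a # \<sigma> i))"
| "exec (Pop i) = pop i"
| "exec (Seq c d) = (\<lambda>\<sigma>. exec d (exec c \<sigma>))"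
| "exec (IfTop i a c d) = (\<lambda>\<sigma>. if top_symbol (\<sigma> i) = a then exec c \<sigma> else exec d \<sigma>)"
| "exec (Loop i c) = (\<lambda>\<sigma>. ((\<lambda>\<sigma>. pop i (exec c \<sigma>)) ^^ length (\<sigma> i)) \<sigma>)"

text \<open>An upper bound on machine steps. A push is a move followed by a write;
  \<open>IfTop\<close> counts a test and the jump over the other branch; each round of a loop adds a
  test, an erasure and a jump back, and the final test accounts for the 1.\<close>

primrec time :: "com \<Rightarrow> store \<Rightarrow> nat" where
  "time Skip = (\<lambda>\<sigma>. 0)"
| "time (Push i a) = (\<lambda>\<sigma>. 2)"
| "time (Pop i) = (\<lambda>\<sigma>. 1)"
| "time (Seq c d) = (\<lambda>\<sigma>. time c \<sigma> + time d (exec c \<sigma>))"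
| "time (IfTop i a c d) = (\<lambda>\<sigma>. 2 + (if top_symbol (\<sigma> i) = a then time c \<sigma> else time d \<sigma>))"
| "time (Loop i c) = (\<lambda>\<sigma>. 1 + (\<Sum>k<length (\<sigma> i). time c (((\<lambda>\<sigma>. pop i (exec c \<sigma>)) ^^ k) \<sigma>) + 3))"

primrec writes :: "com \<Rightarrow> nat set" where
  "writes Skip = {}"
| "writes (Push i a) = {i}"
| "writes (Pop i) = {i}"
| "writes (Seq c d) = writes c \<union> writes d"
| "writes (IfTop i a c d) = writes c \<union> writes d"
| "writes (Loop i c) = insert i (writes c)"

primrec regs :: "com \<Rightarrow> nat set" where
  "regs Skip = {}"
| "regs (Push i a) = {i}"
| "regs (Pop i) = {i}"
| "regs (Seq c d) = regs c \<union> regs d"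
| "regs (IfTop i a c d) = insert i (regs c \<union> regs d)"
| "regs (Loop i c) = insert i (regs c)"

text \<open>\<open>exec\<close> fixes the number of rounds of a loop on entry, whereas the compiled
  code tests the counter for emptiness in every round; both agree because the body never writes the
  counter. Pushed symbols are nonblank, so a blank under the head means an empty stack.\<close>

primrec wf_com :: "com \<Rightarrow> bool" where
  "wf_com Skip = True"
| "wf_com (Push i a) = (a \<in> {1, 2, 3})"
| "wf_com (Pop i) = True"
| "wf_com (Seq c d) = (wf_com c \<and> wf_com d)"
| "wf_com (IfTop i a c d) = (wf_com c \<and> wf_com d)"
| "wf_com (Loop i c) = (wf_com c \<and> i \<notin> writes c)"

definition proper :: "store \<Rightarrow> bool" where
  "proper \<sigma> \<longleftrightarrow> (\<forall>i. set (\<sigma> i) \<subseteq> {1, 2, 3})"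

lemma finite_regs: "finite (regs c)"
  by (induction c) auto

lemma exec_not_written: "i \<notin> writes c \<Longrightarrow> exec c \<sigma> i = \<sigma> i"
proof (induction c arbitrary: \<sigma>)
  case (Loop j c)
  have "((\<lambda>\<sigma>. pop j (exec c \<sigma>)) ^^ k) \<sigma> i = \<sigma> i" for k
    using Loop by (induction k) (auto simp: pop_def)
  then show ?case by simp
qed (auto simp: pop_def)

lemma proper_pop: "proper \<sigma> \<Longrightarrow> proper (pop i \<sigma>)"
  unfolding proper_def pop_def
  by (metis fun_upd_apply list.set_sel(2) list.sel(2) subset_iff)

lemma proper_exec: "wf_com c \<Longrightarrow> proper \<sigma> \<Longrightarrow> proper (exec c \<sigma>)"
proof (induction c arbitrary: \<sigma>)
  case (Loop j c)
  have "proper (((\<lambda>\<sigma>. pop j (exec c \<sigma>)) ^^ k) \<sigma>)" for k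
    using Loop by (induction k) (auto intro: proper_pop)
  then show ?case by simp
next
  case (Push i a) then show ?case by (auto simp: proper_def)
qed (auto intro: proper_pop)

section \<open>Compilation to jump code and the machine that runs it\<close>

datatype instr = Wr nat nat | Lf nat | Er nat | Br nat nat nat nat

primrec code_size :: "com \<Rightarrow> nat" where
  "code_size Skip = 0"
| "code_size (Push i a) = 2"
| "code_size (Pop i) = 1"
| "code_size (Seq c d) = code_size c + code_size d"
| "code_size (IfTop i a c d) = code_size c + code_size d + 2"
| "code_size (Loop i c) = code_size c + 3"

text \<open>\<open>b\<close> is the absolute address of the first instruction. Stacks grow to the
  left: a push moves left and then writes, which takes two instructions because a machine step
  writes before it moves. \<open>Br 0 0 p p\<close> is an unconditional jump.\<close>

primrec code :: "com \<Rightarrow> nat \<Rightarrow> instr list" where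
  "code Skip = (\<lambda>b. [])"
| "code (Push i a) = (\<lambda>b. [Lf i, Wr i a])"
| "code (Pop i) = (\<lambda>b. [Er i])"
| "code (Seq c d) = (\<lambda>b. code c b @ code d (b + code_size c))"
| "code (IfTop i a c d) = (\<lambda>b.
     Br i a (b + 1) (b + code_size c + 2) # code c (b + 1) @
     Br 0 0 (b + code_size c + code_size d + 2) (b + code_size c + code_size d + 2) #
     code d (b + code_size c + 2))"
| "code (Loop i c) = (\<lambda>b.
     Br i 0 (b + code_size c + 3) (b + 1) # code c (b + 1) @ [Er i, Br 0 0 b b])"

lemma length_code [simp]: "length (code c b) = code_size c"
  by (induction c arbitrary: b) auto

text \<open>The index \<open>i = k\<close> addresses no tape and gives the action that changes
  nothing.\<close>

definition act :: "nat \<Rightarrow> nat list \<Rightarrow> nat \<Rightarrow> nat \<times> move \<Rightarrow> (nat \<times> move) list" where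
  "act k ss i a = map (\<lambda>j. if j = i then a else ((if ss ! j < 4 then ss ! j else 0), Stay)) [0..<k]"

text \<open>Program counter \<open>p\<close> is state \<open>p + 3\<close>; behind the last instruction the machine accepts
  iff register \<open>res\<close> has top symbol 1.\<close>

definition machine_delta :: "nat \<Rightarrow> instr list \<Rightarrow> nat \<Rightarrow> nat \<Rightarrow> nat list \<Rightarrow> nat \<times> (nat \<times> move) list" where
  "machine_delta k cs res q ss =
     (let goto = (\<lambda>p. if p \<le> length cs then p + 3 else 2);
          keep = act k ss k (0, Stay)
      in if q = 0 then (3, keep)
         else if q - 3 < length cs then
           (case cs ! (q - 3) of
              Wr i a \<Rightarrow> (goto (q - 2), act k ss i (if a < 4 then a else 0, Stay))
            | Lf i \<Rightarrow> (goto (q - 2), act k ss i (if ss ! i < 4 then ss ! i else 0, Left))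
            | Er i \<Rightarrow> (goto (q - 2), act k ss i (0, Right))
            | Br i a p p' \<Rightarrow> (goto (if ss ! i = a then p else p'), keep))
         else ((if ss ! res = 1 then 1 else 2), keep))"

definition machine :: "nat \<Rightarrow> instr list \<Rightarrow> nat \<Rightarrow> tm" where
  "machine k cs res = \<lparr>num_tapes = k, num_states = length cs + 4, num_symbols = 4,
     delta = machine_delta k cs res\<rparr>"

text \<open>Holds for arbitrary code: the guards in \<open>act\<close> and
  \<open>machine_delta\<close> replace invalid symbols by blanks, and \<open>goto\<close> sends
  invalid addresses to the rejecting state.\<close>

lemma turing_machine_machine: "1 \<le> k \<Longrightarrow> turing_machine (machine k cs res)"
  unfolding turing_machine_def machine_def machine_delta_def
  by (auto simp: act_def Let_def split: instr.split)

text \<open>A tape holds a stack whose top is under the head. A push on an empty stack leaves a blank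
  below it, hence the trailing blanks.\<close>

definition tape_holds :: "tape \<Rightarrow> nat list \<Rightarrow> bool" where
  "tape_holds t xs \<longleftrightarrow> set (fst t) \<subseteq> {0} \<and> (\<exists>m. snd t = xs @ replicate m 0)"

definition holds :: "nat \<Rightarrow> tape list \<Rightarrow> store \<Rightarrow> bool" where
  "holds k ts \<sigma> \<longleftrightarrow> length ts = k \<and> (\<forall>i<k. tape_holds (ts ! i) (\<sigma> i))"

lemma head_symbol_tape_holds: "tape_holds t xs \<Longrightarrow> head_symbol t = top_symbol xs"
proof -
  assume h: "tape_holds t xs"
  then obtain l m where t: "t = (l, xs @ replicate m 0)"
    unfolding tape_holds_def by (metis prod.collapse)
  show ?thesis unfolding t top_symbol_def
    by (cases xs; cases m) auto
qed

text \<open>On an empty right part the write materialises a blank cell, absorbed by the trailing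
  blanks that \<open>tape_holds\<close> permits.\<close>

lemma tape_holds_keep:
  assumes "tape_holds t xs"
  shows "tape_holds (write_symbol (head_symbol t) t) xs"
proof -
  obtain l m where t: "t = (l, xs @ replicate m 0)" and l: "set l \<subseteq> {0}"
    using assms unfolding tape_holds_def by (metis prod.collapse)
  show ?thesis
  proof (cases "xs @ replicate m (0::nat)")
    case Nil
    then show ?thesis using l unfolding t tape_holds_def by (auto intro!: exI[of _ 1])
  next
    case (Cons a list)
    then show ?thesis using l unfolding t tape_holds_def by (auto intro!: exI[of _ m])
  qed
qed

lemma tape_holds_left:
  assumes "tape_holds t xs"
  shows "tape_holds (move_head Left (write_symbol (head_symbol t) t)) (0 # xs)"
proof -
  obtain l r where t: "write_symbol (head_symbol t) t = (l, r)" by fastforce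
  have "tape_holds (l, r) xs" using tape_holds_keep[OF assms] t by simp
  then obtain m where "r = xs @ replicate m 0" "set l \<subseteq> {0}" unfolding tape_holds_def by auto
  then show ?thesis unfolding t by (cases l) (auto simp: tape_holds_def)
qed

lemma tape_holds_write:
  "tape_holds t (b # xs) \<Longrightarrow> tape_holds (write_symbol a t) (a # xs)"
  unfolding tape_holds_def by (cases t) auto

lemma tape_holds_erase:
  assumes "tape_holds t xs"
  shows "tape_holds (move_head Right (write_symbol 0 t)) (tl xs)"
proof -
  obtain l m where t: "t = (l, xs @ replicate m 0)" and l: "set l \<subseteq> {0}"
    using assms unfolding tape_holds_def by (metis prod.collapse)
  show ?thesis using l unfolding t tape_holds_def
    by (cases xs) (auto intro: exI[of _ "m - 1"] exI[of _ m])
qed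

lemma top_symbol_proper: "proper \<sigma> \<Longrightarrow> top_symbol (\<sigma> i) < 4 \<and> (top_symbol (\<sigma> i) = 0 \<longleftrightarrow> \<sigma> i = [])"
  unfolding proper_def top_symbol_def by (cases "\<sigma> i") (auto dest!: spec[of _ i])

lemma heads_holds:
  assumes "holds k ts \<sigma>" "i < k"
  shows "map head_symbol ts ! i = top_symbol (\<sigma> i)"
  using assms head_symbol_tape_holds unfolding holds_def by auto

text \<open>Tapes other than \<open>i\<close> get their scanned symbol rewritten. The condition
  \<open>i < k\<close> on the last premise lets \<open>i = k\<close> cover the steps that leave
  every stack as it is.\<close>

lemma holds_act:
  assumes h: "holds k ts \<sigma>" and p: "proper \<sigma>"
    and u: "i < k \<Longrightarrow> tape_holds (move_head (snd a) (write_symbol (fst a) (ts ! i))) xs"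
  shows "holds k (map2 (\<lambda>(s, d) t. move_head d (write_symbol s t)) (act k (map head_symbol ts) i a) ts)
           (\<sigma>(i := xs))"
  unfolding holds_def
proof (intro conjI allI impI)
  fix j assume j: "j < k"
  have l: "length ts = k" using h by (simp add: holds_def)
  have t: "tape_holds (ts ! j) (\<sigma> j)" using h j by (simp add: holds_def)
  show "tape_holds (map2 (\<lambda>(s, d) t. move_head d (write_symbol s t)) (act k (map head_symbol ts) i a) ts ! j)
      ((\<sigma>(i := xs)) j)"
  proof (cases "j = i")
    case True
    then show ?thesis using u j l by (simp add: act_def case_prod_beta)
  next
    case False
    have "head_symbol (ts ! j) < 4"
      using head_symbol_tape_holds[OF t] top_symbol_proper[OF p, of j] by simp
    then show ?thesis using False j l tape_holds_keep[OF t] by (simp add: act_def)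
  qed
qed (use h in \<open>simp_all add: holds_def act_def\<close>)

lemma holds_keep:
  assumes "holds k ts \<sigma>" "proper \<sigma>"
  shows "holds k (map2 (\<lambda>(s, d) t. move_head d (write_symbol s t)) (act k (map head_symbol ts) k (0, Stay)) ts) \<sigma>"
proof -
  have "holds k (map2 (\<lambda>(s, d) t. move_head d (write_symbol s t)) (act k (map head_symbol ts) k (0, Stay)) ts) (\<sigma>(k := \<sigma> k))"
    by (rule holds_act[OF assms]) auto
  then show ?thesis by simp
qed

section \<open>Correctness of the compiled code\<close>

definition located :: "instr list \<Rightarrow> nat \<Rightarrow> instr list \<Rightarrow> bool" where
  "located cs b ds \<longleftrightarrow> (\<exists>pre post. cs = pre @ ds @ post \<and> length pre = b)"

lemma located_append: "located cs b (ds @ es) \<longleftrightarrow> located cs b ds \<and> located cs (b + length ds) es"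
proof
  assume "located cs b (ds @ es)"
  then obtain pre post where "cs = pre @ ds @ es @ post" "length pre = b"
    unfolding located_def by auto
  then show "located cs b ds \<and> located cs (b + length ds) es" unfolding located_def
    by (metis append.assoc length_append)
next
  assume "located cs b ds \<and> located cs (b + length ds) es"
  then obtain p q p' q' where 1: "cs = p @ ds @ q" "length p = b"
    and 2: "cs = p' @ es @ q'" "length p' = b + length ds" unfolding located_def by blast
  have "p' = take (b + length ds) cs" using 2 by simp
  also have "\<dots> = p @ ds" using 1 by simp
  finally show "located cs b (ds @ es)" using 2(1) 1(2) unfolding located_def by auto
qed

lemma located_Cons: "located cs b (d # ds) \<longleftrightarrow> located cs b [d] \<and> located cs (b + 1) ds"
  using located_append[of cs b "[d]" ds] by simp

lemma located_single: "located cs b [d] \<Longrightarrow> b < length cs \<and> cs ! b = d"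
  unfolding located_def by auto

lemma located_le: "located cs b ds \<Longrightarrow> b + length ds \<le> length cs"
  unfolding located_def by auto

lemma step_machine:
  assumes "p < length cs"
  shows "step (machine k cs res) (p + 3, ts) =
    (let (q', acts) = machine_delta k cs res (p + 3) (map head_symbol ts)
     in (q', map2 (\<lambda>(s, d) t. move_head d (write_symbol s t)) acts ts))"
  using assms by (simp add: step_def machine_def)

lemma step_Br:
  assumes "located cs b [Br i a p p']" "holds k ts \<sigma>" "proper \<sigma>" "i < k" "p \<le> length cs" "p' \<le> length cs"
  obtains ts' where "step (machine k cs res) (b + 3, ts) = ((if top_symbol (\<sigma> i) = a then p else p') + 3, ts')"
    "holds k ts' \<sigma>"
  using located_single[OF assms(1)] assms(5,6) heads_holds[OF assms(2,4)] holds_keep[OF assms(2,3)]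
  by (auto simp: step_machine machine_delta_def Let_def)

lemma step_Er:
  assumes "located cs b [Er i]" "holds k ts \<sigma>" "proper \<sigma>" "i < k"
  obtains ts' where "step (machine k cs res) (b + 3, ts) = (b + 1 + 3, ts')" "holds k ts' (pop i \<sigma>)"
proof -
  have "holds k (map2 (\<lambda>(s, d) t. move_head d (write_symbol s t)) (act k (map head_symbol ts) i (0, Right)) ts) (pop i \<sigma>)"
    unfolding pop_def using assms tape_holds_erase by (intro holds_act) (auto simp: holds_def)
  then show ?thesis using that located_single[OF assms(1)]
    by (auto simp: step_machine machine_delta_def Let_def)
qed

lemma step_Push:
  assumes "located cs b [Lf i, Wr i a]" "holds k ts \<sigma>" "proper \<sigma>" "i < k" "a < 4"
  obtains ts' where "(step (machine k cs res) ^^ 2) (b + 3, ts) = (b + 2 + 3, ts')" "holds k ts' (\<sigma>(i := a # \<sigma> i))"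
proof -
  have l: "located cs b [Lf i]" "located cs (b + 1) [Wr i a]"
    using assms(1) located_Cons by (metis)+
  have ti: "tape_holds (ts ! i) (\<sigma> i)" and len: "length ts = k" using assms by (auto simp: holds_def)
  have hi: "head_symbol (ts ! i) < 4" 
    using head_symbol_tape_holds[OF ti] top_symbol_proper[OF assms(3), of i] by simp
  let ?ts1 = "map2 (\<lambda>(s, d) t. move_head d (write_symbol s t)) (act k (map head_symbol ts) i (head_symbol (ts ! i), Left)) ts"
  have s1: "step (machine k cs res) (b + 3, ts) = (b + 1 + 3, ?ts1)"
    using located_single[OF l(1)] hi assms(4) len
    by (auto simp: step_machine machine_delta_def Let_def)
  have h1: "holds k ?ts1 (\<sigma>(i := 0 # \<sigma> i))"
    using tape_holds_left[OF ti] by (intro holds_act[OF assms(2,3)]) auto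
  have len1: "length ?ts1 = k" using h1 by (simp add: holds_def)
  let ?ts2 = "map2 (\<lambda>(s, d) t. move_head d (write_symbol s t)) (act k (map head_symbol ?ts1) i (a, Stay)) ?ts1"
  have s2: "step (machine k cs res) (b + 1 + 3, ?ts1) = (b + 2 + 3, ?ts2)"
    using located_single[OF l(2)] assms(5)
    by (subst step_machine) (auto simp: machine_delta_def Let_def)
  \<comment> \<open>\<open>holds_act\<close> does not apply to the second step: between the two
    instructions the stack has a blank on top, so the intermediate store is not
    \<open>proper\<close>.\<close>
  have "holds k ?ts2 (\<sigma>(i := a # \<sigma> i))"
    unfolding holds_def
  proof (intro conjI allI impI)
    fix j assume j: "j < k"
    have t: "tape_holds (?ts1 ! j) ((\<sigma>(i := 0 # \<sigma> i)) j)" using h1 j unfolding holds_def by blast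
    show "tape_holds (?ts2 ! j) ((\<sigma>(i := a # \<sigma> i)) j)"
    proof (cases "j = i")
      case True
      have "tape_holds (?ts1 ! j) (0 # \<sigma> i)" using t True by simp
      from tape_holds_write[OF this, of a] show ?thesis using True j len1 by (simp add: act_def)
    next
      case False
      have t': "tape_holds (?ts1 ! j) (\<sigma> j)" using t False by simp
      have "head_symbol (?ts1 ! j) < 4"
        using head_symbol_tape_holds[OF t'] top_symbol_proper[OF assms(3), of j] by simp
      then show ?thesis using False j len1 tape_holds_keep[OF t'] by (simp add: act_def)
    qed
  qed (use len1 in \<open>simp_all add: act_def\<close>)
  then show ?thesis using that s1 s2 by (simp add: numeral_2_eq_2)
qed

text \<open>Structural induction; for a loop, an inner induction on the height of the counter stack.
  The number of steps is only bounded by \<open>time\<close>, since a taken else branch saves the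
  closing jump.\<close>

lemma code_correct:
  assumes "located cs b (code c b)" "holds k ts \<sigma>" "proper \<sigma>" "wf_com c" "regs c \<subseteq> {..<k}" "0 < k"
  shows "\<exists>n ts'. n \<le> time c \<sigma> \<and> (step (machine k cs res) ^^ n) (b + 3, ts) = (b + code_size c + 3, ts')
    \<and> holds k ts' (exec c \<sigma>)"
proof -
  let ?S = "step (machine k cs res)"
  show ?thesis using assms(1-5)
  proof (induction c arbitrary: b ts \<sigma>)
    case Skip
    then show ?case by (auto intro!: exI[of _ 0])
  next
    case (Push i a)
    obtain ts' where "(?S ^^ 2) (b + 3, ts) = (b + 2 + 3, ts')" "holds k ts' (\<sigma>(i := a # \<sigma> i))"
      using Push by (auto intro: step_Push[of cs b i a k ts \<sigma> res])
    then show ?case by (intro exI[of _ 2] exI[of _ ts']) (simp add: add.commute fun_upd_def)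
  next
    case (Pop i)
    obtain ts' where "?S (b + 3, ts) = (b + 1 + 3, ts')" "holds k ts' (pop i \<sigma>)"
      using Pop by (auto intro: step_Er[of cs b i k ts \<sigma> res])
    then show ?case by (intro exI[of _ 1]) auto
  next
    case (Seq c d)
    have l: "located cs b (code c b)" "located cs (b + code_size c) (code d (b + code_size c))"
      using Seq.prems(1) by (simp_all add: located_append)
    obtain n ts1 where 1: "n \<le> time c \<sigma>" "(?S ^^ n) (b + 3, ts) = (b + code_size c + 3, ts1)"
      "holds k ts1 (exec c \<sigma>)"
      using Seq.IH(1)[OF l(1) Seq.prems(2,3)] Seq.prems by auto
    obtain m ts2 where 2: "m \<le> time d (exec c \<sigma>)"
      "(?S ^^ m) (b + code_size c + 3, ts1) = (b + code_size c + code_size d + 3, ts2)"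
      "holds k ts2 (exec d (exec c \<sigma>))"
      using Seq.IH(2)[OF l(2) 1(3) proper_exec] Seq.prems by auto
    have "(?S ^^ (m + n)) (b + 3, ts) = (b + code_size c + code_size d + 3, ts2)"
      using 1(2) 2(2) by (simp add: funpow_add)
    then show ?case using 1(1) 2(1,3) by (intro exI[of _ "m + n"] exI[of _ ts2]) (auto simp: add.assoc)
  next
    case (IfTop i a c d)
    let ?c = "code_size c" and ?d = "code_size d"
    have l: "located cs b [Br i a (b + 1) (b + ?c + 2)]" "located cs (b + 1) (code c (b + 1))"
      "located cs (b + 1 + ?c) [Br 0 0 (b + ?c + ?d + 2) (b + ?c + ?d + 2)]"
      "located cs (b + ?c + 2) (code d (b + ?c + 2))"
    proof -
      have "located cs b ([Br i a (b + 1) (b + ?c + 2)] @ code c (b + 1) @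
          [Br 0 0 (b + ?c + ?d + 2) (b + ?c + ?d + 2)] @ code d (b + ?c + 2))" using IfTop.prems(1) by simp
      then show "located cs b [Br i a (b + 1) (b + ?c + 2)]" "located cs (b + 1) (code c (b + 1))"
        "located cs (b + 1 + ?c) [Br 0 0 (b + ?c + ?d + 2) (b + ?c + ?d + 2)]"
        "located cs (b + ?c + 2) (code d (b + ?c + 2))"
        unfolding located_append by simp_all
    qed
    have le: "b + 1 \<le> length cs" "b + ?c + ?d + 2 \<le> length cs"
      using located_le[OF IfTop.prems(1)] by simp_all
    have ik: "i < k" using IfTop.prems by simp
    obtain ts1 where 1: "?S (b + 3, ts) = ((if top_symbol (\<sigma> i) = a then b + 1 else b + ?c + 2) + 3, ts1)"
      "holds k ts1 \<sigma>"
      using step_Br[OF l(1) IfTop.prems(2,3) ik, of res] le by auto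
    show ?case
    proof (cases "top_symbol (\<sigma> i) = a")
      case True
      obtain n ts2 where 2: "n \<le> time c \<sigma>" "(?S ^^ n) (b + 1 + 3, ts1) = (b + 1 + ?c + 3, ts2)"
        "holds k ts2 (exec c \<sigma>)"
        using IfTop.IH(1)[OF l(2) 1(2) IfTop.prems(3)] IfTop.prems by auto
      obtain ts3 where 3: "?S (b + 1 + ?c + 3, ts2) = (b + ?c + ?d + 2 + 3, ts3)"
        "holds k ts3 (exec c \<sigma>)"
        using step_Br[OF l(3) 2(3), of res] proper_exec[OF _ IfTop.prems(3), of c] IfTop.prems assms(6) le by auto
      have "(?S ^^ (1 + n + 1)) (b + 3, ts) = (b + ?c + ?d + 2 + 3, ts3)"
        unfolding funpow_add comp_def using 1(1) 2(2) 3(1) True by simp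
      then show ?thesis using 2(1) 3(2) True
        by (intro exI[of _ "1 + n + 1"] exI[of _ ts3]) (auto simp: add.assoc)
    next
      case False
      obtain n ts2 where 2: "n \<le> time d \<sigma>" "(?S ^^ n) (b + ?c + 2 + 3, ts1) = (b + ?c + 2 + ?d + 3, ts2)"
        "holds k ts2 (exec d \<sigma>)"
        using IfTop.IH(2)[OF l(4) 1(2) IfTop.prems(3)] IfTop.prems by auto
      have "(?S ^^ (n + 1)) (b + 3, ts) = (b + ?c + 2 + ?d + 3, ts2)"
        unfolding funpow_add comp_def using 1(1) 2(2) False by simp
      then show ?thesis using 2(1,3) False
        by (intro exI[of _ "n + 1"] exI[of _ ts2]) (auto simp: algebra_simps)
    qed
  next
    case (Loop i c)
    let ?c = "code_size c"
    let ?f = "\<lambda>\<sigma>. pop i (exec c \<sigma>)"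
    have l: "located cs b [Br i 0 (b + ?c + 3) (b + 1)]" "located cs (b + 1) (code c (b + 1))"
      "located cs (b + 1 + ?c) [Er i]" "located cs (b + 2 + ?c) [Br 0 0 b b]"
    proof -
      have "located cs b ([Br i 0 (b + ?c + 3) (b + 1)] @ code c (b + 1) @ [Er i] @ [Br 0 0 b b])"
        using Loop.prems(1) by simp
      then show "located cs b [Br i 0 (b + ?c + 3) (b + 1)]" "located cs (b + 1) (code c (b + 1))"
        "located cs (b + 1 + ?c) [Er i]" "located cs (b + 2 + ?c) [Br 0 0 b b]"
        unfolding located_append by simp_all
    qed
    have le: "b + ?c + 3 \<le> length cs"
      using located_le[OF Loop.prems(1)] by simp
    have ik: "i < k" and wfc: "wf_com c" and iw: "i \<notin> writes c" using Loop.prems by auto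
    have "\<exists>n ts'. n \<le> 1 + (\<Sum>m<len. time c ((?f ^^ m) \<sigma>) + 3) \<and>
       (?S ^^ n) (b + 3, ts) = (b + ?c + 3 + 3, ts') \<and> holds k ts' ((?f ^^ len) \<sigma>)"
      if "len = length (\<sigma> i)" "holds k ts \<sigma>" "proper \<sigma>" for len \<sigma> ts
      using that
    proof (induction len arbitrary: \<sigma> ts)
      case 0
      have "top_symbol (\<sigma> i) = 0" using 0 by (simp add: top_symbol_def)
      then obtain ts1 where "?S (b + 3, ts) = (b + ?c + 3 + 3, ts1)" "holds k ts1 \<sigma>"
        using step_Br[OF l(1) 0(2,3) ik, of res] le by auto
      then show ?case by (intro exI[of _ 1]) auto
    next
      case (Suc len)
      have "top_symbol (\<sigma> i) \<noteq> 0" using top_symbol_proper[OF Suc.prems(3), of i] Suc.prems(1) by auto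
      then obtain ts1 where 1: "?S (b + 3, ts) = (b + 1 + 3, ts1)" "holds k ts1 \<sigma>"
        using step_Br[OF l(1) Suc.prems(2,3) ik, of res] le by auto
      obtain n ts2 where 2: "n \<le> time c \<sigma>" "(?S ^^ n) (b + 1 + 3, ts1) = (b + 1 + ?c + 3, ts2)"
        "holds k ts2 (exec c \<sigma>)"
        using Loop.IH[OF l(2) 1(2) Suc.prems(3)] Loop.prems by auto
      have p2: "proper (exec c \<sigma>)" using proper_exec[OF wfc Suc.prems(3)] .
      obtain ts3 where 3: "?S (b + 1 + ?c + 3, ts2) = (b + 1 + ?c + 1 + 3, ts3)"
        "holds k ts3 (?f \<sigma>)"
        using step_Er[OF l(3) 2(3) p2 ik] by blast
      have p3: "proper (?f \<sigma>)" using proper_pop[OF p2] .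
      obtain ts4 where 4: "?S (b + 2 + ?c + 3, ts3) = (b + 3, ts4)"
        "holds k ts4 (?f \<sigma>)"
        using step_Br[OF l(4) 3(2) p3 assms(6)] le by auto
      \<comment> \<open>One round lowers the counter by exactly one, because the body does not write
        it.\<close>
      have "len = length (?f \<sigma> i)" using Suc.prems(1) exec_not_written[OF iw, of \<sigma>] by (simp add: pop_def)
      from Suc.IH[OF this 4(2) p3] obtain m ts5 where 5: "m \<le> 1 + (\<Sum>m<len. time c ((?f ^^ m) (?f \<sigma>)) + 3)"
        "(?S ^^ m) (b + 3, ts4) = (b + ?c + 3 + 3, ts5)" "holds k ts5 ((?f ^^ len) (?f \<sigma>))"
        by blast
      have swap: "(?f ^^ m) (?f \<sigma>) = (?f ^^ Suc m) \<sigma>" for m using funpow_swap1[of ?f m \<sigma>] by simp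
      have "(?S ^^ (m + (1 + (1 + (n + 1))))) (b + 3, ts) = (b + ?c + 3 + 3, ts5)"
        unfolding funpow_add comp_def using 1(1) 2(2) 3(1) 4(1) 5(2) by (simp add: add.commute)
      moreover have "m + (1 + (1 + (n + 1))) \<le> 1 + (\<Sum>m<Suc len. time c ((?f ^^ m) \<sigma>) + 3)"
        using 5(1) 2(1) swap unfolding sum.lessThan_Suc_shift by simp
      ultimately show ?case using 5(3) swap[of len]
        by (intro exI[of _ "m + (1 + (1 + (n + 1)))"] exI[of _ ts5]) simp
    qed
    from this[OF refl Loop.prems(2,3)] show ?case by (simp add: add.assoc)
  qed
qed

definition word_store :: "nat list \<Rightarrow> store" where
  "word_store w = (\<lambda>_. [])(0 := w)"

text \<open>The 2 accounts for the step that leaves state 0 and for the final test of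
  \<open>res\<close>. Halting configurations are fixed points, so the verdict at one sufficiently
  late time decides acceptance.\<close>

theorem com_machine:
  assumes "wf_com c"
  obtains M where "turing_machine M"
    "\<And>w. set w \<subseteq> {1, 2, 3} \<Longrightarrow>
       (\<forall>n \<ge> time c (word_store w) + 2. state_after M w n = (if top_symbol (exec c (word_store w) res) = 1 then 1 else 2)) \<and>
       (accepts M w \<longleftrightarrow> top_symbol (exec c (word_store w) res) = 1)"
proof -
  define k where "k = Suc (Max (insert res (regs c)))"
  have fin: "finite (insert res (regs c))" by (simp add: finite_regs)
  have kr: "regs c \<subseteq> {..<k}" "res < k"
    using Max_ge[OF fin] by (auto simp: k_def less_Suc_eq_le)
  let ?cs = "code c 0"
  let ?M = "machine k ?cs res"
  have halt: "(step ?M ^^ n) (q, ts) = (q, ts)" if "q \<in> {1, 2}" for n q ts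
    using that by (induction n) (auto simp: step_def)
  have main: "(\<forall>n \<ge> time c (word_store w) + 2. state_after ?M w n = (if top_symbol (exec c (word_store w) res) = 1 then 1 else 2)) \<and>
       (accepts ?M w \<longleftrightarrow> top_symbol (exec c (word_store w) res) = 1)" if w: "set w \<subseteq> {1, 2, 3}" for w
  proof -
    let ?\<sigma> = "word_store w" and ?S = "step ?M" and ?init = "initial_config ?M w"
    let ?\<tau> = "exec c ?\<sigma>"
    let ?r = "if top_symbol (?\<tau> res) = 1 then 1 else 2 :: nat"
    have p: "proper ?\<sigma>" using w by (auto simp: proper_def word_store_def)
    obtain ts0 where ts0: "?init = (0, ts0)" "holds k ts0 ?\<sigma>"
      unfolding initial_config_def holds_def word_store_def tape_holds_def
      by (auto simp: machine_def k_def nth_Cons split: nat.split)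
    obtain ts1 where s1: "?S (0, ts0) = (0 + 3, ts1)" "holds k ts1 ?\<sigma>"
      using holds_keep[OF ts0(2) p] by (auto simp: step_def machine_def machine_delta_def)
    have "located ?cs 0 (code c 0)" unfolding located_def by auto
    from code_correct[OF this s1(2) p assms kr(1), of res]
    obtain n ts2 where n: "n \<le> time c ?\<sigma>" "(?S ^^ n) (0 + 3, ts1) = (0 + code_size c + 3, ts2)"
      "holds k ts2 (?\<tau>)" using kr(2) by auto
    obtain ts3 where s3: "?S (0 + code_size c + 3, ts2) = (?r, ts3)"
      using heads_holds[OF n(3) kr(2)] by (auto simp: step_def machine_def machine_delta_def)
    have fin: "(?S ^^ (m + (1 + (n + 1)))) (?init) = (?r, ts3)" for m
      unfolding funpow_add comp_def using s1(1) n(2) s3 ts0(1) by (simp add: halt)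
    have all: "state_after ?M w n' = ?r" if n': "n' \<ge> n + 2" for n'
    proof -
      have e: "n' - n - 2 + (1 + (n + 1)) = n'" using n' by simp
      show ?thesis unfolding state_after_def using fin[of "n' - n - 2"] unfolding e by (simp only: fst_conv)
    qed
    moreover have "accepts ?M w \<longleftrightarrow> ?r = 1"
    proof
      assume "accepts ?M w"
      then obtain n1 where "state_after ?M w n1 = 1" by (auto simp: accepts_def)
      then obtain ts4 where "(?S ^^ n1) (?init) = (1, ts4)"
        unfolding state_after_def by (metis prod.collapse)
      then have "state_after ?M w ((n + 2) + n1) = 1"
        unfolding state_after_def funpow_add comp_def using halt by simp
      then show "?r = 1" using all[of "n + 2 + n1"] by simp
    qed (use all[of "n + 2"] in \<open>auto simp: accepts_def\<close>)
    ultimately show ?thesis using n(1) by (auto split: if_splits)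
  qed
  show thesis by (rule that[OF _ main]) (simp_all add: turing_machine_machine k_def)
qed

section \<open>Terms of bounded arithmetic\<close>

text \<open>Truth values are the numbers 0 and 1: \<open>Leq\<close> is the only atomic comparison,
  multiplication acts as conjunction, and \<open>Sum\<close> provides both counting and bounded
  quantifiers.\<close>

datatype trm = Var nat | Cst nat | Len | Sym trm | Add trm trm | Mul trm trm | Leq trm trm | Sum trm trm

text \<open>Variables are de Bruijn indices; \<open>Sum t s\<close> binds index 0 in \<open>s\<close>.\<close>

primrec val :: "nat list \<Rightarrow> trm \<Rightarrow> (nat \<Rightarrow> nat) \<Rightarrow> nat" where
  "val w (Var k) = (\<lambda>\<rho>. \<rho> k)"
| "val w (Cst c) = (\<lambda>\<rho>. c)"
| "val w Len = (\<lambda>\<rho>. length w)"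
| "val w (Sym t) = (\<lambda>\<rho>. if val w t \<rho> < length w then w ! val w t \<rho> else 0)"
| "val w (Add t s) = (\<lambda>\<rho>. val w t \<rho> + val w s \<rho>)"
| "val w (Mul t s) = (\<lambda>\<rho>. val w t \<rho> * val w s \<rho>)"
| "val w (Leq t s) = (\<lambda>\<rho>. of_bool (val w t \<rho> \<le> val w s \<rho>))"
| "val w (Sum t s) = (\<lambda>\<rho>. \<Sum>a<val w t \<rho>. val w s (case_nat a \<rho>))"

section \<open>Compilation of terms to loop programs\<close>

primrec pushes :: "nat \<Rightarrow> nat \<Rightarrow> com" where
  "pushes i 0 = Skip"
| "pushes i (Suc n) = Seq (pushes i n) (Push i 1)"

definition push_top :: "nat \<Rightarrow> nat \<Rightarrow> com" where
  "push_top j i = IfTop i 1 (Push j 1) (IfTop i 2 (Push j 2) (IfTop i 3 (Push j 3) Skip))"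

text \<open>Variable \<open>k\<close> lives in register \<open>vs k\<close>, the result goes to
  \<open>r\<close>, and the registers from \<open>r\<close> on are scratch. A loop consumes its
  counter, so the word and the variables are read by moving them to scratch and back, which for the
  word also undoes the reversal. In \<open>Sum\<close>, \<open>r + 1\<close> counts down the rounds
  and \<open>r + 2\<close> is the bound variable, counting up.\<close>

primrec eval_code :: "trm \<Rightarrow> (nat \<Rightarrow> nat) \<Rightarrow> nat \<Rightarrow> com" where
  "eval_code (Var k) = (\<lambda>vs r.
     Seq (Loop (vs k) (Push (r + 1) 1))
         (Loop (r + 1) (Seq (Push (vs k) 1) (Push r 1))))"
| "eval_code (Cst c) = (\<lambda>vs r. pushes r c)"
| "eval_code Len = (\<lambda>vs r.
     Seq (Loop 0 (push_top (r + 1) 0))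
         (Loop (r + 1) (Seq (push_top 0 (r + 1)) (Push r 1))))"
| "eval_code (Sym t) = (\<lambda>vs r.
     Seq (eval_code t vs (r + 1))
    (Seq (Loop (r + 1) (Seq (push_top (r + 2) 0) (Pop 0)))
    (Seq (IfTop 0 1 (pushes r 1) (IfTop 0 2 (pushes r 2) (IfTop 0 3 (pushes r 3) Skip)))
         (Loop (r + 2) (push_top 0 (r + 2))))))"
| "eval_code (Add t s) = (\<lambda>vs r.
     Seq (eval_code t vs r) (Seq (eval_code s vs (r + 1)) (Loop (r + 1) (Push r 1))))"
| "eval_code (Mul t s) = (\<lambda>vs r.
     Seq (eval_code t vs (r + 1)) (Seq (eval_code s vs (r + 2))
    (Seq (Loop (r + 1)
            (Seq (Loop (r + 2) (Seq (Push r 1) (Push (r + 3) 1)))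
                 (Loop (r + 3) (Push (r + 2) 1))))
         (Loop (r + 2) Skip))))"
| "eval_code (Leq t s) = (\<lambda>vs r.
     Seq (eval_code t vs r) (Seq (eval_code s vs (r + 1))
    (Seq (Loop (r + 1) (Pop r))
         (IfTop r 0 (Push r 1) (Loop r Skip)))))"
| "eval_code (Sum t s) = (\<lambda>vs r.
     Seq (eval_code t vs (r + 1))
    (Seq (Loop (r + 1)
            (Seq (eval_code s (case_nat (r + 2) vs) (r + 3))
            (Seq (Loop (r + 3) (Push r 1)) (Push (r + 2) 1))))
         (Loop (r + 2) Skip)))"

abbreviation ones :: "nat \<Rightarrow> nat list" where
  "ones n \<equiv> replicate n (1::nat)"

definition env_store :: "nat list \<Rightarrow> (nat \<Rightarrow> nat) \<Rightarrow> (nat \<Rightarrow> nat) \<Rightarrow> nat \<Rightarrow> store \<Rightarrow> bool" where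
  "env_store w \<rho> vs r \<sigma> \<longleftrightarrow> \<sigma> 0 = w \<and> set w \<subseteq> {1, 2, 3} \<and> 0 < r \<and>
     (\<forall>k. 0 < vs k \<and> vs k < r \<and> \<sigma> (vs k) = ones (\<rho> k)) \<and> (\<forall>j\<ge>r. \<sigma> j = [])"

lemma top_symbol_ones: "top_symbol (ones n) = (if n = 0 then 0 else 1)"
  by (cases n) (auto simp: top_symbol_def)

lemma wf_pushes: "wf_com (pushes i n)" and writes_pushes: "writes (pushes i n) \<subseteq> {i}"
  by (induction n) auto

text \<open>Needed for the loop of \<open>Sum\<close>: its counter \<open>r + 1\<close> is neither
  0, nor a variable register of the body, nor in the scratch area of the body from
  \<open>r + 3\<close> on. The separate lower bound \<open>r\<close> lets the induction hypothesis
  be used at shifted bases \<open>k\<close>.\<close>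

lemma writes_eval_code: "r \<le> k \<Longrightarrow> writes (eval_code t vs k) \<subseteq> insert 0 (range vs \<union> {r..})"
proof (induction t arbitrary: vs r k)
  case (Cst c) then show ?case using writes_pushes[of k c] by auto
next
  case (Sym t) then show ?case using Sym.IH[of r "k + 1" vs] by (auto simp: push_top_def eval_nat_numeral)
next
  case (Add t s) then show ?case using Add.IH(1)[of r k vs] Add.IH(2)[of r "k + 1" vs] by auto
next
  case (Leq t s) then show ?case using Leq.IH(1)[of r k vs] Leq.IH(2)[of r "k + 1" vs] by auto
next
  case (Mul t s) then show ?case using Mul.IH(1)[of r "k + 1" vs] Mul.IH(2)[of r "k + 2" vs] by auto
next
  case (Sum t s)
  have "case_nat (k + 2) vs i \<in> range vs \<union> {r..}" for i
    using Sum.prems by (cases i) auto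
  then have "insert 0 (range (case_nat (k + 2) vs) \<union> {r..}) \<subseteq> insert 0 (range vs \<union> {r..})"
    by (intro insert_mono Un_least image_subsetI) simp_all
  moreover have "writes (eval_code s (case_nat (k + 2) vs) (k + 3)) \<subseteq> insert 0 (range (case_nat (k + 2) vs) \<union> {r..})"
    using Sum.prems by (intro Sum.IH(2)) simp
  ultimately have "writes (eval_code s (case_nat (k + 2) vs) (k + 3)) \<subseteq> insert 0 (range vs \<union> {r..})" by (rule order_trans[rotated])
  moreover have "writes (eval_code t vs (k + 1)) \<subseteq> insert 0 (range vs \<union> {r..})"
    using Sum.prems by (intro Sum.IH(1)) simp
  moreover have "{k, k + 1, k + 2, k + 3} \<subseteq> insert 0 (range vs \<union> {r..})" using Sum.prems by auto
  ultimately show ?case by simp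
qed (auto simp: push_top_def)

lemma wf_eval_code: "(\<And>k. 0 < vs k \<and> vs k < b) \<Longrightarrow> b \<le> r \<Longrightarrow> wf_com (eval_code t vs r)"
proof (induction t arbitrary: vs b r)
  case (Var k) show ?case using Var(1)[of k] Var(2) by auto
next
  case (Cst x) show ?case using wf_pushes by simp
next
  case Len then show ?case using Len(1)[of 0] by (simp add: push_top_def)
next
  case (Sym t)
  have "wf_com (eval_code t vs (r + 1))" by (rule Sym.IH[OF Sym.prems(1)]) (use Sym.prems(2) in simp)
  then show ?case using Sym.prems(1)[of 0] Sym.prems(2) by (simp add: push_top_def eval_nat_numeral)
next
  case (Add t s)
  have "wf_com (eval_code s vs (r + 1))" by (rule Add.IH(2)[OF Add.prems(1)]) (use Add.prems(2) in simp)
  then show ?case using Add.IH(1)[OF Add.prems] by simp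
next
  case (Leq t s)
  have "wf_com (eval_code s vs (r + 1))" by (rule Leq.IH(2)[OF Leq.prems(1)]) (use Leq.prems(2) in simp)
  then show ?case using Leq.IH(1)[OF Leq.prems] by simp
next
  case (Mul t s)
  have "wf_com (eval_code t vs (r + 1))" by (rule Mul.IH(1)[OF Mul.prems(1)]) (use Mul.prems(2) in simp)
  moreover have "wf_com (eval_code s vs (r + 2))" by (rule Mul.IH(2)[OF Mul.prems(1)]) (use Mul.prems(2) in simp)
  ultimately show ?case by simp
next
  case (Sum t s)
  let ?vs = "case_nat (r + 2) vs"
  have v: "vs k \<noteq> r + 1" for k using Sum.prems(1)[of k] Sum.prems(2) by auto
  have "r + 1 \<noteq> ?vs k" for k using v[of "k - 1"] by (auto split: nat.split)
  then have "r + 1 \<notin> insert 0 (range ?vs \<union> {r + 3..})" by auto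
  then have "r + 1 \<notin> writes (eval_code s ?vs (r + 3))" using writes_eval_code[of "r + 3" "r + 3" s ?vs] by blast
  moreover have "wf_com (eval_code t vs (r + 1))" by (rule Sum.IH(1)[OF Sum.prems(1)]) (use Sum.prems(2) in simp)
  moreover have "0 < ?vs k \<and> ?vs k < r + 3" for k
    using Sum.prems(1)[of "k - 1"] Sum.prems(2) by (auto split: nat.split)
  then have "wf_com (eval_code s ?vs (r + 3))" by (rule Sum.IH(2)) simp
  ultimately show ?case by simp
qed

section \<open>Effect and running time of the loops\<close>

lemma iterate_store:
  assumes "\<And>k. k < n \<Longrightarrow> f (g k) = g (Suc k)"
  shows "(f ^^ n) (g 0) = g n"
  using assms by (induction n) auto

text \<open>\<open>g k\<close> is the store after \<open>k\<close> rounds in closed form; it takes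
  the place of a loop invariant.\<close>

lemma exec_Loop:
  assumes "\<sigma> = g 0" "length (\<sigma> i) = n" "\<And>k. k < n \<Longrightarrow> pop i (exec c (g k)) = g (Suc k)"
  shows "exec (Loop i c) \<sigma> = g n"
  using iterate_store[of n "\<lambda>\<sigma>. pop i (exec c \<sigma>)" g] assms by simp

lemma time_Loop:
  assumes "\<sigma> = g 0" "length (\<sigma> i) = n" "\<And>k. k < n \<Longrightarrow> pop i (exec c (g k)) = g (Suc k)"
    "\<And>k. k < n \<Longrightarrow> time c (g k) \<le> m"
  shows "time (Loop i c) \<sigma> \<le> (m + 3) * n + 1"
proof -
  have "((\<lambda>\<sigma>. pop i (exec c \<sigma>)) ^^ k) \<sigma> = g k" if "k < n" for k
    using iterate_store[of k "\<lambda>\<sigma>. pop i (exec c \<sigma>)" g] assms that by simp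
  then have "time (Loop i c) \<sigma> = 1 + (\<Sum>k<n. time c (g k) + 3)"
    using assms(2) by simp
  also have "\<dots> \<le> 1 + (\<Sum>k<n. m + 3)" using assms(4) by (intro add_left_mono sum_mono) auto
  finally show ?thesis by (simp add: algebra_simps)
qed

lemma time_Loop_const:
  assumes "\<And>\<sigma>. time c \<sigma> \<le> m"
  shows "time (Loop i c) \<sigma> \<le> (m + 3) * length (\<sigma> i) + 1"
proof -
  have "(\<Sum>k<length (\<sigma> i). time c (((\<lambda>\<sigma>. pop i (exec c \<sigma>)) ^^ k) \<sigma>) + 3) \<le> (\<Sum>k<length (\<sigma> i). m + 3)"
    using assms by (intro sum_mono) auto
  then show ?thesis by (simp add: algebra_simps)
qed

lemma exec_pushes: "exec (pushes i n) \<sigma> = \<sigma>(i := ones n @ \<sigma> i)"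
  by (induction n) (auto simp: fun_eq_iff)

lemma time_pushes: "time (pushes i n) \<sigma> = 2 * n"
  by (induction n arbitrary: \<sigma>) auto

lemma time_push_top: "time (push_top j i) \<sigma> \<le> 8"
  by (simp add: push_top_def)

lemma exec_push_top: "set (\<sigma> i) \<subseteq> {1, 2, 3} \<Longrightarrow>
   exec (push_top j i) \<sigma> = (if \<sigma> i = [] then \<sigma> else \<sigma>(j := hd (\<sigma> i) # \<sigma> j))"
  by (cases "\<sigma> i") (auto simp: push_top_def top_symbol_def)

text \<open>A form for loops that may inspect their own counter: before round \<open>k\<close> the
  counter is \<open>drop k\<close> of its original content, and \<open>h k\<close> describes the
  other registers.\<close>

lemma exec_Loop_pop:
  assumes "h 0 = \<sigma>" "\<And>k. k < length (\<sigma> i) \<Longrightarrow> exec c ((h k)(i := drop k (\<sigma> i))) = (h (Suc k))(i := drop k (\<sigma> i))"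
  shows "exec (Loop i c) \<sigma> = (h (length (\<sigma> i)))(i := [])"
proof -
  have "exec (Loop i c) \<sigma> = (h (length (\<sigma> i)))(i := drop (length (\<sigma> i)) (\<sigma> i))"
    by (rule exec_Loop[where g = "\<lambda>k. (h k)(i := drop k (\<sigma> i))"])
      (use assms in \<open>auto simp: pop_def tl_drop drop_Suc\<close>)
  then show ?thesis by simp
qed

lemma exec_clear: "exec (Loop i Skip) \<sigma> = \<sigma>(i := [])"
  by (rule exec_Loop_pop[of "\<lambda>k. \<sigma>"]) auto

lemma exec_add: "i \<noteq> j \<Longrightarrow> exec (Loop i (Push j 1)) \<sigma> = \<sigma>(i := [], j := ones (length (\<sigma> i)) @ \<sigma> j)"
  by (subst exec_Loop_pop[of "\<lambda>k. \<sigma>(j := ones k @ \<sigma> j)"]) (auto simp: fun_eq_iff)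

lemma exec_add2: "i \<noteq> j \<Longrightarrow> i \<noteq> l \<Longrightarrow> j \<noteq> l \<Longrightarrow> exec (Loop i (Seq (Push j 1) (Push l 1))) \<sigma> =
   \<sigma>(i := [], j := ones (length (\<sigma> i)) @ \<sigma> j, l := ones (length (\<sigma> i)) @ \<sigma> l)"
  by (subst exec_Loop_pop[of "\<lambda>k. \<sigma>(j := ones k @ \<sigma> j, l := ones k @ \<sigma> l)"]) (auto simp: fun_eq_iff)

lemma exec_monus: "i \<noteq> j \<Longrightarrow> exec (Loop i (Pop j)) \<sigma> = \<sigma>(i := [], j := drop (length (\<sigma> i)) (\<sigma> j))"
  by (subst exec_Loop_pop[of "\<lambda>k. \<sigma>(j := drop k (\<sigma> j))"]) (auto simp: pop_def tl_drop drop_Suc fun_eq_iff)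

lemma set_drop_proper: "set xs \<subseteq> {1, 2, 3} \<Longrightarrow> set (drop k xs) \<subseteq> {1, 2, 3}"
  by (auto dest: in_set_dropD)

lemma exec_reverse:
  assumes "i \<noteq> j" "set (\<sigma> i) \<subseteq> {1, 2, 3}"
  shows "exec (Loop i (push_top j i)) \<sigma> = \<sigma>(i := [], j := rev (\<sigma> i) @ \<sigma> j)"
  by (subst exec_Loop_pop[of "\<lambda>k. \<sigma>(j := rev (take k (\<sigma> i)) @ \<sigma> j)"])
    (use assms(1) set_drop_proper[OF assms(2)] in
      \<open>auto simp: exec_push_top fun_eq_iff take_Suc_conv_app_nth hd_drop_conv_nth\<close>)

lemma exec_reverse_count:
  assumes "i \<noteq> j" "i \<noteq> l" "j \<noteq> l" "set (\<sigma> i) \<subseteq> {1, 2, 3}"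
  shows "exec (Loop i (Seq (push_top j i) (Push l 1))) \<sigma> = \<sigma>(i := [], j := rev (\<sigma> i) @ \<sigma> j, l := ones (length (\<sigma> i)) @ \<sigma> l)"
  by (subst exec_Loop_pop[of "\<lambda>k. \<sigma>(j := rev (take k (\<sigma> i)) @ \<sigma> j, l := ones k @ \<sigma> l)"])
    (use assms(1-3) set_drop_proper[OF assms(4)] in
      \<open>auto simp: exec_push_top fun_eq_iff take_Suc_conv_app_nth hd_drop_conv_nth\<close>)

text \<open>If the counter is longer than the word, the surplus rounds do nothing, as
  \<open>push_top\<close> and \<open>Pop\<close> ignore an empty stack; \<open>take\<close> and
  \<open>drop\<close> behave likewise.\<close>

lemma exec_shift:
  assumes "i \<noteq> 0" "j \<noteq> 0" "i \<noteq> j" "set (\<sigma> 0) \<subseteq> {1, 2, 3}"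
  shows "exec (Loop i (Seq (push_top j 0) (Pop 0))) \<sigma> =
    \<sigma>(i := [], 0 := drop (length (\<sigma> i)) (\<sigma> 0), j := rev (take (length (\<sigma> i)) (\<sigma> 0)) @ \<sigma> j)"
  by (subst exec_Loop_pop[of "\<lambda>k. \<sigma>(0 := drop k (\<sigma> 0), j := rev (take k (\<sigma> 0)) @ \<sigma> j)"])
    (use assms(1-3) set_drop_proper[OF assms(4)] in
      \<open>auto simp: exec_push_top pop_def tl_drop drop_Suc fun_eq_iff take_Suc_conv_app_nth hd_drop_conv_nth not_le\<close>)

lemma env_store_fresh:
  assumes "env_store w \<rho> vs r \<sigma>" "r \<le> i" "i < r'"
  shows "env_store w \<rho> vs r' (\<sigma>(i := xs))"
proof -
  have "vs k < r" for k using assms(1) by (simp add: env_store_def)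
  then have "vs k \<noteq> i \<and> vs k < r'" for k using assms(2,3) by (metis le_less_trans less_trans not_le)
  then show ?thesis using assms unfolding env_store_def by auto
qed

lemma env_store_weaken: "env_store w \<rho> vs r \<sigma> \<Longrightarrow> r \<le> r' \<Longrightarrow> env_store w \<rho> vs r' \<sigma>"
  unfolding env_store_def by (meson less_le_trans order_trans)

lemma env_store_bind:
  assumes "env_store w \<rho> vs r \<sigma>" "\<And>j. j < r \<Longrightarrow> \<sigma>' j = \<sigma> j" "\<sigma>' (r + 2) = ones a" "\<And>j. r + 3 \<le> j \<Longrightarrow> \<sigma>' j = []"
  shows "env_store w (case_nat a \<rho>) (case_nat (r + 2) vs) (r + 3) \<sigma>'"
  using assms unfolding env_store_def by (auto split: nat.split simp: less_le_trans dest: spec intro: less_trans)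

section \<open>Bounds on values and time, and correctness of the compiled terms\<close>

declare exec.simps(6) [simp del] time.simps(6) [simp del]

text \<open>\<open>M\<close> bounds the length of the word and all variables. Under
  \<open>Sum\<close> the bound variable stays below the value of \<open>t\<close>, whence the
  enlarged argument \<open>M + value_bound t M\<close>.\<close>

primrec value_bound :: "trm \<Rightarrow> nat \<Rightarrow> nat" where
  "value_bound (Var k) = (\<lambda>M. M)"
| "value_bound (Cst c) = (\<lambda>M. c)"
| "value_bound Len = (\<lambda>M. M)"
| "value_bound (Sym t) = (\<lambda>M. 3)"
| "value_bound (Add t s) = (\<lambda>M. value_bound t M + value_bound s M)"
| "value_bound (Mul t s) = (\<lambda>M. value_bound t M * value_bound s M)"
| "value_bound (Leq t s) = (\<lambda>M. 1)"
| "value_bound (Sum t s) = (\<lambda>M. value_bound t M * value_bound s (M + value_bound t M))"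

text \<open>The constants follow from \<open>time_Loop_const\<close>: a round costs its body plus 3,
  and the exit costs 1. For \<open>Var\<close>, for example, the two loops cost 5 and 7 per
  round.\<close>

primrec time_bound :: "trm \<Rightarrow> nat \<Rightarrow> nat" where
  "time_bound (Var k) = (\<lambda>M. 12 * M + 2)"
| "time_bound (Cst c) = (\<lambda>M. 2 * c)"
| "time_bound Len = (\<lambda>M. 24 * M + 2)"
| "time_bound (Sym t) = (\<lambda>M. time_bound t M + 12 * value_bound t M + 11 * M + 20)"
| "time_bound (Add t s) = (\<lambda>M. time_bound t M + time_bound s M + 5 * value_bound s M + 1)"
| "time_bound (Mul t s) = (\<lambda>M. time_bound t M + time_bound s M +
     (12 * value_bound s M + 5) * value_bound t M + 3 * value_bound s M + 2)"
| "time_bound (Leq t s) = (\<lambda>M. time_bound t M + time_bound s M + 4 * value_bound s M + 3 * value_bound t M + 6)"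
| "time_bound (Sum t s) = (\<lambda>M. time_bound t M +
     (time_bound s (M + value_bound t M) + 5 * value_bound s (M + value_bound t M) + 9) * value_bound t M + 2)"

lemma val_le_value_bound:
  assumes "length w \<le> M" "set w \<subseteq> {1, 2, 3}" "\<And>k. \<rho> k \<le> M"
  shows "val w t \<rho> \<le> value_bound t M"
  using assms
proof (induction t arbitrary: \<rho> M)
  case (Sym t)
  have "w ! i \<le> 3" if "i < length w" for i using Sym.prems(2) nth_mem[OF that] by auto
  then show ?case by auto
next
  case (Sum t s)
  have n: "val w t \<rho> \<le> value_bound t M" using Sum.prems by (intro Sum.IH(1))
  have "(\<Sum>a<val w t \<rho>. val w s (case_nat a \<rho>)) \<le> (\<Sum>a<val w t \<rho>. value_bound s (M + value_bound t M))"
  proof (rule sum_mono, rule Sum.IH(2))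
    fix a k assume "a \<in> {..<val w t \<rho>}"
    then show "case_nat a \<rho> k \<le> M + value_bound t M"
      using n Sum.prems(3)[of "k - 1"] by (auto split: nat.split)
  qed (use Sum.prems in auto)
  also have "\<dots> \<le> value_bound t M * value_bound s (M + value_bound t M)"
    using n by simp
  finally show ?case by simp
qed (auto intro: add_mono mult_mono)

text \<open>All registers except \<open>r\<close> end as they began, so subterms can be evaluated
  one after the other in the same environment. Value and time are treated in one induction because
  the time of a later part depends on the store that the earlier ones leave.\<close>

lemma eval_code_correct:
  assumes "env_store w \<rho> vs r \<sigma>" "length w \<le> M" "\<And>k. \<rho> k \<le> M"
  shows "exec (eval_code t vs r) \<sigma> = \<sigma>(r := ones (val w t \<rho>)) \<and> time (eval_code t vs r) \<sigma> \<le> time_bound t M"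
  using assms
proof (induction t arbitrary: \<rho> vs r \<sigma> M)
  case (Var k)
  then have h: "vs k \<noteq> r" "vs k \<noteq> r + 1" "\<sigma> r = []" "\<sigma> (r + 1) = []" "\<sigma> (vs k) = ones (\<rho> k)"
    by (auto simp: env_store_def dest!: spec[of _ k])
  let ?c = "Loop (vs k) (Push (r + 1) 1)" and ?d = "Loop (r + 1) (Seq (Push (vs k) 1) (Push r 1))"
  have "time ?c \<sigma> \<le> (2 + 3) * length (\<sigma> (vs k)) + 1" by (rule time_Loop_const) simp
  moreover have "time ?d (exec ?c \<sigma>) \<le> (4 + 3) * length (exec ?c \<sigma> (r + 1)) + 1"
    by (rule time_Loop_const) simp
  ultimately show ?case using h Var.prems(3)[of k] unfolding eval_code.simps time.simps(4)
    by (simp del: One_nat_def add: exec_add exec_add2 fun_eq_iff)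
next
  case (Cst c)
  then show ?case by (simp add: exec_pushes time_pushes env_store_def)
next
  case Len
  then have h: "\<sigma> r = []" "\<sigma> (r + 1) = []" "\<sigma> 0 = w" "set w \<subseteq> {1, 2, 3}" "0 < r"
    by (auto simp: env_store_def)
  let ?c = "Loop 0 (push_top (r + 1) 0)" and ?d = "Loop (r + 1) (Seq (push_top 0 (r + 1)) (Push r 1))"
  have "time ?c \<sigma> \<le> (8 + 3) * length (\<sigma> 0) + 1" by (rule time_Loop_const) (rule time_push_top)
  moreover have "time ?d (exec ?c \<sigma>) \<le> (10 + 3) * length (exec ?c \<sigma> (r + 1)) + 1"
    by (rule time_Loop_const) (use time_push_top[of 0 "r + 1"] in \<open>simp add: add_mono\<close>)
  ultimately show ?case using h Len.prems(2) unfolding eval_code.simps time.simps(4)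
    by (simp del: One_nat_def add: exec_reverse exec_reverse_count fun_eq_iff)
next
  case (Sym t)
  define p where "p = val w t \<rho>"
  have h: "\<sigma> r = []" "\<sigma> (r + 1) = []" "\<sigma> (r + 2) = []" "\<sigma> 0 = w" "set w \<subseteq> {1, 2, 3}" "0 < r"
    using Sym.prems by (auto simp: env_store_def)
  have e: "env_store w \<rho> vs (r + 1) \<sigma>" using env_store_weaken[OF Sym.prems(1)] by simp
  note IH = Sym.IH[OF e Sym.prems(2,3)]
  have 1: "exec (eval_code t vs (r + 1)) \<sigma> = \<sigma>(r + 1 := ones p)" unfolding p_def using IH by blast
  have p: "p \<le> value_bound t M" unfolding p_def using val_le_value_bound Sym.prems h(5) by blast
  let ?c = "Loop (r + 1) (Seq (push_top (r + 2) 0) (Pop 0))" and ?d = "Loop (r + 2) (push_top 0 (r + 2))"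
  let ?i = "IfTop 0 1 (pushes r 1) (IfTop 0 2 (pushes r 2) (IfTop 0 3 (pushes r 3) Skip))"
  let ?\<tau> = "\<sigma>(0 := drop p w, r + 2 := rev (take p w))"
  have 2: "exec ?c (\<sigma>(r + 1 := ones p)) = ?\<tau>" using h by (subst exec_shift) (auto simp: fun_eq_iff)
  have t2: "time ?c (\<sigma>(r + 1 := ones p)) \<le> (9 + 3) * length ((\<sigma>(r + 1 := ones p)) (r + 1)) + 1"
    by (rule time_Loop_const) (use time_push_top[of "r + 2" 0] in \<open>simp add: add_mono\<close>)
  let ?s = "if p < length w then w ! p else 0"
  have s: "p < length w \<Longrightarrow> w ! p \<in> {1, 2, 3}" using h(5) nth_mem by blast
  have 3: "exec ?i ?\<tau> = ?\<tau>(r := ones ?s)"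
  proof (cases "p < length w")
    case True
    then have "top_symbol (drop p w) = w ! p" by (simp add: Cons_nth_drop_Suc[symmetric] top_symbol_def)
    then show ?thesis using s[OF True] True h by (auto simp: exec_pushes fun_eq_iff simp del: pushes.simps)
  next
    case False
    then show ?thesis using h by (auto simp: top_symbol_def fun_eq_iff)
  qed
  have t3: "time ?i ?\<tau> \<le> 12" by (simp add: time_pushes del: pushes.simps)
  have 4: "exec ?d (?\<tau>(r := ones ?s)) = \<sigma>(r := ones ?s)"
    using h by (subst exec_reverse) (auto simp: fun_eq_iff dest: in_set_takeD)
  have "time ?d (?\<tau>(r := ones ?s)) \<le> (8 + 3) * length ((?\<tau>(r := ones ?s)) (r + 2)) + 1"
    by (rule time_Loop_const) (rule time_push_top)
  also have "\<dots> \<le> 11 * M + 1" using Sym.prems(2) by simp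
  finally have t4: "time ?d (?\<tau>(r := ones ?s)) \<le> 11 * M + 1" .
  have "exec (eval_code (Sym t) vs r) \<sigma> = \<sigma>(r := ones (val w (Sym t) \<rho>))"
    unfolding eval_code.simps exec.simps(4) 1 2 3 4 by (simp only: p_def val.simps)
  moreover have "time (eval_code (Sym t) vs r) \<sigma> \<le> time_bound (Sym t) M"
    unfolding eval_code.simps time.simps(4) 1 2 3 time_bound.simps using conjunct2[OF IH] t2 t3 t4 p
    by (simp del: time.simps exec.simps)
  ultimately show ?case ..
next
  case (Add t s)
  let ?a = "val w t \<rho>" and ?b = "val w s \<rho>" and ?c = "Loop (r + 1) (Push r 1)"
  have h: "\<sigma> r = []" "\<sigma> (r + 1) = []" "set w \<subseteq> {1, 2, 3}" using Add.prems by (auto simp: env_store_def)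
  note IH1 = Add.IH(1)[OF Add.prems]
  have e: "env_store w \<rho> vs (r + 1) (\<sigma>(r := ones ?a))" using env_store_fresh[OF Add.prems(1), of r] by simp
  note IH2 = Add.IH(2)[OF e Add.prems(2,3)]
  note x = conjunct1[OF IH1] conjunct1[OF IH2]
  have b: "?b \<le> value_bound s M" using val_le_value_bound Add.prems h(3) by blast
  let ?\<tau> = "\<sigma>(r := ones ?a, r + 1 := ones ?b)"
  have "time ?c ?\<tau> \<le> (2 + 3) * length (?\<tau> (r + 1)) + 1" by (rule time_Loop_const) simp
  also have "\<dots> \<le> 5 * value_bound s M + 1" using b by simp
  finally have "time (eval_code (Add t s) vs r) \<sigma> \<le> time_bound (Add t s) M"
    unfolding eval_code.simps time.simps(4) x time_bound.simps using conjunct2[OF IH1] conjunct2[OF IH2] by linarith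
  moreover have "exec (eval_code (Add t s) vs r) \<sigma> = \<sigma>(r := ones (val w (Add t s) \<rho>))"
    unfolding eval_code.simps exec.simps(4) x using h
    by (simp del: One_nat_def add: exec_add fun_eq_iff replicate_add[symmetric] add.commute)
  ultimately show ?case by blast
next
  case (Mul t s)
  let ?a = "val w t \<rho>" and ?b = "val w s \<rho>"
  have h: "\<sigma> r = []" "\<sigma> (r + 1) = []" "\<sigma> (r + 2) = []" "\<sigma> (r + 3) = []" "set w \<subseteq> {1, 2, 3}" using Mul.prems by (auto simp: env_store_def)
  have e1: "env_store w \<rho> vs (r + 1) \<sigma>" using env_store_weaken[OF Mul.prems(1)] by simp
  note IH1 = Mul.IH(1)[OF e1 Mul.prems(2,3)]
  have e2: "env_store w \<rho> vs (r + 2) (\<sigma>(r + 1 := ones ?a))" using env_store_fresh[OF Mul.prems(1), of "r + 1"] by simp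
  note IH2 = Mul.IH(2)[OF e2 Mul.prems(2,3)]
  note x = conjunct1[OF IH1] conjunct1[OF IH2]
  have a: "?a \<le> value_bound t M" and b: "?b \<le> value_bound s M"
    using val_le_value_bound Mul.prems h(5) by blast+
  \<comment> \<open>Store after \<open>k\<close> rounds of the outer loop: \<open>k\<close> copies
    of the second factor have been added to \<open>r\<close>.\<close>
  let ?g = "\<lambda>k. \<sigma>(r + 1 := ones (?a - k), r + 2 := ones ?b, r := ones (k * ?b))"
  let ?c1 = "Loop (r + 2) (Seq (Push r 1) (Push (r + 3) 1))" and ?c2 = "Loop (r + 3) (Push (r + 2) 1)"
  let ?c = "Seq ?c1 ?c2" and ?\<tau> = "\<sigma>(r + 1 := ones ?a, r + 2 := ones ?b)"
  have i: "pop (r + 1) (exec ?c (?g k)) = ?g (Suc k)" for k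
    using h(1-4) by (auto simp del: One_nat_def simp add: exec_add exec_add2 fun_eq_iff pop_def replicate_add[symmetric])
  have 3: "exec (Loop (r + 1) ?c) ?\<tau> = ?g ?a"
    by (rule exec_Loop[where g = ?g, OF _ _ i]) (use h(1-4) in \<open>auto simp: fun_eq_iff\<close>)
  have "time (Loop (r + 1) ?c) ?\<tau> \<le> (12 * ?b + 2 + 3) * ?a + 1"
  proof (rule time_Loop[where g = ?g, OF _ _ i])
    fix k
    have "time ?c1 (?g k) \<le> (4 + 3) * length (?g k (r + 2)) + 1" by (rule time_Loop_const) simp
    moreover have "exec ?c1 (?g k) (r + 3) = ones ?b"
      using h by (simp del: One_nat_def add: exec_add2)
    moreover have "time ?c2 (exec ?c1 (?g k)) \<le> (2 + 3) * length (exec ?c1 (?g k) (r + 3)) + 1"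
      by (rule time_Loop_const) simp
    ultimately show "time ?c (?g k) \<le> 12 * ?b + 2" unfolding time.simps(4) by (simp del: time.simps exec.simps)
  qed (use h(1-4) in \<open>auto simp: fun_eq_iff\<close>)
  also have "\<dots> \<le> (12 * value_bound s M + 5) * value_bound t M + 1"
    using a b by (intro add_right_mono mult_le_mono) auto
  finally have t3: "time (Loop (r + 1) ?c) ?\<tau> \<le> (12 * value_bound s M + 5) * value_bound t M + 1" .
  have "time (Loop (r + 2) Skip) (?g ?a) \<le> (0 + 3) * length (?g ?a (r + 2)) + 1"
    by (rule time_Loop_const) simp
  then have t4: "time (Loop (r + 2) Skip) (?g ?a) \<le> 3 * value_bound s M + 1" using b by (simp del: time.simps)
  have "time (eval_code (Mul t s) vs r) \<sigma> \<le> time_bound (Mul t s) M"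
    unfolding eval_code.simps time.simps(4)[of "eval_code t vs (r + 1)"] time.simps(4)[of "eval_code s vs (r + 2)"]
     time.simps(4)[of "Loop (r + 1) ?c"] x 3 time_bound.simps
    using t3 t4 conjunct2[OF IH1] conjunct2[OF IH2] by linarith
  moreover have "exec (eval_code (Mul t s) vs r) \<sigma> = \<sigma>(r := ones (val w (Mul t s) \<rho>))"
    unfolding eval_code.simps exec.simps(4)[of "eval_code t vs (r + 1)"] exec.simps(4)[of "eval_code s vs (r + 2)"]
     exec.simps(4)[of "Loop (r + 1) ?c"] x 3 exec_clear using h by (auto simp: fun_eq_iff)
  ultimately show ?case by blast
next
  case (Leq t s)
  let ?a = "val w t \<rho>" and ?b = "val w s \<rho>" and ?c = "Loop (r + 1) (Pop r)"
  have h: "\<sigma> r = []" "\<sigma> (r + 1) = []" "set w \<subseteq> {1, 2, 3}" using Leq.prems by (auto simp: env_store_def)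
  note IH1 = Leq.IH(1)[OF Leq.prems]
  have e: "env_store w \<rho> vs (r + 1) (\<sigma>(r := ones ?a))" using env_store_fresh[OF Leq.prems(1), of r] by simp
  note IH2 = Leq.IH(2)[OF e Leq.prems(2,3)]
  note x = conjunct1[OF IH1] conjunct1[OF IH2]
  have a: "?a \<le> value_bound t M" and b: "?b \<le> value_bound s M"
    using val_le_value_bound Leq.prems h(3) by blast+
  let ?\<tau> = "\<sigma>(r := ones ?a, r + 1 := ones ?b)"
  have "time ?c ?\<tau> \<le> (1 + 3) * length (?\<tau> (r + 1)) + 1" by (rule time_Loop_const) simp
  also have "\<dots> = 4 * ?b + 1" by simp
  finally have t1: "time ?c ?\<tau> \<le> 4 * ?b + 1" .
  have c: "exec ?c ?\<tau> r = ones (?a - ?b)" by (simp add: exec_monus)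
  have "time (Loop r Skip) (exec ?c ?\<tau>) \<le> (0 + 3) * length (exec ?c ?\<tau> r) + 1"
    by (rule time_Loop_const) simp
  also have "\<dots> \<le> 3 * ?a + 1" unfolding c by simp
  finally have "time (IfTop r 0 (Push r 1) (Loop r Skip)) (exec ?c ?\<tau>) \<le> 3 * ?a + 5"
    unfolding time.simps(5) time.simps(2) by (simp del: exec.simps time.simps)
  then have "time (eval_code (Leq t s) vs r) \<sigma> \<le> time_bound (Leq t s) M"
    unfolding eval_code.simps time.simps(4) x time_bound.simps
    using t1 conjunct2[OF IH1] conjunct2[OF IH2] a b by linarith
  moreover have "exec (eval_code (Leq t s) vs r) \<sigma> = \<sigma>(r := ones (val w (Leq t s) \<rho>))"
    unfolding eval_code.simps exec.simps(4) x using h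
    by (auto simp: exec_monus[unfolded One_nat_def] exec_clear fun_eq_iff top_symbol_ones[unfolded One_nat_def])
  ultimately show ?case by blast
next
  case (Sum t s)
  let ?n = "val w t \<rho>" and ?f = "\<lambda>a. val w s (case_nat a \<rho>)" and ?M = "M + value_bound t M"
  have h: "\<sigma> r = []" "\<sigma> (r + 1) = []" "\<sigma> (r + 2) = []" "\<sigma> (r + 3) = []" "set w \<subseteq> {1, 2, 3}" using Sum.prems by (auto simp: env_store_def)
  have e1: "env_store w \<rho> vs (r + 1) \<sigma>" using env_store_weaken[OF Sum.prems(1)] by simp
  note IH1 = Sum.IH(1)[OF e1 Sum.prems(2,3)]
  note 1 = conjunct1[OF IH1]
  have n: "?n \<le> value_bound t M" using val_le_value_bound Sum.prems h(5) by blast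
  \<comment> \<open>Store before round \<open>k\<close>: the partial sum of the first
    \<open>k\<close> values is in \<open>r\<close>, and \<open>r + 2\<close> holds \<open>k\<close>,
    the value of the bound variable in this round.\<close>
  define g where "g = (\<lambda>k. \<sigma>(r + 1 := ones (?n - k), r + 2 := ones k, r := ones (\<Sum>a<k. ?f a)))"
  have e: "env_store w (case_nat k \<rho>) (case_nat (r + 2) vs) (r + 3) (g k)" for k
    using Sum.prems by (intro env_store_bind[OF Sum.prems(1)]) (auto simp: g_def env_store_def)
  let ?d = "eval_code s (case_nat (r + 2) vs) (r + 3)" and ?p = "Loop (r + 3) (Push r 1)"
  let ?c = "Seq ?d (Seq ?p (Push (r + 2) 1))" and ?\<tau> = "\<sigma>(r + 1 := ones ?n)"
  have r: "case_nat k \<rho> j \<le> ?M" if "k < ?n" for k j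
    using that n Sum.prems(3)[of "j - 1"] by (auto split: nat.split)
  have IH2: "exec ?d (g k) = (g k)(r + 3 := ones (?f k)) \<and> time ?d (g k) \<le> time_bound s ?M" if "k < ?n" for k
    using r[OF that] Sum.prems(2) by (intro Sum.IH(2)[OF e]) auto
  note x = conjunct1[OF IH2]
  have i: "pop (r + 1) (exec ?c (g k)) = g (Suc k)" if "k < ?n" for k
    unfolding exec.simps(4) x[OF that] using h(1-4)
    by (auto simp del: One_nat_def simp add: exec_add g_def fun_eq_iff pop_def replicate_add[symmetric] add.commute)
  have 2: "exec (Loop (r + 1) ?c) ?\<tau> = g ?n"
    by (rule exec_Loop[where g = g, OF _ _ i]) (use h(1-4) in \<open>auto simp: g_def fun_eq_iff\<close>)
  have "time (Loop (r + 1) ?c) ?\<tau> \<le> (time_bound s ?M + 5 * value_bound s ?M + 3 + 3) * ?n + 1"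
  proof (rule time_Loop[where g = g, OF _ _ i])
    fix k assume k: "k < ?n"
    let ?h = "(g k)(r + 3 := ones (?f k))"
    have "?f k \<le> value_bound s ?M" using r[OF k] h(5) Sum.prems(2) by (intro val_le_value_bound) auto
    moreover have "time ?p ?h \<le> (2 + 3) * length (?h (r + 3)) + 1" by (rule time_Loop_const) simp
    ultimately show "time ?c (g k) \<le> time_bound s ?M + 5 * value_bound s ?M + 3"
      unfolding time.simps(4) x[OF k] time.simps(2) using conjunct2[OF IH2[OF k]] by (simp del: time.simps)
  qed (use h(1-4) in \<open>auto simp: g_def fun_eq_iff\<close>)
  moreover have "time (Loop (r + 2) Skip) (g ?n) \<le> (0 + 3) * length (g ?n (r + 2)) + 1"
    by (rule time_Loop_const) simp
  moreover have "length (g ?n (r + 2)) = ?n" by (simp add: g_def)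
  ultimately have "time (Loop (r + 1) ?c) ?\<tau> + time (Loop (r + 2) Skip) (g ?n)
     \<le> (time_bound s ?M + 5 * value_bound s ?M + 9) * ?n + 2" by (simp del: time.simps add: algebra_simps)
  also have "\<dots> \<le> (time_bound s ?M + 5 * value_bound s ?M + 9) * value_bound t M + 2" using n by simp
  finally have "time (eval_code (Sum t s) vs r) \<sigma> \<le> time_bound (Sum t s) M"
    unfolding eval_code.simps time.simps(4)[of "eval_code t vs (r + 1)"]
     time.simps(4)[of "Loop (r + 1) ?c"] 1 2 time_bound.simps using conjunct2[OF IH1] by linarith
  moreover have "exec (eval_code (Sum t s) vs r) \<sigma> = \<sigma>(r := ones (val w (Sum t s) \<rho>))"
    unfolding eval_code.simps exec.simps(4)[of "eval_code t vs (r + 1)"]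
     exec.simps(4)[of "Loop (r + 1) ?c"] 1 2 exec_clear g_def using h by (auto simp: fun_eq_iff)
  ultimately show ?case by blast
qed

text \<open>From 2 on, a single power of \<open>M\<close> absorbs all constants and lower terms, so
  no coefficients have to be tracked and composition just multiplies exponents.\<close>

definition poly_bounded :: "(nat \<Rightarrow> nat) \<Rightarrow> bool" where
  "poly_bounded f \<longleftrightarrow> (\<exists>k. \<forall>M\<ge>2. f M \<le> M ^ k)"

lemma poly_bounded_const: "poly_bounded (\<lambda>M. c)"
  unfolding poly_bounded_def
proof (intro exI[of _ c] allI impI)
  fix M :: nat assume "2 \<le> M"
  have "c \<le> 2 ^ c" by (simp add: less_imp_le)
  also have "\<dots> \<le> M ^ c" using \<open>2 \<le> M\<close> by (rule power_mono) simp
  finally show "c \<le> M ^ c" .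
qed

lemma poly_bounded_id: "poly_bounded (\<lambda>M. M)"
  unfolding poly_bounded_def by (intro exI[of _ 1]) simp

lemma poly_bounded_mult: "poly_bounded f \<Longrightarrow> poly_bounded g \<Longrightarrow> poly_bounded (\<lambda>M. f M * g M)"
proof -
  assume "poly_bounded f" "poly_bounded g"
  then obtain k l where "\<forall>M\<ge>2. f M \<le> M ^ k" "\<forall>M\<ge>2. g M \<le> M ^ l" unfolding poly_bounded_def by blast
  then show ?thesis unfolding poly_bounded_def
    by (intro exI[of _ "k + l"]) (auto simp: power_add intro: mult_le_mono)
qed

lemma poly_bounded_add: "poly_bounded f \<Longrightarrow> poly_bounded g \<Longrightarrow> poly_bounded (\<lambda>M. f M + g M)"
proof -
  assume "poly_bounded f" "poly_bounded g"
  then obtain k l where kl: "\<forall>M\<ge>2. f M \<le> M ^ k"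
    "\<forall>M\<ge>2. g M \<le> M ^ l" unfolding poly_bounded_def by blast
  show ?thesis unfolding poly_bounded_def
  \<comment> \<open>Both summands are at most \<open>M ^ (k + l)\<close>, and one more factor
    \<open>M\<close> absorbs the resulting 2.\<close>
  proof (intro exI[of _ "k + l + 1"] allI impI)
    fix M :: nat assume M: "2 \<le> M"
    have "M ^ k \<le> M ^ (k + l)" "M ^ l \<le> M ^ (k + l)" using M by (simp_all add: power_increasing)
    then have "f M + g M \<le> M ^ (k + l) * 2"
      using add_mono[OF order_trans[OF kl(1)[rule_format, OF M]] order_trans[OF kl(2)[rule_format, OF M]]]
      by (simp add: mult_2_right)
    also have "\<dots> \<le> M ^ (k + l) * M" using M by (intro mult_le_mono) auto
    finally show "f M + g M \<le> M ^ (k + l + 1)" by (simp add: mult.commute)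
  qed
qed

lemma poly_bounded_comp:
  assumes f: "poly_bounded f" and g: "poly_bounded g"
  shows "poly_bounded (\<lambda>M. f (M + g M))"
proof -
  obtain k where k: "\<forall>M\<ge>2. f M \<le> M ^ k" using f unfolding poly_bounded_def by blast
  obtain l where l: "\<forall>M\<ge>2. M + g M \<le> M ^ l"
    using poly_bounded_add[OF poly_bounded_id g] unfolding poly_bounded_def by blast
  have "f (M + g M) \<le> M ^ (l * k)" if "M \<ge> 2" for M
  proof -
    have "f (M + g M) \<le> (M + g M) ^ k" using k that by simp
    also have "\<dots> \<le> (M ^ l) ^ k" using l that by (intro power_mono) auto
    finally show ?thesis by (simp add: power_mult)
  qed
  then show ?thesis unfolding poly_bounded_def by blast
qed

lemmas poly_bounded_intros = poly_bounded_const poly_bounded_id poly_bounded_mult poly_bounded_add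

lemma poly_bounded_value_bound: "poly_bounded (value_bound t)"
proof (induction t)
  case (Sum t s)
  show ?case using poly_bounded_mult[OF Sum(1) poly_bounded_comp[OF Sum(2,1)]] by simp
qed (auto intro: poly_bounded_intros)

lemma poly_bounded_time_bound: "poly_bounded (time_bound t)"
proof (induction t)
  case (Sum t s)
  note v = poly_bounded_value_bound
  show ?case unfolding time_bound.simps
    by (intro poly_bounded_add poly_bounded_mult poly_bounded_const Sum v poly_bounded_comp)
qed (auto simp only: time_bound.simps intro!: poly_bounded_intros poly_bounded_value_bound)

text \<open>Free variables of a term evaluated by the machine have the value 0, read off the empty register 1.\<close>

theorem trm_machine:
  obtains M and p :: "nat poly" where "turing_machine M"
    "\<And>w. set w \<subseteq> {1, 2, 3} \<Longrightarrow> halts_within M w (poly p (length w))"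
    "\<And>w. set w \<subseteq> {1, 2, 3} \<Longrightarrow> accepts M w \<longleftrightarrow> val w t (\<lambda>_. 0) \<noteq> 0"
proof -
  let ?c = "eval_code t (\<lambda>_. 1) 2"
  have "wf_com ?c" by (rule wf_eval_code[of _ 2]) auto
  then obtain M where M: "turing_machine M"
    "\<And>w. set w \<subseteq> {1, 2, 3} \<Longrightarrow>
       (\<forall>n \<ge> time ?c (word_store w) + 2. state_after M w n = (if top_symbol (exec ?c (word_store w) 2) = 1 then 1 else 2)) \<and>
       (accepts M w \<longleftrightarrow> top_symbol (exec ?c (word_store w) 2) = 1)"
    by (rule com_machine[where res = 2]) blast
  obtain k where k: "\<forall>M\<ge>2. time_bound t M + 2 \<le> M ^ k"
    using poly_bounded_add[OF poly_bounded_time_bound poly_bounded_const] unfolding poly_bounded_def by blast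
  \<comment> \<open>This is the polynomial \<open>(X + 2) ^ k\<close>; the shift by 2 makes the
    bounds apply to words shorter than 2 as well.\<close>
  let ?p = "[:2, 1:] ^ k :: nat poly"
  have e: "env_store w (\<lambda>_. 0) (\<lambda>_. 1) 2 (word_store w)" if "set w \<subseteq> {1, 2, 3}" for w
    using that by (auto simp: env_store_def word_store_def)
  have x: "exec ?c (word_store w) 2 = ones (val w t (\<lambda>_. 0))" if "set w \<subseteq> {1, 2, 3}" for w
    using eval_code_correct[OF e[OF that], of "length w" t] by simp
  show thesis
  proof (rule that[OF M(1)])
    fix w :: "nat list" assume w: "set w \<subseteq> {1, 2, 3}"
    have "time ?c (word_store w) \<le> time_bound t (length w + 2)"
      using eval_code_correct[OF e[OF w], of "length w + 2" t] by simp
    also have "time_bound t (length w + 2) + 2 \<le> (length w + 2) ^ k" using k by simp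
    finally have "time ?c (word_store w) + 2 \<le> (length w + 2) ^ k" by simp
    moreover have "poly ?p (length w) = (length w + 2) ^ k" by (simp add: poly_power add.commute)
    ultimately show "halts_within M w (poly ?p (length w))"
      using M(2)[OF w] unfolding halts_within_def by auto
    show "accepts M w \<longleftrightarrow> val w t (\<lambda>_. 0) \<noteq> 0"
      using M(2)[OF w] unfolding x[OF w] top_symbol_ones by auto
  qed
qed

section \<open>A criterion for membership in NP\<close>

text \<open>A shallow embedding: formulas remain HOL expressions, and the closure rules build the
  underlying term by following their shape, so that the verifier needs no explicit term.\<close>

definition definable :: "(nat list \<Rightarrow> (nat \<Rightarrow> nat) \<Rightarrow> nat) \<Rightarrow> bool" where
  "definable f \<longleftrightarrow> (\<exists>t. \<forall>w \<rho>. val w t \<rho> = f w \<rho>)"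

definition decidable :: "(nat list \<Rightarrow> (nat \<Rightarrow> nat) \<Rightarrow> bool) \<Rightarrow> bool" where
  "decidable P \<longleftrightarrow> definable (\<lambda>w \<rho>. of_bool (P w \<rho>))"

definition symbol_at :: "nat list \<Rightarrow> nat \<Rightarrow> nat" where
  "symbol_at w i = (if i < length w then w ! i else 0)"

lemma definable_var: "definable (\<lambda>w \<rho>. \<rho> k)"
  unfolding definable_def by (rule exI[of _ "Var k"]) simp

lemma definable_const: "definable (\<lambda>w \<rho>. c)"
  unfolding definable_def by (rule exI[of _ "Cst c"]) simp

lemma definable_length: "definable (\<lambda>w \<rho>. length w)"
  unfolding definable_def by (rule exI[of _ Len]) simp

lemma definable_symbol_at: "definable f \<Longrightarrow> definable (\<lambda>w \<rho>. symbol_at w (f w \<rho>))"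
  unfolding definable_def symbol_at_def by (metis val.simps(4))

lemma definable_add: "definable f \<Longrightarrow> definable g \<Longrightarrow> definable (\<lambda>w \<rho>. f w \<rho> + g w \<rho>)"
  unfolding definable_def by (metis val.simps(5))

lemma definable_mult: "definable f \<Longrightarrow> definable g \<Longrightarrow> definable (\<lambda>w \<rho>. f w \<rho> * g w \<rho>)"
  unfolding definable_def by (metis val.simps(6))

lemma definable_Suc: "definable f \<Longrightarrow> definable (\<lambda>w \<rho>. Suc (f w \<rho>))"
  using definable_add[OF _ definable_const[of 1], of f] by simp

lemma definable_power: "definable f \<Longrightarrow> definable (\<lambda>w \<rho>. f w \<rho> ^ k)"
  by (induction k) (auto intro: definable_const definable_mult)

lemma decidable_le: "definable f \<Longrightarrow> definable g \<Longrightarrow> decidable (\<lambda>w \<rho>. f w \<rho> \<le> g w \<rho>)"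
  unfolding decidable_def definable_def by (metis val.simps(7))

text \<open>The second premise is the body under the binder: the summation variable is index 0 and
  the outer variables are shifted by one.\<close>

lemma definable_sum:
  assumes "definable f" "definable (\<lambda>w \<rho>. g w (\<lambda>k. \<rho> (Suc k)) (\<rho> 0))"
  shows "definable (\<lambda>w \<rho>. \<Sum>a<f w \<rho>. g w \<rho> a)"
proof -
  obtain t s where "\<forall>w \<rho>. val w t \<rho> = f w \<rho>" "\<forall>w \<rho>. val w s \<rho> = g w (\<lambda>k. \<rho> (Suc k)) (\<rho> 0)"
    using assms unfolding definable_def by blast
  then show ?thesis unfolding definable_def by (intro exI[of _ "Sum t s"]) simp
qed

primrec rename :: "(nat \<Rightarrow> nat) \<Rightarrow> trm \<Rightarrow> trm" where
  "rename h (Var k) = Var (h k)"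
| "rename h (Cst c) = Cst c"
| "rename h Len = Len"
| "rename h (Sym t) = Sym (rename h t)"
| "rename h (Add t s) = Add (rename h t) (rename h s)"
| "rename h (Mul t s) = Mul (rename h t) (rename h s)"
| "rename h (Leq t s) = Leq (rename h t) (rename h s)"
| "rename h (Sum t s) = Sum (rename h t) (rename (case_nat 0 (\<lambda>k. Suc (h k))) s)"

lemma val_rename: "val w (rename h t) \<rho> = val w t (\<lambda>k. \<rho> (h k))"
proof (induction t arbitrary: h \<rho>)
  case (Sum t s)
  have "(\<lambda>k. case_nat a \<rho> (case_nat 0 (\<lambda>k. Suc (h k)) k)) = case_nat a (\<lambda>k. \<rho> (h k))" for a
    by (auto simp: fun_eq_iff split: nat.split)
  then show ?case by (simp add: Sum)
qed simp_all

text \<open>Used where an argument function stands below a binder that it does not mention, as the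
  index does in \<open>certificate\<close>.\<close>

lemma definable_weaken: "definable f \<Longrightarrow> definable (\<lambda>w \<rho>. f w (\<lambda>k. \<rho> (Suc k)))"
  unfolding definable_def by (metis val_rename)

lemma definable_of_bool: "decidable P \<Longrightarrow> definable (\<lambda>w \<rho>. of_bool (P w \<rho>))"
  unfolding decidable_def .

lemma decidable_not: "decidable P \<Longrightarrow> decidable (\<lambda>w \<rho>. \<not> P w \<rho>)"
proof -
  assume "decidable P"
  then have "decidable (\<lambda>w \<rho>. of_bool (P w \<rho>) \<le> (0::nat))"
    by (intro decidable_le definable_const) (simp add: decidable_def)
  then show ?thesis by simp
qed

lemma decidable_conj: "decidable P \<Longrightarrow> decidable Q \<Longrightarrow> decidable (\<lambda>w \<rho>. P w \<rho> \<and> Q w \<rho>)"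
  unfolding decidable_def using definable_mult[of "\<lambda>w \<rho>. of_bool (P w \<rho>)" "\<lambda>w \<rho>. of_bool (Q w \<rho>)"]
  by (simp add: of_bool_conj)

lemma decidable_disj: "decidable P \<Longrightarrow> decidable Q \<Longrightarrow> decidable (\<lambda>w \<rho>. P w \<rho> \<or> Q w \<rho>)"
proof -
  assume "decidable P" "decidable Q"
  then have "decidable (\<lambda>w \<rho>. \<not> (\<not> P w \<rho> \<and> \<not> Q w \<rho>))" by (intro decidable_not decidable_conj)
  then show ?thesis by simp
qed

lemma decidable_imp: "decidable P \<Longrightarrow> decidable Q \<Longrightarrow> decidable (\<lambda>w \<rho>. P w \<rho> \<longrightarrow> Q w \<rho>)"
  unfolding imp_conv_disj by (intro decidable_disj decidable_not)

lemma decidable_less: "definable f \<Longrightarrow> definable g \<Longrightarrow> decidable (\<lambda>w \<rho>. f w \<rho> < g w \<rho>)"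
  unfolding not_le[symmetric] by (intro decidable_not decidable_le)

lemma decidable_eq: "definable f \<Longrightarrow> definable g \<Longrightarrow> decidable (\<lambda>w \<rho>. f w \<rho> = g w \<rho>)"
  unfolding eq_iff by (intro decidable_conj decidable_le)

lemma decidable_ex:
  assumes "definable f" "decidable (\<lambda>w \<rho>. P w (\<lambda>k. \<rho> (Suc k)) (\<rho> 0))"
  shows "decidable (\<lambda>w \<rho>. \<exists>a<f w \<rho>. P w \<rho> a)"
proof -
  have "decidable (\<lambda>w \<rho>. 1 \<le> (\<Sum>a<f w \<rho>. of_bool (P w \<rho> a) :: nat))"
    using assms by (intro decidable_le definable_const definable_sum definable_of_bool)
  moreover have "1 \<le> (\<Sum>a<m. of_bool (Q a) :: nat) \<longleftrightarrow> (\<exists>a<m. Q a)" for m :: nat and Q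
  proof -
    have "(\<Sum>a<m. of_bool (Q a) :: nat) = 0 \<longleftrightarrow> \<not> (\<exists>a<m. Q a)" by (subst sum_eq_0_iff) auto
    then show ?thesis by (metis One_nat_def Suc_leI less_one not_gr_zero not_le)
  qed
  ultimately show ?thesis by simp
qed

lemma decidable_all:
  assumes "definable f" "decidable (\<lambda>w \<rho>. P w (\<lambda>k. \<rho> (Suc k)) (\<rho> 0))"
  shows "decidable (\<lambda>w \<rho>. \<forall>a<f w \<rho>. P w \<rho> a)"
proof -
  have "decidable (\<lambda>w \<rho>. \<not> (\<exists>a<f w \<rho>. \<not> P w \<rho> a))"
    using assms by (intro decidable_not decidable_ex)
  then show ?thesis by simp
qed

lemma definable_if:
  assumes "decidable P" "definable f" "definable g"
  shows "definable (\<lambda>w \<rho>. if P w \<rho> then f w \<rho> else g w \<rho>)"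
proof -
  have "definable (\<lambda>w \<rho>. of_bool (P w \<rho>) * f w \<rho> + of_bool (\<not> P w \<rho>) * g w \<rho>)"
    using assms by (intro definable_add definable_mult definable_of_bool decidable_not)
  moreover have "of_bool b * m + of_bool (\<not> b) * k = (if b then m else k)" for b and m k :: nat by simp
  ultimately show ?thesis by simp
qed

lemma decidable_if:
  assumes "decidable P" "decidable Q" "decidable S"
  shows "decidable (\<lambda>w \<rho>. if P w \<rho> then Q w \<rho> else S w \<rho>)"
proof -
  have "decidable (\<lambda>w \<rho>. (P w \<rho> \<and> Q w \<rho>) \<or> (\<not> P w \<rho> \<and> S w \<rho>))"
    using assms by (intro decidable_disj decidable_conj decidable_not)
  moreover have "((a \<and> b) \<or> (\<not> a \<and> c)) = (if a then b else c)" for a b c by auto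
  ultimately show ?thesis by simp
qed

section \<open>Reading the input and the certificate off the machine word\<close>

definition input_length :: "nat list \<Rightarrow> nat" where
  "input_length w = (\<Sum>i<length w. of_bool (\<forall>j<Suc i. symbol_at w j \<noteq> 3))"

definition input_bit :: "nat list \<Rightarrow> nat \<Rightarrow> bool" where
  "input_bit w i \<longleftrightarrow> i < input_length w \<and> symbol_at w i = 2"

text \<open>A certificate is read as a sequence of small numbers, each given by the number of ones in a
  block of fixed length.\<close>

definition certificate :: "nat \<Rightarrow> nat list \<Rightarrow> nat \<Rightarrow> nat" where
  "certificate b w i = (\<Sum>j<(input_length w + 2) ^ b.
     of_bool (symbol_at w (input_length w + 1 + (i * (input_length w + 2) ^ b + j)) = 2))"

definition bit_at :: "bool list \<Rightarrow> nat \<Rightarrow> bool" where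
  "bit_at x i \<longleftrightarrow> i < length x \<and> x ! i"

lemma definable_input_length: "definable (\<lambda>w \<rho>. input_length w)"
  unfolding input_length_def
  by (intro definable_sum definable_length definable_of_bool decidable_all definable_Suc definable_var
      decidable_not decidable_eq definable_symbol_at definable_const)

lemma decidable_input_bit: "definable f \<Longrightarrow> decidable (\<lambda>w \<rho>. input_bit w (f w \<rho>))"
  unfolding input_bit_def
  by (intro decidable_conj decidable_less decidable_eq definable_symbol_at definable_const definable_input_length)

lemma definable_certificate: "definable f \<Longrightarrow> definable (\<lambda>w \<rho>. certificate b w (f w \<rho>))"
  unfolding certificate_def
  by (intro definable_sum definable_power definable_add definable_mult definable_of_bool decidable_eq
      definable_symbol_at definable_const definable_input_length definable_var definable_weaken)

lemmas definable_intros = definable_const definable_var definable_add definable_mult definable_power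
  definable_sum definable_of_bool definable_if decidable_le decidable_less decidable_eq
  decidable_not decidable_conj decidable_disj decidable_imp decidable_ex decidable_all decidable_if
  definable_input_length decidable_input_bit definable_certificate

lemma symbol_at_pair_word:
  "symbol_at (pair_word x y) i =
     (if i < length x then bit_symbol (x ! i) else if i = length x then 3
      else if i < length x + 1 + length y then bit_symbol (y ! (i - length x - 1)) else 0)"
  unfolding symbol_at_def pair_word_def by (auto simp: nth_append nth_Cons')

text \<open>The sum counts the positions up to which no separator has occurred, and their number is
  the position of the first separator.\<close>

lemma input_length_pair_word: "input_length (pair_word x y) = length x"
proof -
  have s: "(\<forall>j<Suc i. symbol_at (pair_word x y) j \<noteq> 3) \<longleftrightarrow> i < length x" for i
  proof
    assume "\<forall>j<Suc i. symbol_at (pair_word x y) j \<noteq> 3"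
    then show "i < length x" by (rule contrapos_pp) (auto simp: symbol_at_pair_word intro!: exI[of _ "length x"])
  qed (auto simp: symbol_at_pair_word bit_symbol_def)
  have "input_length (pair_word x y) = (\<Sum>i<length (pair_word x y). of_bool (i < length x))"
    unfolding input_length_def s ..
  also have "\<dots> = card ({..<length (pair_word x y)} \<inter> {i. i < length x})"
    by (simp add: of_bool_def sum.If_cases)
  also have "{..<length (pair_word x y)} \<inter> {i. i < length x} = {..<length x}"
    by (auto simp: pair_word_def)
  finally show ?thesis by simp
qed

lemma input_bit_pair_word: "input_bit (pair_word x y) = bit_at x"
  by (auto simp: fun_eq_iff input_bit_def input_length_pair_word bit_at_def symbol_at_pair_word bit_symbol_def)

text \<open>Block \<open>i\<close> consists of \<open>f i\<close> ones followed by zeros. Behind the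
  end of the certificate only blanks are read, which gives the value 0 from index
  \<open>(length x + 2) ^ c\<close> on.\<close>

lemma certificate_exists:
  assumes "\<And>i. f i \<le> (length x + 2) ^ b" "\<And>i. (length x + 2) ^ c \<le> i \<Longrightarrow> f i = 0"
  obtains y where "length y = (length x + 2) ^ (c + b)" "certificate b (pair_word x y) = f"
proof -
  let ?B = "(length x + 2) ^ b" and ?I = "(length x + 2) ^ c"
  define y where "y = map (\<lambda>k. k mod ?B < f (k div ?B)) [0..<?I * ?B]"
  have B: "?B > 0" by simp
  have "certificate b (pair_word x y) i = f i" for i
  proof -
    have s: "symbol_at (pair_word x y) (length x + 1 + k) = 2 \<longleftrightarrow> k < ?I * ?B \<and> k mod ?B < f (k div ?B)" for k
      by (auto simp: symbol_at_pair_word y_def bit_symbol_def)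
    have "certificate b (pair_word x y) i = (\<Sum>j<?B. of_bool (j < f i))"
      unfolding certificate_def input_length_pair_word s
    proof (rule sum.cong[OF refl])
      fix j assume "j \<in> {..<?B}"
      then have j: "j < ?B" by simp
      have d: "(i * ?B + j) div ?B = i" "(i * ?B + j) mod ?B = j" using j by simp_all
      show "of_bool (i * ?B + j < ?I * ?B \<and> (i * ?B + j) mod ?B < f ((i * ?B + j) div ?B)) = (of_bool (j < f i) :: nat)"
      proof (cases "i < ?I")
        case True
        then have "Suc i * ?B \<le> ?I * ?B" by (intro mult_le_mono1) simp
        then have "i * ?B + j < ?I * ?B" using j by simp
        then show ?thesis unfolding d by simp
      next
        case False
        then show ?thesis unfolding d using assms(2)[of i] by simp
      qed
    qed
    also have "\<dots> = card ({..<?B} \<inter> {j. j < f i})"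
      by (simp add: of_bool_def sum.If_cases)
    also have "{..<?B} \<inter> {j. j < f i} = {..<f i}" using assms(1)[of i] by auto
    finally show ?thesis by simp
  qed
  then show ?thesis using that[of y] by (auto simp: y_def power_add fun_eq_iff)
qed

lemma set_pair_word: "set (pair_word x y) \<subseteq> {1, 2, 3}"
  by (auto simp: pair_word_def bit_symbol_def)

text \<open>Every word decodes to some sequence, so no certificate is malformed, and soundness is
  demanded of all sequences \<open>f\<close>. Completeness has to supply one within the bounds, so
  that it fits into a certificate of length \<open>(length x + 2) ^ (c + b)\<close>.\<close>

theorem NP_by_certificate:
  assumes dec: "decidable (\<lambda>w \<rho>. R (input_length w) (input_bit w) (certificate b w))"
    and sound: "\<And>x f. R (length x) (bit_at x) f \<Longrightarrow> x \<in> L"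
    and complete: "\<And>x. x \<in> L \<Longrightarrow> \<exists>f. (\<forall>i. f i \<le> (length x + 2) ^ b) \<and>
        (\<forall>i\<ge>(length x + 2) ^ c. f i = 0) \<and> R (length x) (bit_at x) f"
  shows "L \<in> NP"
proof -
  obtain t where t: "\<And>w \<rho>. val w t \<rho> = of_bool (R (input_length w) (input_bit w) (certificate b w))"
    using dec unfolding decidable_def definable_def by blast
  obtain M p where M: "turing_machine M"
    and halts: "\<And>w. set w \<subseteq> {1, 2, 3} \<Longrightarrow> halts_within M w (poly p (length w))"
    and acc: "\<And>w. set w \<subseteq> {1, 2, 3} \<Longrightarrow> accepts M w \<longleftrightarrow> val w t (\<lambda>_. 0) \<noteq> 0"
    by (rule trm_machine[of t]) blast
  have a: "accepts M (pair_word x y) \<longleftrightarrow> R (length x) (bit_at x) (certificate b (pair_word x y))" for x y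
    using acc[OF set_pair_word] by (simp add: t input_length_pair_word input_bit_pair_word)
  let ?q = "[:2, 1:] ^ (c + b) :: nat poly"
  have q: "poly ?q m = (m + 2) ^ (c + b)" for m by (simp add: poly_power add.commute)
  have "x \<in> L \<longleftrightarrow> (\<exists>y. length y \<le> poly ?q (length x) \<and> accepts M (pair_word x y))" for x
  proof
    assume "x \<in> L"
    then obtain f where "\<And>i. f i \<le> (length x + 2) ^ b" "\<And>i. (length x + 2) ^ c \<le> i \<Longrightarrow> f i = 0"
      and R: "R (length x) (bit_at x) f" using complete by blast
    then obtain y where "length y = (length x + 2) ^ (c + b)" "certificate b (pair_word x y) = f"
      using certificate_exists by metis
    then show "\<exists>y. length y \<le> poly ?q (length x) \<and> accepts M (pair_word x y)"
      using R unfolding a q by (intro exI[of _ y]) simp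
  qed (auto simp: a intro: sound)
  then show ?thesis unfolding NP_def using M halts[OF set_pair_word] by blast
qed

section \<open>Closed walks\<close>

definition transition :: "(nat \<Rightarrow> 'v) \<Rightarrow> nat \<Rightarrow> 'v \<times> 'v \<times> 'v" where
  "transition w k = (w k, w (k + 1), w (k + 2))"

text \<open>The closed walk is unrolled with its first two vertices repeated at the end. Transitions
  with index below \<open>l\<close> then read positions up to \<open>l + 1\<close>, and no index has
  to be reduced modulo the length.\<close>

definition cyclic :: "nat \<Rightarrow> (nat \<Rightarrow> 'v) \<Rightarrow> bool" where
  "cyclic l w \<longleftrightarrow> 1 \<le> l \<and> w l = w 0 \<and> w (l + 1) = w 1"

lemma cyclic_walk_vertex:
  assumes "W \<noteq> []"
  shows "cyclic (length W) (walk_vertex W)" "map (walk_vertex W) [0..<length W] = W"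
  using assms by (auto simp: cyclic_def walk_vertex_def Suc_le_eq mod_Suc intro: nth_equalityI)

lemma walk_vertex_map:
  assumes "cyclic l w" "k \<le> l + 1"
  shows "walk_vertex (map w [0..<l]) k = w k"
proof -
  \<comment> \<open>For \<open>l = 1\<close> the index \<open>l + 1\<close> reduces to 0 and not to
    1.\<close>
  consider "k < l" | "k = l" | "k = l + 1" "l = 1" | "k = l + 1" "l \<ge> 2"
    using assms by (auto simp: cyclic_def) linarith
  then show ?thesis
  proof cases
    case 4
    then have "k mod l = 1" by (simp add: mod_Suc)
    then show ?thesis using 4 assms by (simp add: walk_vertex_def cyclic_def)
  qed (use assms in \<open>auto simp: walk_vertex_def cyclic_def\<close>)
qed

text \<open>Two transitions straddle the cut, and they survive because two consecutive vertices
  agree on both sides; agreement in one vertex alone could create a new transition.\<close>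

lemma transition_cut:
  assumes "i < j" "w i = w j" "w (i + 1) = w (j + 1)"
  defines "u \<equiv> \<lambda>k. if k < i then w k else w (k + (j - i))"
  shows "transition u k = transition w (if k < i then k else k + (j - i))"
proof -
  consider "k + 2 < i" | "k + 2 = i" | "k + 1 = i" | "i \<le> k" by linarith
  then show ?thesis using assms by cases (auto simp: transition_def)
qed

lemma cyclic_cut:
  assumes "cyclic l w" "i < j" "j < l" "w i = w j" "w (i + 1) = w (j + 1)"
  shows "cyclic (l - (j - i)) (\<lambda>k. if k < i then w k else w (k + (j - i)))"
proof -
  \<comment> \<open>For \<open>i\<close> at most 1 the cut moves the values at 0 or 1 with which the
    end of the walk is compared.\<close>
  have "i = 0 \<or> i = 1 \<or> 1 < i" by linarith
  then show ?thesis using assms by (auto simp: cyclic_def)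
qed

text \<open>A closed walk may be cut between two occurrences of the same directed edge, provided that
  every transition lost also occurs earlier. If the walk is long, the pigeonhole principle yields
  two such occurrences with no first occurrence of a transition in between.\<close>

lemma shorten_cyclic:
  fixes w :: "nat \<Rightarrow> 'v" and c :: "'v \<times> 'v \<times> 'v \<Rightarrow> real"
  assumes "finite V" "cyclic l w" "\<And>k. k < l \<Longrightarrow> w k \<in> V" "\<And>k. k < l \<Longrightarrow> 0 \<le> c (transition w k)"
  shows "\<exists>l' u. l' \<le> card V ^ 2 * (card V ^ 3 + 1) \<and> cyclic l' u \<and>
    transition u ` {..<l'} = transition w ` {..<l} \<and>
    (\<Sum>k<l'. c (transition u k)) \<le> (\<Sum>k<l. c (transition w k))"
  using assms(2-)
proof (induction l arbitrary: w rule: less_induct)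
  case (less l)
  let ?N = "card V ^ 2 * (card V ^ 3 + 1)"
  show ?case
  proof (cases "l \<le> ?N")
    case True
    then show ?thesis using less.prems by blast
  next
    case False
    have wV: "w k \<in> V" if "k \<le> l + 1" for k
    proof -
      have "k < l \<or> k = l \<or> k = l + 1" using that by linarith
      moreover have "w l \<in> V" using less.prems by (auto simp: cyclic_def)
      moreover have "w (l + 1) \<in> V" using less.prems \<open>w l \<in> V\<close>
        by (cases "l = 1") (auto simp: cyclic_def)
      ultimately show ?thesis using less.prems by auto
    qed
    \<comment> \<open>Each transition has one index of first occurrence, so this set has at most as
      many elements as there are triples of vertices.\<close>
    define first where "first = {k. k < l \<and> (\<forall>m<k. transition w m \<noteq> transition w k)}"
    have fin: "finite first" by (simp add: first_def)
    have "inj_on (transition w) first"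
    proof (rule inj_onI)
      fix a b assume "a \<in> first" "b \<in> first" "transition w a = transition w b"
      then show "a = b" unfolding first_def by (metis (mono_tags, lifting) mem_Collect_eq linorder_neqE_nat)
    qed
    moreover have "transition w ` first \<subseteq> V \<times> V \<times> V"
      using wV by (auto simp: transition_def first_def)
    ultimately have "card first \<le> card (V \<times> V \<times> V)"
      using assms(1) by (intro card_inj_on_le) auto
    then have cf: "card first \<le> card V ^ 3"
      by (simp add: card_cartesian_product power3_eq_cube)
    \<comment> \<open>Equal keys at \<open>i < j\<close> mean the same directed edge and no first
      occurrence from \<open>i\<close> up to \<open>j - 1\<close>. There are
      \<open>card V ^ 2\<close> pairs of vertices and \<open>card V ^ 3 + 1\<close> counts, which is
      where \<open>?N\<close> comes from.\<close>
    define key where "key = (\<lambda>k. (w k, w (k + 1), card (first \<inter> {..<k})))"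
    have "key ` {..<l} \<subseteq> V \<times> V \<times> {..card V ^ 3}"
    proof
      fix z assume "z \<in> key ` {..<l}"
      then obtain k where k: "k < l" "z = key k" by auto
      have "card (first \<inter> {..<k}) \<le> card first" using fin by (intro card_mono) auto
      then show "z \<in> V \<times> V \<times> {..card V ^ 3}" using k cf wV[of k] wV[of "k + 1"] by (simp add: key_def)
    qed
    then have "card (key ` {..<l}) \<le> card (V \<times> V \<times> {..card V ^ 3})"
      using assms(1) by (intro card_mono) auto
    also have "\<dots> = ?N" by (simp add: card_cartesian_product power2_eq_square algebra_simps)
    finally have "\<not> inj_on key {..<l}" using False card_image[of key "{..<l}"] by auto
    then obtain i j where ij: "i < j" "j < l" "key i = key j"
    proof -
      obtain a b where "a < l" "b < l" "a \<noteq> b" "key a = key b"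
        using \<open>\<not> inj_on key {..<l}\<close> unfolding inj_on_def by auto
      then show ?thesis using that[of a b] that[of b a] by (cases "a < b") auto
    qed
    have wij: "w i = w j" "w (i + 1) = w (j + 1)" using ij(3) by (simp_all add: key_def)
    have none: "k \<notin> first" if "i \<le> k" "k < j" for k
    proof
      assume "k \<in> first"
      then have "k \<in> first \<inter> {..<j}" "k \<notin> first \<inter> {..<i}" using that by auto
      moreover have "first \<inter> {..<i} \<subseteq> first \<inter> {..<j}" using ij(1) by auto
      ultimately have "first \<inter> {..<i} \<subset> first \<inter> {..<j}" by blast
      then have "card (first \<inter> {..<i}) < card (first \<inter> {..<j})"
        using fin by (intro psubset_card_mono) auto
      then show False using ij(3) by (simp add: key_def)
    qed
    have earlier: "\<exists>m<i. transition w m = transition w k" if "i \<le> k" "k < j" for k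
    proof -
      define m where "m = (LEAST m. transition w m = transition w k)"
      have m: "transition w m = transition w k" unfolding m_def by (rule LeastI) simp
      have "m \<le> k" unfolding m_def by (rule Least_le) simp
      moreover have "transition w m' \<noteq> transition w m" if "m' < m" for m'
        using not_less_Least[of m' "\<lambda>m. transition w m = transition w k"] that m unfolding m_def by simp
      ultimately have "m \<in> first" using that ij(2) by (auto simp: first_def)
      then have "m < i" using none \<open>m \<le> k\<close> that by (meson le_less_trans not_le)
      then show ?thesis using m by blast
    qed
    let ?d = "j - i"
    define u where "u = (\<lambda>k. if k < i then w k else w (k + ?d))"
    \<comment> \<open>The position in \<open>w\<close> of the transition that \<open>u\<close> has
      at \<open>k\<close>. It is injective, so the new cost is a partial sum of the old, nonnegative
      terms.\<close>
    define h where "h = (\<lambda>k. if k < i then k else k + ?d)"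
    have tu: "transition u k = transition w (h k)" for k
      using transition_cut[OF ij(1) wij] by (simp add: u_def h_def)
    have cu: "cyclic (l - ?d) u" unfolding u_def using cyclic_cut less.prems(1) ij wij by blast
    have hl: "h ` {..<l - ?d} \<subseteq> {..<l}" and hinj: "inj_on h {..<l - ?d}"
      using ij by (auto simp: h_def inj_on_def)
    have "transition u ` {..<l - ?d} = transition w ` (h ` {..<l - ?d})"
      by (simp add: image_image tu)
    also have "\<dots> = transition w ` {..<l}"
    proof
      show "transition w ` {..<l} \<subseteq> transition w ` (h ` {..<l - ?d})"
      proof
        fix z assume "z \<in> transition w ` {..<l}"
        then obtain k where k: "k < l" "z = transition w k" by auto
        obtain k' where k': "k' < l" "z = transition w k'" "k' < i \<or> j \<le> k'"
          using earlier[of k] k ij by (metis less_trans not_le)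
        have "h (if k' < i then k' else k' - ?d) = k'" "(if k' < i then k' else k' - ?d) < l - ?d"
          using k' ij by (auto simp: h_def)
        then show "z \<in> transition w ` (h ` {..<l - ?d})" using k'(2) by (metis imageI lessThan_iff)
      qed
    qed (use hl in auto)
    finally have tr: "transition u ` {..<l - ?d} = transition w ` {..<l}" .
    have "(\<Sum>k<l - ?d. c (transition u k)) = (\<Sum>k\<in>h ` {..<l - ?d}. c (transition w k))"
      using hinj by (simp add: sum.reindex tu)
    also have "\<dots> \<le> (\<Sum>k<l. c (transition w k))"
      using hl less.prems(3) by (intro sum_mono2) auto
    finally have cost: "(\<Sum>k<l - ?d. c (transition u k)) \<le> (\<Sum>k<l. c (transition w k))" .
    have "l - ?d < l" using ij by linarith
    moreover have "u k \<in> V" if "k < l - ?d" for k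
      using wV[of "h k"] that ij by (auto simp: u_def h_def)
    moreover have "0 \<le> c (transition u k)" if "k < l - ?d" for k
      using less.prems(3)[of "h k"] hl that by (auto simp: tu)
    ultimately have "\<exists>l' v. l' \<le> ?N \<and> cyclic l' v \<and> transition v ` {..<l'} = transition u ` {..<l - ?d} \<and>
      (\<Sum>k<l'. c (transition v k)) \<le> (\<Sum>k<l - ?d. c (transition u k))"
      by (intro less.IH cu)
    then obtain l' v where v: "l' \<le> ?N" "cyclic l' v"
      "transition v ` {..<l'} = transition u ` {..<l - ?d}"
      "(\<Sum>k<l'. c (transition v k)) \<le> (\<Sum>k<l - ?d. c (transition u k))" by blast
    show ?thesis
      by (intro exI[of _ l'] exI[of _ v] conjI v(1,2) v(3)[unfolded tr] order_trans[OF v(4) cost])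
  qed
qed

section \<open>Threadings described by their transitions\<close>

lemma walk_edge_map:
  assumes "cyclic l w" "k \<le> l"
  shows "walk_edge (map w [0..<l]) k = {w k, w (k + 1)}"
  using walk_vertex_map[OF assms(1), of k] walk_vertex_map[OF assms(1), of "k + 1"] assms(2)
  by (simp add: walk_edge_def)

text \<open>The edges of the junction graph at \<open>v\<close>, without multiplicities.\<close>

definition crossings :: "('v \<times> 'v \<times> 'v) set \<Rightarrow> 'v \<Rightarrow> 'v set set set" where
  "crossings T v = {{{a, v}, {v, b}} | a b. (a, v, b) \<in> T}"

text \<open>The right side sees the walk through \<open>T\<close> alone. Testing only the incoming
  edge \<open>{a, v}\<close> covers every edge, as each edge of the walk is the incoming one of some
  transition.\<close>

lemma threading_map_iff:
  assumes "cyclic l w"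
  defines "T \<equiv> transition w ` {..<l}"
  shows "threading V E (map w [0..<l]) \<longleftrightarrow>
    (\<forall>(a, v, b)\<in>T. a \<in> V \<and> {a, v} \<in> E \<and> {a, v} \<noteq> {v, b}) \<and>
    (\<forall>e\<in>E. \<exists>(a, v, b)\<in>T. e = {a, v}) \<and>
    (\<forall>v\<in>V. connected_graph (incident E v) (crossings T v))"
proof -
  let ?W = "map w [0..<l]"
  have e: "walk_edge ?W k = {w k, w (k + 1)}" "walk_edge ?W (Suc k) = {w (k + 1), w (k + 2)}"
     "walk_vertex ?W (Suc k) = w (k + 1)" if "k < l" for k
    using walk_edge_map[OF assms(1), of k] walk_edge_map[OF assms(1), of "k + 1"]
      walk_vertex_map[OF assms(1), of "k + 1"] that by simp_all
  have "set_mset (junction_edges ?W v) = crossings T v" for v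
  proof -
    have "set_mset (junction_edges ?W v) = (\<lambda>i. {walk_edge ?W i, walk_edge ?W (Suc i)}) ` {i. i < l \<and> walk_vertex ?W (Suc i) = v}"
      by (auto simp: junction_edges_def)
    also have "\<dots> = (\<lambda>i. {{w i, v}, {v, w (i + 2)}}) ` {i. i < l \<and> w (i + 1) = v}"
      using e by (intro image_cong) auto
    also have "\<dots> = crossings T v"
      by (auto simp: crossings_def T_def transition_def image_iff)
    finally show ?thesis .
  qed
  moreover have "closed_walk V E ?W \<longleftrightarrow> (\<forall>(a, v, b)\<in>T. a \<in> V \<and> {a, v} \<in> E)"
    using assms(1) e by (auto simp: closed_walk_def cyclic_def T_def transition_def)
  moreover have "(\<forall>i<length ?W. walk_edge ?W i \<noteq> walk_edge ?W (Suc i)) \<longleftrightarrow> (\<forall>(a, v, b)\<in>T. {a, v} \<noteq> {v, b})"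
    using e by (auto simp: T_def transition_def)
  moreover have "(\<exists>i<length ?W. walk_edge ?W i = f) \<longleftrightarrow> (\<exists>(a, v, b)\<in>T. f = {a, v})" for f
    using e by (auto simp: T_def transition_def)
  ultimately show ?thesis
    by (auto simp: threading_def connected_multigraph_def junction_graph_def)
qed

lemma turn_cost_map:
  assumes "cyclic l w"
  shows "turn_cost \<alpha> (map w [0..<l]) = (\<Sum>k<l. \<alpha> {{w k, w (k + 1)}, {w (k + 1), w (k + 2)}})"
  unfolding turn_cost_def using walk_edge_map[OF assms] by (intro sum.cong) auto

section \<open>Connectivity certified by ranks\<close>

lemma connected_graphI_rank:
  fixes r :: "'a \<Rightarrow> nat"
  assumes "s \<in> S" "\<And>a. a \<in> S \<Longrightarrow> a = s \<or> (\<exists>b\<in>S. r b < r a \<and> {a, b} \<in> T)"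
  shows "connected_graph S T"
proof -
  let ?R = "{(a, b). {a, b} \<in> T}"
  have to_s: "(a, s) \<in> ?R\<^sup>*" if "a \<in> S" for a
    using that
  proof (induction "r a" arbitrary: a rule: less_induct)
    case less
    then consider "a = s" | b where "b \<in> S" "r b < r a" "{a, b} \<in> T" using assms(2) by blast
    then show ?case
    proof cases
      case 2
      then have "(b, s) \<in> ?R\<^sup>*" using less by blast
      then show ?thesis using 2(3) by (intro converse_rtrancl_into_rtrancl[of a b]) auto
    qed simp
  qed
  have "sym ?R" by (auto simp: sym_def insert_commute)
  then have "sym (?R\<^sup>*)" by (rule sym_rtrancl)
  then have "(a, b) \<in> ?R\<^sup>*" if "a \<in> S" "b \<in> S" for a b
    using to_s[OF that(1)] to_s[OF that(2)] by (meson rtrancl_trans symD)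
  then show ?thesis using assms(1) by (auto simp: connected_graph_def)
qed

text \<open>The rank of \<open>a\<close> is the number of elements strictly closer to
  \<open>s\<close>. Unlike for the distance itself, the bound \<open>card S\<close> then needs no
  argument about the length of shortest paths.\<close>

lemma connected_graph_rank:
  assumes "connected_graph S T" "finite S" "\<Union>T \<subseteq> S"
  obtains s and r :: "'a \<Rightarrow> nat" where "s \<in> S" "\<And>a. r a \<le> card S"
    "\<And>a. a \<in> S \<Longrightarrow> a = s \<or> (\<exists>b\<in>S. r b < r a \<and> {a, b} \<in> T)"
proof -
  let ?R = "{(a, b). {a, b} \<in> T}"
  obtain s where s: "s \<in> S" using assms(1) by (auto simp: connected_graph_def)
  define d where "d = (\<lambda>a. LEAST n. (a, s) \<in> ?R ^^ n)"
  define r where "r = (\<lambda>a. card {b \<in> S. d b < d a})"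
  have "a = s \<or> (\<exists>b\<in>S. r b < r a \<and> {a, b} \<in> T)" if a: "a \<in> S" for a
  proof (cases "a = s")
    case False
    have "(a, s) \<in> ?R\<^sup>*" using assms(1) a s by (auto simp: connected_graph_def)
    then obtain n where "(a, s) \<in> ?R ^^ n" by (meson rtrancl_power)
    then have da: "(a, s) \<in> ?R ^^ d a" unfolding d_def by (rule LeastI)
    then obtain m where m: "d a = Suc m" using False by (cases "d a") auto
    then obtain b where b: "(a, b) \<in> ?R" "(b, s) \<in> ?R ^^ m"
      using da by (metis relpow_Suc_D2)
    have "d b \<le> m" unfolding d_def using b(2) by (rule Least_le)
    then have lt: "d b < d a" using m by simp
    have bS: "b \<in> S" using b(1) assms(3) by auto
    have "{x \<in> S. d x < d b} \<subset> {x \<in> S. d x < d a}" using lt bS by auto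
    then have "r b < r a" unfolding r_def using assms(2) by (intro psubset_card_mono) auto
    then show ?thesis using bS b(1) by auto
  qed simp
  moreover have "r a \<le> card S" for a unfolding r_def using assms(2) by (intro card_mono) auto
  ultimately show ?thesis using that s by blast
qed

section \<open>The local check of a threading\<close>

definition linked :: "nat \<Rightarrow> (nat \<Rightarrow> nat) \<Rightarrow> nat \<Rightarrow> nat \<Rightarrow> nat \<Rightarrow> bool" where
  "linked l w v a b \<longleftrightarrow> (\<exists>i<l. w (i + 1) = v \<and> ((w i = a \<and> w (i + 2) = b) \<or> (w i = b \<and> w (i + 2) = a)))"

text \<open>An edge at \<open>v\<close> is named by its other endpoint, so the junction graph
  becomes a relation between vertices; \<open>s\<close> is the root, and ranks decrease towards
  it.\<close>

definition ranked :: "nat \<Rightarrow> (nat \<Rightarrow> nat \<Rightarrow> bool) \<Rightarrow> nat \<Rightarrow> (nat \<Rightarrow> nat) \<Rightarrow> nat \<Rightarrow> nat \<Rightarrow> (nat \<Rightarrow> nat) \<Rightarrow> bool" where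
  "ranked n e l w v s r \<longleftrightarrow> e s v \<and>
     (\<forall>a<n. e a v \<longrightarrow> a = s \<or> (\<exists>b<n. e b v \<and> r b < r a \<and> linked l w v a b))"

text \<open>\<open>w i \<noteq> w (i + 2)\<close> excludes U-turns. The standing assumptions on the
  graph follow from the check: a closed walk through all vertices gives connectedness, and every
  visit without a U-turn exhibits two edges. The ranks for all vertices form one table, with row
  \<open>v\<close> at offset \<open>v * n\<close>.\<close>

definition walk_check :: "nat \<Rightarrow> (nat \<Rightarrow> nat \<Rightarrow> bool) \<Rightarrow> nat \<Rightarrow> (nat \<Rightarrow> nat) \<Rightarrow> (nat \<Rightarrow> nat) \<Rightarrow> bool" where
  "walk_check n e l w r \<longleftrightarrow>
     1 \<le> l \<and> w l = w 0 \<and> w (l + 1) = w 1 \<and>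
     (\<forall>i<l. w i < n \<and> e (w i) (w (i + 1)) \<and> w i \<noteq> w (i + 2)) \<and>
     (\<forall>u<n. \<forall>v<n. e u v \<longrightarrow> (\<exists>i<l. (w i = u \<and> w (i + 1) = v) \<or> (w i = v \<and> w (i + 1) = u))) \<and>
     (\<forall>v<n. \<exists>i<l. w i = v) \<and>
     (\<forall>v<n. \<exists>s<n. ranked n e l w v s (\<lambda>a. r (v * n + a)))"

definition edge_set :: "nat \<Rightarrow> (nat \<Rightarrow> nat \<Rightarrow> bool) \<Rightarrow> nat set set" where
  "edge_set n e = {{u, v} | u v. u < n \<and> v < n \<and> e u v}"

lemma mem_edge_set:
  assumes "\<And>u v. e u v \<Longrightarrow> e v u"
  shows "{u, v} \<in> edge_set n e \<longleftrightarrow> u < n \<and> v < n \<and> e u v"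
  using assms by (auto simp: edge_set_def doubleton_eq_iff)

lemma walk_check_sound:
  assumes c: "walk_check n e l w r" and sym: "\<And>u v. e u v \<Longrightarrow> e v u" and irr: "\<And>u. \<not> e u u"
  shows "cyclic l w" "\<And>i. i \<le> l + 1 \<Longrightarrow> w i < n" "\<And>i. i \<le> l \<Longrightarrow> e (w i) (w (i + 1))"
    "threadable_graph {..<n} (edge_set n e)" "threading {..<n} (edge_set n e) (map w [0..<l])"
proof -
  let ?E = "edge_set n e"
  note mem = mem_edge_set[of e, OF sym]
  show cyc: "cyclic l w" using c by (auto simp: walk_check_def cyclic_def)
  then have l: "1 \<le> l" "w l = w 0" "w (l + 1) = w 1" by (auto simp: cyclic_def)
  have step: "w i < n" "e (w i) (w (i + 1))" "w i \<noteq> w (i + 2)" if "i < l" for i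
    using c that by (auto simp: walk_check_def)
  \<comment> \<open>A closed walk of length 1 would be a loop at \<open>w 0\<close>.\<close>
  have "l \<noteq> 1" using step(2)[of 0] irr l by auto
  then have l2: "2 \<le> l" using l(1) by simp
  show wn: "w i < n" if "i \<le> l + 1" for i
  proof -
    have "i < l \<or> i = l \<or> i = l + 1" using that by linarith
    then show ?thesis using step(1)[of i] step(1)[of 0] step(1)[of 1] l l2 by auto
  qed
  show we: "e (w i) (w (i + 1))" if "i \<le> l" for i
  proof (cases "i = l")
    case True then show ?thesis using step(2)[of 0] l by simp
  qed (use that step in simp)
  \<comment> \<open>Visits are needed at the middle position \<open>i + 1\<close> of a transition; a
    visit at position 0 is found again at position \<open>l\<close>.\<close>
  have mid: "\<exists>i<l. w (i + 1) = v" if "v < n" for v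
  proof -
    obtain i where i: "i < l" "w i = v" using c \<open>v < n\<close> unfolding walk_check_def by blast
    show ?thesis
    proof (cases i)
      case 0 then show ?thesis using i l by (intro exI[of _ "l - 1"]) auto
    next
      case (Suc m) then show ?thesis using i by (intro exI[of _ m]) auto
    qed
  qed
  have fin: "finite ?E"
    by (rule finite_subset[of _ "Pow {..<n}"]) (auto simp: edge_set_def)
  have "2 \<le> card (incident ?E v)" if "v < n" for v
  proof -
    obtain i where i: "i < l" "w (i + 1) = v" using mid \<open>v < n\<close> by blast
    have "{w i, v} \<in> ?E" "{v, w (i + 2)} \<in> ?E"
      using i we[of i] we[of "i + 1"] wn[of i] wn[of "i + 2"] that by (auto simp: mem)
    then have "{{w i, v}, {v, w (i + 2)}} \<subseteq> incident ?E v" by (auto simp: incident_def)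
    moreover have "card {{w i, v}, {v, w (i + 2)}} = 2"
      using step(3)[OF i(1)] by (auto simp: doubleton_eq_iff card_insert_if)
    ultimately show ?thesis using fin by (metis card_mono finite_subset incident_def mem_Collect_eq subsetI)
  qed
  moreover have "connected_graph {..<n} ?E"
  proof -
    let ?R = "{(a, b). {a, b} \<in> ?E}"
    have r: "(w 0, w i) \<in> ?R\<^sup>*" if "i \<le> l" for i
      using that
    proof (induction i)
      case (Suc i)
      then have "(w i, w (Suc i)) \<in> ?R" using we[of i] wn[of i] wn[of "i + 1"] by (auto simp: mem)
      then show ?case using Suc by (auto intro: rtrancl_into_rtrancl)
    qed simp
    have "sym ?R" by (auto simp: sym_def insert_commute)
    then have s: "sym (?R\<^sup>*)" by (rule sym_rtrancl)
    have "(u, v) \<in> ?R\<^sup>*" if "u < n" "v < n" for u v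
    proof -
      have "(w 0, u) \<in> ?R\<^sup>*" "(w 0, v) \<in> ?R\<^sup>*"
        using mid[OF that(1)] mid[OF that(2)] r by fastforce+
      then show ?thesis using s by (meson rtrancl_trans symD)
    qed
    then show ?thesis using wn[of 0] by (auto simp: connected_graph_def)
  qed
  moreover have "f \<subseteq> {..<n} \<and> card f = 2" if "f \<in> ?E" for f
    using that irr by (auto simp: edge_set_def card_insert_if)
  ultimately show "threadable_graph {..<n} ?E"
    by (auto simp: threadable_graph_def)
  let ?T = "transition w ` {..<l}"
  have "connected_graph (incident ?E v) (crossings ?T v)" if v: "v < n" for v
  proof -
    obtain s where s: "s < n" and rank: "ranked n e l w v s (\<lambda>a. r (v * n + a))"
    proof -
      have "\<forall>v<n. \<exists>s<n. ranked n e l w v s (\<lambda>a. r (v * n + a))" using c unfolding walk_check_def by (elim conjE)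
      then show ?thesis using that v by blast
    qed
    then have sv: "e s v" by (simp add: ranked_def)
    \<comment> \<open>Carries the ranks of vertices over to the edges at \<open>v\<close>.\<close>
    define other where "other = (\<lambda>f. THE a. f = {a, v})"
    have other: "other {a, v} = a" for a
      unfolding other_def by (rule the_equality) (auto simp: doubleton_eq_iff)
    show ?thesis
    proof (rule connected_graphI_rank[where s = "{s, v}" and r = "\<lambda>f. r (v * n + other f)"])
      show "{s, v} \<in> incident ?E v" using s sv v by (auto simp: incident_def mem)
      fix f assume "f \<in> incident ?E v"
      then have "f \<in> ?E" "v \<in> f" by (auto simp: incident_def)
      then obtain a where a: "f = {a, v}" "a < n" "e a v"
        using sym by (fastforce simp: edge_set_def)
      then have "a = s \<or> (\<exists>b<n. e b v \<and> r (v * n + b) < r (v * n + a) \<and> linked l w v a b)"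
        using rank unfolding ranked_def by blast
      then show "f = {s, v} \<or> (\<exists>g\<in>incident ?E v. r (v * n + other g) < r (v * n + other f) \<and> {f, g} \<in> crossings ?T v)"
      proof
        assume "\<exists>b<n. e b v \<and> r (v * n + b) < r (v * n + a) \<and> linked l w v a b"
        then obtain b i where b: "b < n" "e b v" "r (v * n + b) < r (v * n + a)"
          and i: "i < l" "w (i + 1) = v" "w i = a \<and> w (i + 2) = b \<or> w i = b \<and> w (i + 2) = a" unfolding linked_def by blast
        have "{w i, v} \<in> {{a, v}, {b, v}}" "{{w i, v}, {v, w (i + 2)}} = {{a, v}, {b, v}}"
          using i(3) by auto
        moreover have "{{w i, v}, {v, w (i + 2)}} \<in> crossings ?T v"
        proof -
          have "(w i, v, w (i + 2)) \<in> ?T" using i(1,2) by (auto simp: transition_def)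
          then show ?thesis unfolding crossings_def by blast
        qed
        ultimately have "{{a, v}, {b, v}} \<in> crossings ?T v" by simp
        moreover have "{b, v} \<in> incident ?E v" using b v by (auto simp: incident_def mem)
        ultimately show ?thesis using b(3) by (auto simp: a(1) other intro!: bexI[of _ "{b, v}"])
      qed (simp add: a(1))
    qed
  qed
  moreover have "\<forall>(a, v, b)\<in>?T. a \<in> {..<n} \<and> {a, v} \<in> ?E \<and> {a, v} \<noteq> {v, b}"
  proof -
    have "w i \<in> {..<n} \<and> {w i, w (i + 1)} \<in> ?E \<and> {w i, w (i + 1)} \<noteq> {w (i + 1), w (i + 2)}" if "i < l" for i
      using step[OF that] wn[of "i + 1"] that by (auto simp: mem doubleton_eq_iff)
    then show ?thesis by (simp add: transition_def)
  qed
  moreover have "\<forall>f\<in>?E. \<exists>(a, v, b)\<in>?T. f = {a, v}"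
  proof
    fix f assume "f \<in> ?E"
    then obtain u v where "f = {u, v}" "u < n" "v < n" "e u v" by (auto simp: edge_set_def)
    moreover from this obtain i where "i < l" "w i = u \<and> w (i + 1) = v \<or> w i = v \<and> w (i + 1) = u"
      using c unfolding walk_check_def by blast
    ultimately show "\<exists>(a, v, b)\<in>?T. f = {a, v}"
      by (intro bexI[of _ "transition w i"]) (auto simp: transition_def)
  qed
  ultimately show "threading {..<n} ?E (map w [0..<l])"
    unfolding threading_map_iff[OF cyc] by blast
qed

lemma walk_check_complete:
  assumes g: "threadable_graph {..<n} E" and t: "threading {..<n} E W"
    and pos: "\<And>t. t \<in> turns {..<n} E \<Longrightarrow> 0 \<le> \<alpha> t"
  obtains l w r where "l \<le> n ^ 2 * (n ^ 3 + 1)" "walk_check n (\<lambda>u v. {u, v} \<in> E) l w r" "\<And>i. r i \<le> n"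
    "\<And>i. n * n \<le> i \<Longrightarrow> r i = 0" "\<And>i. l + 1 < i \<Longrightarrow> w i = 0"
    "(\<Sum>k<l. \<alpha> {{w k, w (k + 1)}, {w (k + 1), w (k + 2)}}) \<le> turn_cost \<alpha> W"
proof -
  let ?e = "\<lambda>u v. {u, v} \<in> E"
  have E2: "f \<subseteq> {..<n} \<and> card f = 2" if "f \<in> E" for f using g that by (auto simp: threadable_graph_def)
  have en: "u < n \<and> v < n \<and> u \<noteq> v" if "?e u v" for u v using E2[OF that] by (auto simp: card_insert_if split: if_splits)
  define z where "z = walk_vertex W"
  define l0 where "l0 = length W"
  have W: "W \<noteq> []" using t by (auto simp: threading_def closed_walk_def)
  have cz: "cyclic l0 z" and Wz: "W = map z [0..<l0]"
    using cyclic_walk_vertex[OF W] by (auto simp: z_def l0_def)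
  let ?c = "\<lambda>(a, v, b). \<alpha> {{a, v}, {v, b}}"
  let ?T = "transition z ` {..<l0}"
  note t' = t[unfolded Wz threading_map_iff[OF cz]]
  have zz: "z (l0) = z 0" "z (l0 + 1) = z 1" "1 \<le> l0" using cz by (auto simp: cyclic_def)
  have ze: "{z k, z (k + 1)} \<in> E" "z k < n" "{z k, z (k + 1)} \<noteq> {z (k + 1), z (k + 2)}" if "k < l0" for k
    using t' that by (auto simp: transition_def)
  have ze': "{z (k + 1), z (k + 2)} \<in> E" if "k < l0" for k
  proof (cases "k + 1 = l0")
    case True
    then have "z (k + 1) = z 0" "z (k + 2) = z 1" using zz by auto
    then show ?thesis using ze(1)[of 0] zz(3) by simp
  next
    case False then show ?thesis using ze(1)[of "k + 1"] that by simp
  qed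
  \<comment> \<open>Costs are known to be nonnegative on turns, so each transition of the walk is
    recognised as a turn.\<close>
  have "0 \<le> ?c (transition z k)" if "k < l0" for k
  proof -
    have "{{z k, z (k + 1)}, {z (k + 1), z (k + 2)}} \<in> turns {..<n} E"
      unfolding turns_def turns_at_def incident_def
      using ze[OF that] ze'[OF that] en[OF ze(1)[OF that]]
      by (intro UN_I[of "z (k + 1)"]) blast+
    then show ?thesis using pos by (simp add: transition_def)
  qed
  then obtain l w0 where lw0: "l \<le> n ^ 2 * (n ^ 3 + 1)" "cyclic l w0" "transition w0 ` {..<l} = ?T"
    "(\<Sum>k<l. ?c (transition w0 k)) \<le> (\<Sum>k<l0. ?c (transition z k))"
    using shorten_cyclic[of "{..<n}" l0 z ?c] cz ze(2) by (auto simp del: case_prod_conv)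
  \<comment> \<open>Values beyond \<open>l + 1\<close> are set to 0, as a certificate needs finite
    support; transitions with index below \<open>l\<close> do not see the change.\<close>
  define w where "w = (\<lambda>i. if i \<le> l + 1 then w0 i else 0)"
  have w0: "transition w k = transition w0 k" if "k < l" for k
    using that by (simp add: w_def transition_def)
  have lw: "l \<le> n ^ 2 * (n ^ 3 + 1)" "cyclic l w" "transition w ` {..<l} = ?T"
    "(\<Sum>k<l. ?c (transition w k)) \<le> (\<Sum>k<l0. ?c (transition z k))"
    using lw0 w0 by (auto simp: cyclic_def w_def cong: image_cong_simp sum.cong_simp)
  have cost: "(\<Sum>k<l. \<alpha> {{w k, w (k + 1)}, {w (k + 1), w (k + 2)}}) \<le> turn_cost \<alpha> W"
    using lw(4) unfolding Wz turn_cost_map[OF cz] by (simp add: transition_def)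
  have tw: "threading {..<n} E (map w [0..<l])"
    using t' unfolding threading_map_iff[OF lw(2)] lw(3) .
  note tw' = tw[unfolded threading_map_iff[OF lw(2)]]
  have we: "{w k, w (k + 1)} \<in> E \<and> w k < n \<and> {w k, w (k + 1)} \<noteq> {w (k + 1), w (k + 2)}" if "k < l" for k
    using tw' that by (auto simp: transition_def)
  have finE: "finite E" by (rule finite_subset[of _ "Pow {..<n}"]) (use E2 in auto)
  have ww: "w l = w 0" "w (l + 1) = w 1" "1 \<le> l" using lw(2) by (auto simp: cyclic_def)
  have we': "{w (k + 1), w (k + 2)} \<in> E" if "k < l" for k
  proof (cases "k + 1 = l")
    case True
    then have "w (k + 1) = w 0" "w (k + 2) = w 1" using ww by auto
    then show ?thesis using we[of 0] ww(3) by simp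
  next
    case False then show ?thesis using we[of "k + 1"] that by simp
  qed
  have "\<exists>s r. s < n \<and> (\<forall>a. r a \<le> n) \<and> ranked n ?e l w v s r" if v: "v < n" for v
  proof -
    let ?S = "incident E v" and ?X = "crossings (transition w ` {..<l}) v"
    have "connected_graph ?S ?X" using tw' v by blast
    moreover have "finite ?S" using finE by (simp add: incident_def)
    moreover have "\<Union>?X \<subseteq> ?S"
      using we we' by (auto simp: crossings_def transition_def incident_def)
    ultimately obtain s r where s: "s \<in> ?S" and r: "\<And>a. r a \<le> card ?S"
      and conn: "\<And>a. a \<in> ?S \<Longrightarrow> a = s \<or> (\<exists>b\<in>?S. r b < r a \<and> {a, b} \<in> ?X)"
      by (rule connected_graph_rank) blast
    have S: "\<exists>a<n. f = {a, v} \<and> ?e a v" if "f \<in> ?S" for f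
    proof -
      have "f \<in> E" "v \<in> f" using that by (auto simp: incident_def)
      moreover obtain x y where "f = {x, y}" using E2[OF \<open>f \<in> E\<close>] by (meson card_2_iff)
      ultimately show ?thesis using en by (metis insertE insert_commute singletonD)
    qed
    have "?S \<subseteq> (\<lambda>a. {a, v}) ` {..<n}" using S by blast
    then have "card ?S \<le> n" using card_mono card_image_le
      by (metis card_lessThan finite_imageI finite_lessThan le_trans)
    obtain s' where s': "s' < n" "s = {s', v}" "?e s' v" using S[OF s] by blast
    show ?thesis
      unfolding ranked_def
    proof (intro exI[of _ s'] exI[of _ "\<lambda>a. r {a, v}"] conjI allI impI)
      fix a assume a: "a < n" "?e a v"
      then have "{a, v} \<in> ?S" by (auto simp: incident_def)
      from conn[OF this] show "a = s' \<or> (\<exists>b<n. ?e b v \<and> r {b, v} < r {a, v} \<and> linked l w v a b)"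
      proof
        assume "{a, v} = s" then show ?thesis using s' by (auto simp: doubleton_eq_iff)
      next
        assume "\<exists>f\<in>?S. r f < r {a, v} \<and> {{a, v}, f} \<in> ?X"
        then obtain f where f: "f \<in> ?S" "r f < r {a, v}" "{{a, v}, f} \<in> ?X" by blast
        obtain b where b: "b < n" "f = {b, v}" "?e b v" using S[OF f(1)] by blast
        obtain i where i: "i < l" "w (i + 1) = v" "{{a, v}, {b, v}} = {{w i, v}, {v, w (i + 2)}}"
          using f(3) b(2) by (auto simp: crossings_def transition_def)
        have "(w i = a \<and> w (i + 2) = b) \<or> (w i = b \<and> w (i + 2) = a)"
          using i(3) by (auto simp: doubleton_eq_iff)
        then show ?thesis using i b f(2) unfolding linked_def by blast
      qed
    qed (use s' r \<open>card ?S \<le> n\<close> order_trans in blast)+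
  qed
  then obtain s r where sr: "\<And>v. v < n \<Longrightarrow> s v < n \<and> (\<forall>a. r v a \<le> n) \<and> ranked n ?e l w v (s v) (r v)"
    by metis
  define r' where "r' = (\<lambda>i. if i div n < n then r (i div n) (i mod n) else 0)"
  have r': "r' (v * n + a) = r v a" if "v < n" "a < n" for v a
    using that by (simp add: r'_def)
  have cov: "\<exists>i<l. (w i = u \<and> w (i + 1) = v) \<or> (w i = v \<and> w (i + 1) = u)" if "?e u v" for u v
  proof -
    have "\<exists>(a, v', b)\<in>transition w ` {..<l}. {u, v} = {a, v'}" using tw' that by blast
    then obtain i where "i < l" "{u, v} = {w i, w (i + 1)}" by (auto simp: transition_def)
    then show ?thesis by (auto simp: doubleton_eq_iff)
  qed
  have "walk_check n ?e l w r'"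
    unfolding walk_check_def
  proof (intro conjI allI impI)
    fix i assume "i < l"
    then show "w i < n" "{w i, w (i + 1)} \<in> E" "w i \<noteq> w (i + 2)"
      using we[of i] by (auto simp: insert_commute)
  next
    fix v assume v: "v < n"
    have "{s v, v} \<in> E" using sr[OF v] by (simp add: ranked_def)
    then obtain i where i: "i < l" "w i = v \<or> w (i + 1) = v" using cov by blast
    show "\<exists>i<l. w i = v"
    proof (cases "w i = v")
      case False
      then have "w (i + 1) = v" using i by blast
      then show ?thesis using i ww by (cases "i + 1 = l") (auto intro: exI[of _ 0] exI[of _ "i + 1"])
    qed (use i in blast)
  next
    fix v assume v: "v < n"
    have "ranked n ?e l w v (s v) (\<lambda>a. r' (v * n + a))"
      using sr[OF v] r'[OF v] unfolding ranked_def by (metis (no_types, lifting))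
    then show "\<exists>s<n. ranked n ?e l w v s (\<lambda>a. r' (v * n + a))" using sr[OF v] by blast
  qed (use ww cov in auto)
  moreover have "r' i \<le> n" for i using sr by (auto simp: r'_def)
  moreover have "r' i = 0" if "n * n \<le> i" for i
  proof -
    have "\<not> i div n < n" using that by (cases "n = 0") (auto simp: less_mult_imp_div_less div_less_iff_less_mult)
    then show ?thesis by (simp add: r'_def)
  qed
  moreover have "w i = 0" if "l + 1 < i" for i using that by (simp add: w_def)
  ultimately show ?thesis using that lw(1) cost by blast
qed

section \<open>Binary numbers and the instance encoding\<close>

text \<open>Column-wise comparison of two numbers with digits of arbitrary size. The carry into column \<open>k\<close>
  may be negative; it is \<open>c k - b\<close>.\<close>

definition balanced :: "nat \<Rightarrow> nat \<Rightarrow> (nat \<Rightarrow> nat) \<Rightarrow> (nat \<Rightarrow> nat) \<Rightarrow> (nat \<Rightarrow> nat) \<Rightarrow> bool" where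
  "balanced l b f g c \<longleftrightarrow> c 0 = b \<and> c l = b \<and> (\<forall>k<l. f k + b + c k = g k + 2 * c (k + 1))"

text \<open>The carry \<open>c m - b\<close> is the difference of the two sums below column
  \<open>m\<close>, divided by \<open>2 ^ m\<close>; the invariant says so without
  subtraction.\<close>

lemma balanced_sound:
  assumes "balanced l b f g c"
  shows "(\<Sum>k<l. f k * 2 ^ k) = (\<Sum>k<l. g k * 2 ^ k)"
proof -
  have "(\<Sum>k<m. f k * 2 ^ k) + b * 2 ^ m = (\<Sum>k<m. g k * 2 ^ k) + c m * 2 ^ m" if "m \<le> l" for m
    using that
  proof (induction m)
    case 0 then show ?case using assms by (simp add: balanced_def)
  next
    case (Suc m)
    have "f m + b + c m = g m + 2 * c (m + 1)" using assms Suc.prems by (simp add: balanced_def)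
    then have "(f m + b + c m) * 2 ^ m = (g m + 2 * c (m + 1)) * 2 ^ m" by simp
    then show ?case using Suc by (simp add: algebra_simps)
  qed
  from this[of l] show ?thesis using assms by (simp add: balanced_def)
qed

text \<open>As the totals agree, the difference of the parts below column \<open>m\<close> is minus
  that of the parts from \<open>m\<close> on, hence divisible by \<open>2 ^ m\<close>. Digits up to
  \<open>b\<close> make the quotient at most \<open>b\<close> in absolute value, and the shift by
  \<open>b\<close> puts it between 0 and \<open>2 * b\<close>.\<close>

lemma balanced_complete:
  assumes eq: "(\<Sum>k<l. f k * 2 ^ k) = (\<Sum>k<l. g k * 2 ^ k)"
    and le: "\<And>k. k < l \<Longrightarrow> f k \<le> b" "\<And>k. k < l \<Longrightarrow> g k \<le> b"
  obtains c where "balanced l b f g c" "\<And>k. c k \<le> 2 * b" "\<And>k. l < k \<Longrightarrow> c k = 0"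
proof -
  define d where "d = (\<lambda>m. \<Sum>k<m. (int (f k) - int (g k)) * 2 ^ k)"
  have "2 ^ m dvd d m" if "m \<le> l" for m
  proof -
    have "d l = int (\<Sum>k<l. f k * 2 ^ k) - int (\<Sum>k<l. g k * 2 ^ k)"
      by (simp add: d_def left_diff_distrib sum_subtractf)
    then have "d l = 0" using eq by simp
    moreover have "d l = d m + (\<Sum>k=m..<l. (int (f k) - int (g k)) * 2 ^ k)"
      unfolding d_def lessThan_atLeast0 using that by (simp add: sum.atLeastLessThan_concat)
    moreover have "2 ^ m dvd (\<Sum>k=m..<l. (int (f k) - int (g k)) * 2 ^ k)"
      by (intro dvd_sum dvd_mult le_imp_power_dvd) auto
    ultimately show ?thesis by (metis dvd_0_right dvd_add_left_iff)
  qed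
  then obtain q where q: "\<And>m. m \<le> l \<Longrightarrow> d m = 2 ^ m * q m" unfolding dvd_def by metis
  have dle: "\<bar>d m\<bar> \<le> int b * 2 ^ m" if "m \<le> l" for m
    using that
  proof (induction m)
    case (Suc m)
    have "\<bar>int (f m) - int (g m)\<bar> \<le> int b" using le[of m] Suc.prems by linarith
    then have "\<bar>(int (f m) - int (g m)) * 2 ^ m\<bar> \<le> int b * 2 ^ m" by (simp add: abs_mult)
    then have "\<bar>d m + (int (f m) - int (g m)) * 2 ^ m\<bar> \<le> int b * 2 ^ m + int b * 2 ^ m"
      using Suc by linarith
    then show ?case by (simp add: d_def)
  qed (simp add: d_def)
  have qle: "\<bar>q m\<bar> \<le> int b" if "m \<le> l" for m
    using dle[OF that] q[OF that] by (simp add: abs_mult mult.commute)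
  define c where "c = (\<lambda>m. if m \<le> l then nat (q m + int b) else 0)"
  have ci: "int (c m) = q m + int b" if "m \<le> l" for m
    using qle[OF that] that by (simp add: c_def)
  have "balanced l b f g c"
    unfolding balanced_def
  proof (intro conjI allI impI)
    have "q 0 = 0" using q[of 0] by (simp add: d_def)
    then show "c 0 = b" using ci[of 0] by simp
    have "d l = int (\<Sum>k<l. f k * 2 ^ k) - int (\<Sum>k<l. g k * 2 ^ k)"
      by (simp add: d_def left_diff_distrib sum_subtractf)
    then have "q l = 0" using q[of l] eq by simp
    then show "c l = b" using ci[of l] by simp
    fix k assume k: "k < l"
    have "2 ^ Suc k * q (Suc k) = 2 ^ k * q k + (int (f k) - int (g k)) * 2 ^ k"
      using q[of k] q[of "Suc k"] k by (simp add: d_def)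
    then have "2 ^ k * (2 * q (Suc k)) = 2 ^ k * (q k + int (f k) - int (g k))"
      by (simp add: algebra_simps)
    then have "2 * q (Suc k) = q k + int (f k) - int (g k)" by simp
    then have "int (f k + b + c k) = int (g k + 2 * c (k + 1))"
      using ci[of k] ci[of "k + 1"] k by simp
    then show "f k + b + c k = g k + 2 * c (k + 1)" by linarith
  qed
  moreover have "c k \<le> 2 * b" for k using qle[of k] by (auto simp: c_def)
  moreover have "c k = 0" if "l < k" for k using that by (simp add: c_def)
  ultimately show ?thesis using that by blast
qed

text \<open>The product of two digit sequences with unnormalised columns. They go directly into
  \<open>balanced\<close>, so no digits of the product have to be guessed.\<close>

definition convolution :: "nat \<Rightarrow> nat \<Rightarrow> (nat \<Rightarrow> nat) \<Rightarrow> (nat \<Rightarrow> nat) \<Rightarrow> nat \<Rightarrow> nat" where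
  "convolution p q f g k = (\<Sum>i<p. \<Sum>j<q. of_bool (i + j = k) * (f i * g j))"

lemma convolution_value:
  "(\<Sum>k<p + q. convolution p q f g k * 2 ^ k) = (\<Sum>i<p. f i * 2 ^ i) * (\<Sum>j<q. g j * 2 ^ j)"
proof -
  have "(\<Sum>k<p + q. convolution p q f g k * 2 ^ k) =
      (\<Sum>k<p + q. \<Sum>i<p. \<Sum>j<q. of_bool (i + j = k) * (f i * g j) * 2 ^ k)"
    by (simp only: convolution_def sum_distrib_right)
  also have "\<dots> = (\<Sum>i<p. \<Sum>j<q. \<Sum>k<p + q. of_bool (i + j = k) * (f i * g j) * 2 ^ k)"
    by (subst sum.swap) (intro sum.cong refl sum.swap)
  also have "\<dots> = (\<Sum>i<p. \<Sum>j<q. (f i * 2 ^ i) * (g j * 2 ^ j))"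
  proof (intro sum.cong refl)
    fix i j assume "i \<in> {..<p}" "j \<in> {..<q}"
    then have "i + j \<in> {..<p + q}" by auto
    then have s: "(\<Sum>k<p + q. if i + j = k then f i * g j * 2 ^ k else 0) = f i * g j * 2 ^ (i + j)"
      by (subst sum.delta') auto
    have e: "of_bool (i + j = k) * (f i * g j) * 2 ^ k = (if i + j = k then f i * g j * 2 ^ k else 0)" for k
      by simp
    show "(\<Sum>k<p + q. of_bool (i + j = k) * (f i * g j) * 2 ^ k) = (f i * 2 ^ i) * (g j * 2 ^ j)"
      unfolding e s by (simp add: power_add)
  qed
  also have "\<dots> = (\<Sum>i<p. f i * 2 ^ i) * (\<Sum>j<q. g j * 2 ^ j)"
    by (simp add: sum_product)
  finally show ?thesis .
qed

lemma convolution_le: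
  assumes "\<And>i. f i \<le> 1" "\<And>j. g j \<le> 1"
  shows "convolution p q f g k \<le> p * q"
proof -
  have "of_bool (i + j = k) * (f i * g j) \<le> 1" for i j
    using mult_le_mono[OF assms(1)[of i] assms(2)[of j]] by (auto simp: of_bool_def)
  then have "convolution p q f g k \<le> (\<Sum>i<p. \<Sum>j<q. 1)"
    unfolding convolution_def by (intro sum_mono)
  then show ?thesis by simp
qed

lemma binary_digits: "(\<Sum>k<l. (m div 2 ^ k mod 2) * 2 ^ k) = (m::nat) mod 2 ^ l"
proof (induction l)
  case (Suc l)
  have "m mod 2 ^ Suc l = 2 ^ l * (m div 2 ^ l mod 2) + m mod 2 ^ l"
    by (simp add: mod_mult2_eq mult.commute[of 2])
  then show ?case using Suc by (simp add: mult.commute)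
qed simp

section \<open>Binary digits and self-delimiting codes\<close>

definition bits_value :: "bool list \<Rightarrow> nat" where
  "bits_value bs = (\<Sum>j<length bs. of_bool (bs ! j) * 2 ^ j)"

lemma bits_value_Cons: "bits_value (b # bs) = of_bool b + 2 * bits_value bs"
proof -
  have "(\<Sum>j<Suc (length bs). of_bool ((b # bs) ! j) * 2 ^ j) = of_bool b + (\<Sum>j<length bs. of_bool (bs ! j) * 2 ^ Suc j :: nat)"
    by (subst sum.lessThan_Suc_shift) simp
  also have "(\<Sum>j<length bs. of_bool (bs ! j) * 2 ^ Suc j :: nat) = 2 * (\<Sum>j<length bs. of_bool (bs ! j) * 2 ^ j)"
    unfolding sum_distrib_left by (intro sum.cong) simp_all
  finally show ?thesis by (simp only: bits_value_def list.size add_Suc_right add_0_right)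
qed

lemma bits_value_nat_bits: "bits_value (nat_bits n) = n"
proof (induction n rule: less_induct)
  case (less n)
  show ?case
  proof (cases "n = 0")
    case False
    then have "bits_value (nat_bits n) = of_bool (odd n) + 2 * (n div 2)"
      using less[of "n div 2"] by (subst nat_bits.simps) (simp add: bits_value_Cons)
    then show ?thesis by (simp add: odd_two_times_div_two_succ)
  qed (simp add: nat_bits.simps bits_value_def)
qed

lemma nat_bits_Nil_iff: "nat_bits n = [] \<longleftrightarrow> n = 0"
  by (subst nat_bits.simps) simp

lemma last_nat_bits: "nat_bits n \<noteq> [] \<Longrightarrow> last (nat_bits n)"
proof (induction n rule: less_induct)
  case (less n)
  have n: "n \<noteq> 0" using less.prems by (simp add: nat_bits_Nil_iff)
  have e: "nat_bits n = odd n # nat_bits (n div 2)" using n by (subst nat_bits.simps) simp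
  show ?case
  proof (cases "nat_bits (n div 2) = []")
    case True
    then have "n div 2 = 0" by (simp only: nat_bits_Nil_iff)
    then show ?thesis using n True e by (auto simp: div_eq_0_iff less_2_cases_iff)
  next
    case False
    then show ?thesis using less.IH[of "n div 2"] n e by simp
  qed
qed

text \<open>A digit list that is empty or ends in 1 is canonical; this identifies a checked code
  with the one that \<open>encode_nat\<close> produces.\<close>

lemma nat_bits_bits_value: "(bs \<noteq> [] \<Longrightarrow> last bs) \<Longrightarrow> nat_bits (bits_value bs) = bs"
proof (induction bs)
  case (Cons b bs)
  have IH: "nat_bits (bits_value bs) = bs" using Cons by (cases bs) auto
  have "bits_value (b # bs) \<noteq> 0"
  proof
    assume "bits_value (b # bs) = 0"
    then have "\<not> b" "bits_value bs = 0" by (auto simp: bits_value_Cons)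
    then have "bs = []" using IH nat_bits_Nil_iff[of "bits_value bs"] by simp
    then show False using Cons.prems \<open>\<not> b\<close> by simp
  qed
  then have "nat_bits (bits_value (b # bs)) = odd (bits_value (b # bs)) # nat_bits (bits_value (b # bs) div 2)"
    by (subst nat_bits.simps) simp
  also have "\<dots> = b # bs" using IH by (cases b) (simp_all add: bits_value_Cons)
  finally show ?case .
qed (simp add: bits_value_def nat_bits.simps)

lemma less_nat_bits: "n < 2 ^ length (nat_bits n)"
proof -
  have "bits_value bs < 2 ^ length bs" for bs
    by (induction bs) (auto simp: bits_value_Cons bits_value_def[of "[]"])
  then show ?thesis by (metis bits_value_nat_bits)
qed

definition slice :: "'a list \<Rightarrow> nat \<Rightarrow> nat \<Rightarrow> 'a list" where
  "slice x p q = take (q - p) (drop p x)"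

lemma length_slice: "p \<le> q \<Longrightarrow> q \<le> length x \<Longrightarrow> length (slice x p q) = q - p"
  by (simp add: slice_def)

lemma nth_slice: "p + i < q \<Longrightarrow> q \<le> length x \<Longrightarrow> slice x p q ! i = x ! (p + i)"
  by (simp add: slice_def)

lemma slice_append: "p \<le> q \<Longrightarrow> q \<le> r \<Longrightarrow> slice x p q @ slice x q r = slice x p r"
proof -
  assume "p \<le> q" "q \<le> r"
  then have "slice x p r = take ((q - p) + (r - q)) (drop p x)" by (simp add: slice_def)
  also have "\<dots> = slice x p q @ slice x q r"
    unfolding take_add slice_def using \<open>p \<le> q\<close> by simp
  finally show ?thesis by simp
qed

lemma length_concat_pairs: "length (concat (map (\<lambda>b. [True, b]) bs)) = 2 * length bs"
  by (induction bs) auto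

lemma nth_concat_pairs:
  "i < length bs \<Longrightarrow> concat (map (\<lambda>b. [True, b]) bs) ! (2 * i) = True \<and>
   concat (map (\<lambda>b. [True, b]) bs) ! (2 * i + 1) = bs ! i"
  by (induction bs arbitrary: i) (auto simp: nth_Cons split: nat.split)

lemma length_encode_nat: "length (encode_nat m) = 2 * length (nat_bits m) + 1"
  by (simp add: encode_nat_def length_concat_pairs)

lemma nth_encode_nat:
  "i < length (nat_bits m) \<Longrightarrow> encode_nat m ! (2 * i)"
  "i < length (nat_bits m) \<Longrightarrow> encode_nat m ! (2 * i + 1) = nat_bits m ! i"
  "\<not> encode_nat m ! (2 * length (nat_bits m))"
  using nth_concat_pairs[of i "nat_bits m"]
  by (simp_all add: encode_nat_def nth_append length_concat_pairs)

definition nat_code :: "(nat \<Rightarrow> bool) \<Rightarrow> nat \<Rightarrow> nat \<Rightarrow> bool" where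
  "nat_code x p q \<longleftrightarrow> (\<exists>j<q. q = p + 2 * j + 1 \<and> (\<forall>i<j. x (p + 2 * i)) \<and> \<not> x (p + 2 * j) \<and>
     (\<forall>i<j. i + 1 = j \<longrightarrow> x (p + 2 * i + 1)))"

text \<open>Positions past the end of the code count as 0, so all numbers can be summed over the
  same range.\<close>

definition code_digit :: "(nat \<Rightarrow> bool) \<Rightarrow> nat \<Rightarrow> nat \<Rightarrow> nat \<Rightarrow> nat" where
  "code_digit x p q j = of_bool (p + 2 * j + 1 < q \<and> x (p + 2 * j + 1))"

definition code_value :: "nat \<Rightarrow> (nat \<Rightarrow> bool) \<Rightarrow> nat \<Rightarrow> nat \<Rightarrow> nat" where
  "code_value l x p q = (\<Sum>j<l. code_digit x p q j * 2 ^ j)"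

text \<open>Only 0 has a code of length 1; by the third conclusion a denominator is thus tested for
  being positive by comparing positions.\<close>

lemma nat_code_complete:
  assumes s: "slice x p q = encode_nat m" and q: "q \<le> length x"
  shows "nat_code (bit_at x) p q" "code_value (length x) (bit_at x) p q = m" "p + 1 < q \<longleftrightarrow> m \<noteq> 0" "p < q"
proof -
  let ?bs = "nat_bits m"
  have "length (slice x p q) > 0" using s by (simp add: length_encode_nat)
  then show pq: "p < q" by (simp add: slice_def)
  have len: "q = p + 2 * length ?bs + 1"
    using length_slice[of p q x] pq q s by (simp add: length_encode_nat)
  have nth: "bit_at x (p + i) \<longleftrightarrow> encode_nat m ! i" if "i < 2 * length ?bs + 1" for i
    using nth_slice[of p i q x] that len q s by (simp add: bit_at_def)
  have odd: "bit_at x (p + 2 * i + 1) \<longleftrightarrow> ?bs ! i" if "i < length ?bs" for i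
    using nth[of "2 * i + 1"] nth_encode_nat(2)[OF that] that by (simp add: add.assoc)
  show "nat_code (bit_at x) p q"
    unfolding nat_code_def
  proof (intro exI[of _ "length ?bs"] conjI allI impI)
    fix i assume i: "i < length ?bs"
    show "bit_at x (p + 2 * i)" using nth[of "2 * i"] nth_encode_nat(1)[OF i] i by simp
    assume "i + 1 = length ?bs"
    moreover have ne: "?bs \<noteq> []" using i by auto
    ultimately have "?bs ! i = last ?bs" using last_conv_nth[OF ne] by (metis add_diff_cancel_right')
    moreover have "last ?bs" using last_nat_bits[OF ne] .
    ultimately show "bit_at x (p + 2 * i + 1)" using odd[OF i] by simp
  next
    show "\<not> bit_at x (p + 2 * length ?bs)" using nth[of "2 * length ?bs"] nth_encode_nat(3) by simp
  qed (use len in auto)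
  show "p + 1 < q \<longleftrightarrow> m \<noteq> 0" using len nat_bits_Nil_iff[of m] by auto
  have "code_value (length x) (bit_at x) p q = (\<Sum>j<length ?bs. code_digit (bit_at x) p q j * 2 ^ j)"
    unfolding code_value_def using len q by (intro sum.mono_neutral_right) (auto simp: code_digit_def)
  also have "\<dots> = bits_value ?bs"
    unfolding bits_value_def using odd len by (intro sum.cong) (auto simp: code_digit_def)
  finally show "code_value (length x) (bit_at x) p q = m" by (simp add: bits_value_nat_bits)
qed

lemma nat_code_sound:
  assumes "nat_code (bit_at x) p q" and q: "q \<le> length x"
  shows "slice x p q = encode_nat (code_value (length x) (bit_at x) p q)"
proof -
  obtain j where j: "q = p + 2 * j + 1" "\<And>i. i < j \<Longrightarrow> bit_at x (p + 2 * i)" "\<not> bit_at x (p + 2 * j)"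
    "\<And>i. i + 1 = j \<Longrightarrow> bit_at x (p + 2 * i + 1)"
    using assms(1) unfolding nat_code_def by auto
  define bs where "bs = map (\<lambda>i. bit_at x (p + 2 * i + 1)) [0..<j]"
  have "last bs" if "bs \<noteq> []"
    using that j(4)[of "j - 1"] by (cases j) (auto simp: bs_def)
  then have bits: "nat_bits (bits_value bs) = bs" by (rule nat_bits_bits_value)
  have lbs: "length bs = j" by (simp add: bs_def)
  have "slice x p q = encode_nat (bits_value bs)"
  proof (rule nth_equalityI)
    show l: "length (slice x p q) = length (encode_nat (bits_value bs))"
      using j(1) q by (simp add: length_slice length_encode_nat bits lbs)
    fix i assume "i < length (slice x p q)"
    then have i: "i < 2 * j + 1" using j(1) q by (simp add: length_slice)
    have b: "slice x p q ! i \<longleftrightarrow> bit_at x (p + i)" using i j(1) q by (simp add: nth_slice bit_at_def)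
    have lb: "length (nat_bits (bits_value bs)) = j" by (simp add: bits lbs)
    consider k where "i = 2 * k" "k < j" | k where "i = 2 * k + 1" "k < j" | "i = 2 * j"
    proof -
      consider k where "i = 2 * k" | k where "i = 2 * k + 1" by (metis evenE oddE)
      then show ?thesis
      proof cases
        case (1 k) then show ?thesis using i that(1)[of k] that(3) by (cases "k < j") auto
      next
        case (2 k) then show ?thesis using i that(2)[of k] by auto
      qed
    qed
    then show "slice x p q ! i = encode_nat (bits_value bs) ! i"
    proof cases
      case (1 k)
      then show ?thesis using b j(2)[of k] nth_encode_nat(1)[of k "bits_value bs"] lb by simp
    next
      case (2 k)
      then show ?thesis using b nth_encode_nat(2)[of k "bits_value bs"] lb by (simp add: bits) (simp add: bs_def)
    next
      case 3
      then show ?thesis using b j(3) nth_encode_nat(3)[of "bits_value bs"] lb by simp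
    qed
  qed
  moreover from nat_code_complete(2)[OF this q] have "code_value (length x) (bit_at x) p q = bits_value bs" .
  ultimately show ?thesis by simp
qed

section \<open>Cutting a word into consecutive slices\<close>

lemma concat_slices:
  assumes "\<And>i. i < t \<Longrightarrow> P i \<le> P (i + 1)"
  shows "slice x (P 0) (P t) = concat (map (\<lambda>i. slice x (P i) (P (i + 1))) [0..<t])"
  using assms
proof (induction t)
  case (Suc t)
  have "P 0 \<le> P t" using Suc.prems by (induction t) (auto intro: le_trans)
  then have "slice x (P 0) (P (Suc t)) = slice x (P 0) (P t) @ slice x (P t) (P (t + 1))"
    using Suc.prems[of t] by (simp add: slice_append)
  then show ?case using Suc by simp
qed (simp add: slice_def)

text \<open>The cutting positions are the partial sums of the segment lengths. This supplies the
  positions for completeness, while \<open>concat_slices\<close> reassembles the word for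
  soundness.\<close>

lemma slice_concat:
  fixes s :: "nat \<Rightarrow> 'a list"
  assumes "slice x p q = concat (map s [0..<t])" "p \<le> q" "q \<le> length x"
  defines "P \<equiv> \<lambda>i. p + (\<Sum>k<i. length (s k))"
  shows "P t = q" "i < t \<Longrightarrow> slice x (P i) (P (i + 1)) = s i"
proof -
  have len: "length (concat (map s [0..<m])) = (\<Sum>k<m. length (s k))" for m
    by (induction m) auto
  show Pt: "P t = q" unfolding P_def len[symmetric] assms(1)[symmetric] using assms(2,3) by (simp add: length_slice)
  assume i: "i < t"
  have split: "[0..<t] = [0..<i] @ i # [Suc i..<t]"
    using upt_add_eq_append[of 0 i "t - i"] upt_conv_Cons[OF i] i by simp
  have "slice x p q = concat (map s [0..<i]) @ s i @ concat (map s [Suc i..<t])"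
    unfolding assms(1) split by simp
  then have "take (length (s i)) (drop (P i - p) (slice x p q)) = s i"
    by (simp add: P_def len)
  moreover have "length (s i) \<le> q - P i"
  proof -
    have "(\<Sum>k<i. length (s k)) + length (s i) = (\<Sum>k<Suc i. length (s k))" by simp
    also have "\<dots> \<le> (\<Sum>k<t. length (s k))" using i by (intro sum_mono2) auto
    finally show ?thesis using Pt by (auto simp: P_def)
  qed
  moreover have "p \<le> P i" by (simp add: P_def)
  ultimately show "slice x (P i) (P (i + 1)) = s i"
    by (simp add: slice_def P_def drop_take min_def add.commute split: if_splits)
qed

lemma concat_map_times:
  "concat (map f [0..<a * b]) = concat (map (\<lambda>i. concat (map (\<lambda>j. f (i * b + j)) [0..<b])) [0..<a])"
proof (induction a)
  case (Suc a)
  have "[0..<Suc a * b] = [0..<a * b] @ map (\<lambda>j. a * b + j) [0..<b]"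
    using upt_add_eq_append[of 0 "a * b" b] map_add_upt[of "a * b" b] by (simp add: ac_simps)
  then show ?case using Suc by (simp add: comp_def)
qed simp

section \<open>The verifier\<close>

text \<open>Row \<open>v\<close> of the strict lower triangle has \<open>v\<close> entries, and the
  triangle follows the unary prefix of length \<open>n + 1\<close>; hence the offset.\<close>

definition adjacent :: "(nat \<Rightarrow> bool) \<Rightarrow> nat \<Rightarrow> nat \<Rightarrow> nat \<Rightarrow> bool" where
  "adjacent x n u v \<longleftrightarrow> u < v \<and> x (n + 1 + (\<Sum>j<v. j) + u)"

definition edge :: "(nat \<Rightarrow> bool) \<Rightarrow> nat \<Rightarrow> nat \<Rightarrow> nat \<Rightarrow> bool" where
  "edge x n u v \<longleftrightarrow> u < n \<and> v < n \<and> (adjacent x n u v \<or> adjacent x n v u)"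

text \<open>The index of a turn among all vertex triples, ordered as in \<open>encode\<close>;
  sorting the outer vertices gives both directions of traversal the same cost.\<close>

definition turn_index :: "nat \<Rightarrow> nat \<Rightarrow> nat \<Rightarrow> nat \<Rightarrow> nat" where
  "turn_index n a v b = (if a < b then (v * n + b) * n + a else (v * n + a) * n + b)"

text \<open>\<open>P t\<close> and \<open>Q t\<close> are the positions of the numerator and the denominator of the cost with
  number \<open>t\<close>, which equals the integer with digits \<open>M (t * (2 * l) + i)\<close>, for \<open>i < 2 * l\<close>, divided
  by the common denominator with digits \<open>D\<close>. The sequence \<open>c\<close> consists of carries.\<close>

definition fraction_check where
  "fraction_check l x P Q M D c t \<longleftrightarrow>
     nat_code x (P t) (Q t) \<and> nat_code x (Q t) (P (t + 1)) \<and> Q t + 1 < P (t + 1) \<and>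
     balanced (2 * l + l) (2 * l * l)
       (convolution (2 * l) l (\<lambda>i. M (t * (2 * l) + i)) (code_digit x (Q t) (P (t + 1))))
       (convolution (2 * l) l D (code_digit x (P t) (Q t)))
       (\<lambda>k. c (t * (3 * l + 1) + k))"

text \<open>Every triple of vertices gets a segment, empty unless it is a turn with sorted outer
  vertices, so that the index of a turn is an arithmetic expression and not a count of the turns
  before it. Index \<open>n * n * n\<close> belongs to the bound.\<close>

definition costs_check where
  "costs_check l x n P Q M D c \<longleftrightarrow>
     P 0 = n + 1 + (\<Sum>j<n. j) \<and> P (n * n * n + 1) = l \<and> (\<exists>k<2 * l. D k \<noteq> 0) \<and>
     fraction_check l x P Q M D c (n * n * n) \<and>
     (\<forall>v<n. \<forall>b<n. \<forall>a<n.
        if a < b \<and> edge x n a v \<and> edge x n v b then fraction_check l x P Q M D c ((v * n + b) * n + a)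
        else P ((v * n + b) * n + a + 1) = P ((v * n + b) * n + a))"

text \<open>The slack \<open>s\<close> turns the inequality between the cost of the walk and the
  bound into an equality of digit sums. With binary digits, a column on the left adds at most
  \<open>m\<close> digits and one slack digit, whence the offset \<open>m + 1\<close>.\<close>

definition verify where
  "verify l x n m w P Q r M D c s d \<longleftrightarrow>
     n < l \<and> (\<forall>i<n. x i) \<and> \<not> x n \<and> costs_check l x n P Q M D c \<and>
     walk_check n (edge x n) m w r \<and>
     balanced (2 * l) (m + 1)
       (\<lambda>k. (\<Sum>i<m. M (turn_index n (w i) (w (i + 1)) (w (i + 2)) * (2 * l) + k)) + s k)
       (\<lambda>k. M (n * n * n * (2 * l) + k)) d"

text \<open>The certificate interleaves ten sequences; the one with number 8 holds \<open>n\<close> and the length \<open>m\<close> of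
  the walk.\<close>

definition verifier :: "nat \<Rightarrow> (nat \<Rightarrow> bool) \<Rightarrow> (nat \<Rightarrow> nat) \<Rightarrow> bool" where
  "verifier l x f \<longleftrightarrow> verify l x (f 8) (f 18)
     (\<lambda>i. f (10 * i)) (\<lambda>i. f (10 * i + 1)) (\<lambda>i. f (10 * i + 2)) (\<lambda>i. f (10 * i + 3)) (\<lambda>i. f (10 * i + 4))
     (\<lambda>i. f (10 * i + 5)) (\<lambda>i. f (10 * i + 6)) (\<lambda>i. f (10 * i + 7)) (\<lambda>i. f (10 * i + 9))"

text \<open>The definitions avoid subtraction, division and unbounded quantifiers, so after
  unfolding every operator has a closure rule.\<close>

lemma decidable_verifier:
  "decidable (\<lambda>w \<rho>. verifier (input_length w) (input_bit w) (certificate b w))"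
  unfolding verifier_def verify_def costs_check_def fraction_check_def walk_check_def ranked_def linked_def balanced_def
    nat_code_def convolution_def code_digit_def turn_index_def edge_def adjacent_def
  by (intro definable_intros)

section \<open>The encoding as a sequence of segments\<close>

lemma concat_concat: "concat (concat xs) = concat (map concat xs)"
  by (induction xs) auto

lemma concat_map_guard:
  "b \<le> n \<Longrightarrow> concat (map (\<lambda>a. if a < b \<and> R a then g a else []) [0..<n]) = concat (map (\<lambda>a. if R a then g a else []) [0..<b])"
proof -
  assume "b \<le> n"
  then have 1: "[0..<n] = [0..<b] @ [b..<n]" using upt_add_eq_append[of 0 b "n - b"] by simp
  have 2: "concat (map (\<lambda>a. if a < b \<and> R a then g a else []) [b..<n]) = []" by auto
  have 3: "map (\<lambda>a. if a < b \<and> R a then g a else []) [0..<b] = map (\<lambda>a. if R a then g a else []) [0..<b]"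
    by (intro map_cong) auto
  show ?thesis unfolding 1 map_append concat_append 2 3 by simp
qed

definition cost_segment :: "nat \<Rightarrow> nat set set \<Rightarrow> (nat set set \<Rightarrow> nat \<times> nat) \<Rightarrow> nat \<times> nat \<Rightarrow> nat \<Rightarrow> bool list" where
  "cost_segment n E \<alpha> c t =
     (if t < n * n * n then
        (let a = t mod n; b = t div n mod n; v = t div n div n
         in if a < b \<and> {a, v} \<in> E \<and> {v, b} \<in> E then encode_fraction (\<alpha> {{a, v}, {v, b}}) else [])
      else encode_fraction c)"

lemma triple_index_less: "v < n \<Longrightarrow> b < n \<Longrightarrow> a < n \<Longrightarrow> (v * n + b) * n + a < n * n * (n::nat)"
proof -
  assume h: "v < n" "b < n" "a < n"
  have "v * n + b < (v + 1) * n" using h by simp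
  also have "\<dots> \<le> n * n" using h by (intro mult_le_mono1) simp
  finally have "(v * n + b + 1) * n \<le> n * n * n" by (intro mult_le_mono1) simp
  then show ?thesis using h by (simp add: algebra_simps)
qed

lemma triple_index_cases:
  assumes "t < n * n * (n::nat)"
  obtains v b a where "v < n" "b < n" "a < n" "t = (v * n + b) * n + a"
proof -
  have n: "0 < n" using assms by (cases n) auto
  have "t div n < n * n" using assms by (simp add: less_mult_imp_div_less)
  then have "t div n div n < n" by (simp add: less_mult_imp_div_less)
  moreover have "t = (t div n div n * n + t div n mod n) * n + t mod n" by simp
  ultimately show ?thesis using that n by (metis mod_less_divisor)
qed

lemma cost_segment_triple:
  assumes "v < n" "b < n" "a < n"
  shows "cost_segment n E \<alpha> c ((v * n + b) * n + a) =
    (if a < b \<and> {a, v} \<in> E \<and> {v, b} \<in> E then encode_fraction (\<alpha> {{a, v}, {v, b}}) else [])"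
  using triple_index_less[OF assms] assms by (simp add: cost_segment_def)

text \<open>Empty segments for the remaining triples leave the word unchanged, and a single index
  range replaces the nested ones of \<open>encode\<close>.\<close>

lemma encode_segments:
  "encode n E \<alpha> c = replicate n True @ [False] @
     concat (map (\<lambda>v. map (\<lambda>u. {u, v} \<in> E) [0..<v]) [0..<n]) @
     concat (map (cost_segment n E \<alpha> c) [0..<n * n * n + 1])"
proof -
  let ?s = "cost_segment n E \<alpha> c"
  let ?g = "\<lambda>v b a. encode_fraction (\<alpha> {{a, v}, {v, b}})"
  have inner: "concat (map (\<lambda>a. ?s ((v * n + b) * n + a)) [0..<n]) =
     concat (map (\<lambda>a. if {a, v} \<in> E \<and> {v, b} \<in> E then ?g v b a else []) [0..<b])" if "v < n" "b < n" for v b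
  proof -
    have "concat (map (\<lambda>a. ?s ((v * n + b) * n + a)) [0..<n]) =
       concat (map (\<lambda>a. if a < b \<and> {a, v} \<in> E \<and> {v, b} \<in> E then ?g v b a else []) [0..<n])"
      using that by (intro arg_cong[of _ _ concat] map_cong refl) (simp add: cost_segment_triple)
    then show ?thesis using that concat_map_guard[of b n] by simp
  qed
  have "concat (map ?s [0..<n * n * n]) =
     concat (map (\<lambda>v. concat (map (\<lambda>b. concat (map (\<lambda>a. ?s ((v * n + b) * n + a)) [0..<n])) [0..<n])) [0..<n])"
    by (simp only: concat_map_times)
  also have "\<dots> = concat (map (\<lambda>v. concat (map (\<lambda>b. concat (map (\<lambda>a. if {a, v} \<in> E \<and> {v, b} \<in> E then ?g v b a else []) [0..<b])) [0..<n])) [0..<n])"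
    by (rule arg_cong[of _ _ concat], rule map_cong[OF refl], rule arg_cong[of _ _ concat], rule map_cong[OF refl], rule inner) simp_all
  also have "\<dots> = concat (concat (map (\<lambda>v. concat (map (\<lambda>b. concat (map (\<lambda>a. if {a, v} \<in> E \<and> {v, b} \<in> E then [?g v b a] else []) [0..<b])) [0..<n])) [0..<n]))"
    by (simp add: concat_concat comp_def if_distrib[of concat] cong: if_cong)
  finally have turns: "concat (map ?s [0..<n * n * n]) = concat (concat (map (\<lambda>v. concat (map (\<lambda>b. concat (map (\<lambda>a. if {a, v} \<in> E \<and> {v, b} \<in> E then [?g v b a] else []) [0..<b])) [0..<n])) [0..<n]))" .
  have "?s (n * n * n) = encode_fraction c" by (simp add: cost_segment_def)
  then have "concat (map ?s [0..<n * n * n + 1]) = concat (map ?s [0..<n * n * n]) @ encode_fraction c" by simp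
  then show ?thesis unfolding turns encode_def by simp
qed

lemma edge_sym: "edge x n u v \<Longrightarrow> edge x n v u"
  and edge_irrefl: "\<not> edge x n u u"
  by (auto simp: edge_def adjacent_def)

text \<open>A turn determines its middle vertex and, once sorted, its outer ones; costs read off the
  word are therefore a well-defined function on turns.\<close>

lemma turn_triple_unique:
  assumes "{{a, v}, {v, b}} = {{a', v'}, {v', b'}}" "a < (b::nat)" "a' < b'" "a \<noteq> v" "b \<noteq> v" "a' \<noteq> v'" "b' \<noteq> v'"
  shows "a = a'" "v = v'" "b = b'"
  using assms by (auto simp: doubleton_eq_iff)

section \<open>Soundness of the verifier\<close>

lemma slice_map_bit_at: "p \<le> q \<Longrightarrow> q \<le> length x \<Longrightarrow> slice x p q = map (\<lambda>u. bit_at x (p + u)) [0..<q - p]"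
  by (rule nth_equalityI) (auto simp: length_slice nth_slice bit_at_def)

lemma mem_edge_set_edge: "{u, v} \<in> edge_set n (edge x n) \<longleftrightarrow> edge x n u v"
proof -
  have "{u, v} \<in> edge_set n (edge x n) \<longleftrightarrow> u < n \<and> v < n \<and> edge x n u v"
    by (rule mem_edge_set) (rule edge_sym)
  then show ?thesis by (auto simp: edge_def)
qed

lemma fraction_eq_ratio:
  assumes "m * snd r = fst r * d" "0 < snd r" "0 < d"
  shows "fraction r = real m / real d"
proof -
  have "real m * real (snd r) = real (fst r) * real d" using assms(1) by (metis of_nat_mult)
  then show ?thesis using assms(2,3) by (simp add: fraction_def frac_eq_eq)
qed

lemma verify_sound:
  assumes ver: "verify (length x) (bit_at x) n m w P Q r M D c s d"
  shows "x \<in> DECISION_THREADING"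
proof -
  let ?l = "length x" and ?e = "edge (bit_at x) n" and ?N = "n * n * n"
  let ?E = "edge_set n ?e"
  define Mv where "Mv = (\<lambda>t. \<Sum>i<2 * ?l. M (t * (2 * ?l) + i) * 2 ^ i)"
  define Dv where "Dv = (\<Sum>i<2 * ?l. D i * 2 ^ i)"
  define num where "num = (\<lambda>t. code_value ?l (bit_at x) (P t) (Q t))"
  define den where "den = (\<lambda>t. code_value ?l (bit_at x) (Q t) (P (t + 1)))"
  define good where "good = (\<lambda>t. fraction_check ?l (bit_at x) P Q M D c t)"
  have n: "n < ?l" "\<And>i. i < n \<Longrightarrow> bit_at x i" "\<not> bit_at x n"
    and costs: "costs_check ?l (bit_at x) n P Q M D c" and walk: "walk_check n ?e m w r"
    and total: "balanced (2 * ?l) (m + 1)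
       (\<lambda>k. (\<Sum>i<m. M (turn_index n (w i) (w (i + 1)) (w (i + 2)) * (2 * ?l) + k)) + s k)
       (\<lambda>k. M (?N * (2 * ?l) + k)) d"
    using ver unfolding verify_def by blast+
  have P0: "P 0 = n + 1 + (\<Sum>j<n. j)" and PN: "P (?N + 1) = ?l" and D0: "\<exists>k<2 * ?l. D k \<noteq> 0"
    and goodN: "good ?N" using costs unfolding costs_check_def good_def by blast+
  have triple: "if a < b \<and> ?e a v \<and> ?e v b then good ((v * n + b) * n + a)
        else P ((v * n + b) * n + a + 1) = P ((v * n + b) * n + a)" if "v < n" "b < n" "a < n" for v b a
    using costs that unfolding costs_check_def good_def by blast
  have goodPQ: "P t < Q t" "Q t < P (t + 1)" "nat_code (bit_at x) (P t) (Q t)"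
    "nat_code (bit_at x) (Q t) (P (t + 1))" "Q t + 1 < P (t + 1)" if "good t" for t
    using that unfolding good_def fraction_check_def nat_code_def by auto
  have mono: "P t \<le> P (t + 1)" if "t \<le> ?N" for t
  proof (cases "t = ?N")
    case True then show ?thesis using goodPQ(1,2)[OF goodN] by simp
  next
    case False
    then have "t < ?N" using that by simp
    then obtain v b a where "v < n" "b < n" "a < n" "t = (v * n + b) * n + a" by (rule triple_index_cases)
    then show ?thesis using triple[of v b a] goodPQ(1,2)[of t] by (auto split: if_splits)
  qed
  have Ple: "P t \<le> ?l" if "t \<le> ?N + 1" for t
    using that
  proof (induction rule: inc_induct)
    case base then show ?case using PN by simp
  next
    case (step k) then show ?case using mono[of k] by simp
  qed
  have frac: "slice x (P t) (P (t + 1)) = encode_fraction (num t, den t)" "0 < den t" "Mv t * den t = num t * Dv"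
    if "good t" "t \<le> ?N" for t
  proof -
    note g = goodPQ[OF that(1)]
    have le: "P (t + 1) \<le> ?l" "Q t \<le> ?l" using Ple[of "t + 1"] that(2) g(2) by auto
    have s: "slice x (P t) (Q t) = encode_nat (num t)" "slice x (Q t) (P (t + 1)) = encode_nat (den t)"
      using nat_code_sound[OF g(3) le(2)] nat_code_sound[OF g(4) le(1)] by (simp_all add: num_def den_def)
    then show "slice x (P t) (P (t + 1)) = encode_fraction (num t, den t)"
      using slice_append[of "P t" "Q t" "P (t + 1)" x] g(1,2) by (simp add: encode_fraction_def)
    show "0 < den t" using nat_code_complete(3)[OF s(2) le(1)] g(5) by simp
    have "balanced (2 * ?l + ?l) (2 * ?l * ?l)
       (convolution (2 * ?l) ?l (\<lambda>i. M (t * (2 * ?l) + i)) (code_digit (bit_at x) (Q t) (P (t + 1))))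
       (convolution (2 * ?l) ?l D (code_digit (bit_at x) (P t) (Q t)))
       (\<lambda>k. c (t * (3 * ?l + 1) + k))"
      using that(1) unfolding good_def fraction_check_def by blast
    from balanced_sound[OF this] show "Mv t * den t = num t * Dv"
      unfolding convolution_value by (simp add: Mv_def den_def num_def Dv_def code_value_def mult.commute)
  qed
  have Dpos: "0 < Dv"
  proof -
    obtain k where k: "k < 2 * ?l" "D k \<noteq> 0" using D0 by blast
    have "D k * 2 ^ k \<le> Dv" unfolding Dv_def using k by (intro member_le_sum) auto
    then show ?thesis using k by (metis le_zero_eq mult_is_0 not_gr_zero power_not_zero zero_neq_numeral)
  qed
  have ratio: "fraction (num t, den t) = real (Mv t) / real Dv" if "good t" "t \<le> ?N" for t
    using frac(2,3)[OF that] Dpos by (intro fraction_eq_ratio) simp_all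
  \<comment> \<open>The cost function of the reconstructed instance: a turn gets the fraction read
    at the index of its sorted triple.\<close>
  define \<alpha> where "\<alpha> = (\<lambda>T. let t = (THE t. \<exists>v b a. a < b \<and> ?e a v \<and> ?e v b \<and> T = {{a, v}, {v, b}} \<and> t = (v * n + b) * n + a)
      in (num t, den t))"
  have alpha: "\<alpha> {{a, v}, {v, b}} = (num ((v * n + b) * n + a), den ((v * n + b) * n + a))"
    if "a < b" "?e a v" "?e v b" for a v b
  proof -
    have "(THE t. \<exists>v' b' a'. a' < b' \<and> ?e a' v' \<and> ?e v' b' \<and> {{a, v}, {v, b}} = {{a', v'}, {v', b'}} \<and> t = (v' * n + b') * n + a')
      = (v * n + b) * n + a"
    proof (rule the_equality)
      show "\<exists>v' b' a'. a' < b' \<and> ?e a' v' \<and> ?e v' b' \<and> {{a, v}, {v, b}} = {{a', v'}, {v', b'}} \<and> (v * n + b) * n + a = (v' * n + b') * n + a'"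
        using that by blast
      fix t assume "\<exists>v' b' a'. a' < b' \<and> ?e a' v' \<and> ?e v' b' \<and> {{a, v}, {v, b}} = {{a', v'}, {v', b'}} \<and> t = (v' * n + b') * n + a'"
      then obtain v' b' a' where h: "a' < b'" "?e a' v'" "?e v' b'" "{{a, v}, {v, b}} = {{a', v'}, {v', b'}}" "t = (v' * n + b') * n + a'"
        by blast
      have "a \<noteq> v" "b \<noteq> v" "a' \<noteq> v'" "b' \<noteq> v'" using that h(2,3) edge_irrefl by metis+
      from turn_triple_unique[OF h(4) that(1) h(1) this] show "t = (v * n + b) * n + a" using h(5) by simp
    qed
    then show ?thesis by (simp add: \<alpha>_def Let_def)
  qed
  have good_triple: "good ((v * n + b) * n + a) \<and> (v * n + b) * n + a \<le> ?N"
    if "a < b" "?e a v" "?e v b" for a v b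
  proof -
    have "v < n" "b < n" "a < n" using that by (auto simp: edge_def)
    then show ?thesis using triple[of v b a] that triple_index_less[of v n b a] by simp
  qed
  have alpha_ratio: "0 < snd (\<alpha> {{a, v}, {v, b}}) \<and> fraction (\<alpha> {{a, v}, {v, b}}) = real (Mv (turn_index n a v b)) / real Dv"
    if "a \<noteq> b" "?e a v" "?e v b" for a v b
  proof (cases "a < b")
    case True
    then show ?thesis using alpha[OF True that(2,3)] good_triple[OF True that(2,3)] frac(2) ratio
      by (simp add: turn_index_def)
  next
    case False
    then have lt: "b < a" using that(1) by simp
    have e: "?e b v" "?e v a" using that edge_sym by blast+
    have "{{a, v}, {v, b}} = {{b, v}, {v, a}}" by auto
    then show ?thesis using alpha[OF lt e] good_triple[OF lt e] frac(2) ratio False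
      by (simp add: turn_index_def)
  qed
  note ws = walk_check_sound[of n ?e, OF walk edge_sym edge_irrefl]
  let ?c = "(num ?N, den ?N)"
  have "x = encode n ?E \<alpha> ?c"
  proof -
    have Pl: "P 0 \<le> ?l" using Ple[of 0] by simp
    have "x = slice x 0 ?l" by (simp add: slice_def)
    also have "\<dots> = slice x 0 (n + 1) @ slice x (n + 1) (P 0) @ slice x (P 0) ?l"
      using P0 Pl by (simp add: slice_append)
    also have "slice x 0 (n + 1) = replicate n True @ [False]"
      using n by (intro nth_equalityI) (auto simp: length_slice nth_slice bit_at_def nth_append less_Suc_eq)
    also have "slice x (n + 1) (P 0) = concat (map (\<lambda>v. map (\<lambda>u. {u, v} \<in> ?E) [0..<v]) [0..<n])"
    proof -
      define A where "A = (\<lambda>v. n + 1 + (\<Sum>j<v. j))"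
      have "slice x (A 0) (A n) = concat (map (\<lambda>v. slice x (A v) (A (v + 1))) [0..<n])"
        by (rule concat_slices) (simp add: A_def)
      also have "\<dots> = concat (map (\<lambda>v. map (\<lambda>u. {u, v} \<in> ?E) [0..<v]) [0..<n])"
      proof (rule arg_cong[of _ _ concat], rule map_cong[OF refl])
        fix v assume "v \<in> set [0..<n]"
        then have v: "v < n" by simp
        have "(\<Sum>j<Suc v. j) \<le> (\<Sum>j<n. j)" using v by (intro sum_mono2) auto
        then have "A (v + 1) \<le> ?l" using P0 Pl by (simp add: A_def)
        then have "slice x (A v) (A (v + 1)) = map (\<lambda>u. bit_at x (A v + u)) [0..<A (v + 1) - A v]"
          by (intro slice_map_bit_at) (auto simp: A_def)
        also have "\<dots> = map (\<lambda>u. {u, v} \<in> ?E) [0..<v]"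
          using v by (intro map_cong) (auto simp: A_def mem_edge_set_edge edge_def adjacent_def)
        finally show "slice x (A v) (A (v + 1)) = map (\<lambda>u. {u, v} \<in> ?E) [0..<v]" .
      qed
      finally show ?thesis by (simp add: A_def P0)
    qed
    also have "slice x (P 0) ?l = concat (map (cost_segment n ?E \<alpha> ?c) [0..<?N + 1])"
    proof -
      have "slice x (P 0) (P (?N + 1)) = concat (map (\<lambda>t. slice x (P t) (P (t + 1))) [0..<?N + 1])"
        by (rule concat_slices) (use mono in auto)
      also have "\<dots> = concat (map (cost_segment n ?E \<alpha> ?c) [0..<?N + 1])"
      proof (rule arg_cong[of _ _ concat], rule map_cong[OF refl])
        fix t assume "t \<in> set [0..<?N + 1]"
        then have t: "t = ?N \<or> t < ?N" by auto
        then show "slice x (P t) (P (t + 1)) = cost_segment n ?E \<alpha> ?c t"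
        proof
          assume "t = ?N"
          then show ?thesis using frac(1)[OF goodN] by (simp add: cost_segment_def)
        next
          assume "t < ?N"
          then obtain v b a where h: "v < n" "b < n" "a < n" "t = (v * n + b) * n + a" by (rule triple_index_cases)
          show ?thesis
          proof (cases "a < b \<and> ?e a v \<and> ?e v b")
            case True
            then have "cost_segment n ?E \<alpha> ?c t = encode_fraction (num t, den t)"
              unfolding h(4) cost_segment_triple[OF h(1-3)] by (simp add: alpha mem_edge_set_edge)
            moreover have "good t" using triple[OF h(1-3)] True h(4) by simp
            ultimately show ?thesis using frac(1)[of t] \<open>t < ?N\<close> by simp
          next
            case False
            then have "cost_segment n ?E \<alpha> ?c t = []"
              unfolding h(4) cost_segment_triple[OF h(1-3)] by (auto simp: mem_edge_set_edge)
            moreover have "P (t + 1) = P t" using triple[OF h(1-3)] False h(4) by auto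
            ultimately show ?thesis by (simp add: slice_def)
          qed
        qed
      qed
      finally show ?thesis by (simp only: PN)
    qed
    finally show ?thesis unfolding encode_segments by simp
  qed
  moreover have "0 < snd (\<alpha> t)" if "t \<in> turns {..<n} ?E" for t
  proof -
    obtain v f g where t: "t = {f, g}" "f \<in> incident ?E v" "g \<in> incident ?E v" "f \<noteq> g"
      using \<open>t \<in> turns {..<n} ?E\<close> by (auto simp: turns_def turns_at_def)
    have ex: "\<exists>a. h = {a, v} \<and> ?e a v" if "h \<in> incident ?E v" for h
    proof -
      have "h \<in> ?E" "v \<in> h" using that by (auto simp: incident_def)
      then obtain a where "h = {a, v}" by (fastforce simp: edge_set_def)
      then show ?thesis using \<open>h \<in> ?E\<close> mem_edge_set_edge by metis
    qed
    obtain a b where "f = {a, v}" "?e a v" "g = {b, v}" "?e b v" using ex t(2,3) by blast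
    moreover from this have "t = {{a, v}, {v, b}}" "a \<noteq> b" using t by (auto simp: insert_commute)
    ultimately show ?thesis using alpha_ratio[of a b v] edge_sym by blast
  qed
  moreover have "0 < den ?N" using frac(2)[OF goodN] by simp
  moreover have "threading_instance {..<n} ?E (\<lambda>t. fraction (\<alpha> t)) (fraction ?c)"
    using ws(4) by (simp add: threading_instance_def fraction_def)
  moreover have "threading_within {..<n} ?E (\<lambda>t. fraction (\<alpha> t)) (fraction ?c)"
  proof -
    let ?t = "\<lambda>i. turn_index n (w i) (w (i + 1)) (w (i + 2))"
    have "turn_cost (\<lambda>t. fraction (\<alpha> t)) (map w [0..<m]) =
        (\<Sum>i<m. fraction (\<alpha> {{w i, w (i + 1)}, {w (i + 1), w (i + 2)}}))"
      by (rule turn_cost_map[OF ws(1)])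
    also have "\<dots> = (\<Sum>i<m. real (Mv (?t i)) / real Dv)"
    proof (rule sum.cong[OF refl])
      fix i assume "i \<in> {..<m}"
      then have i: "i < m" by simp
      have "?e (w i) (w (i + 1))" "?e (w (i + 1)) (w (i + 2))" using ws(3)[of i] ws(3)[of "i + 1"] i by auto
      moreover have "w i \<noteq> w (i + 2)" using walk i unfolding walk_check_def by blast
      ultimately show "fraction (\<alpha> {{w i, w (i + 1)}, {w (i + 1), w (i + 2)}}) = real (Mv (?t i)) / real Dv"
        using alpha_ratio by blast
    qed
    also have "\<dots> = real (\<Sum>i<m. Mv (?t i)) / real Dv" by (simp add: sum_divide_distrib)
    also have "\<dots> \<le> real (Mv ?N) / real Dv"
    proof -
      \<comment> \<open>The digits of \<open>M\<close> and \<open>s\<close> may have any size here: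
        only the weighted sums enter, and dropping the nonnegative slack gives the
        inequality.\<close>
      have "(\<Sum>k<2 * ?l. ((\<Sum>i<m. M (?t i * (2 * ?l) + k)) + s k) * 2 ^ k) = Mv ?N"
        using balanced_sound[OF total] by (simp add: Mv_def)
      moreover have "(\<Sum>i<m. Mv (?t i)) = (\<Sum>k<2 * ?l. (\<Sum>i<m. M (?t i * (2 * ?l) + k)) * 2 ^ k)"
        unfolding Mv_def by (subst sum.swap) (simp add: sum_distrib_right)
      moreover have "\<dots> \<le> (\<Sum>k<2 * ?l. ((\<Sum>i<m. M (?t i * (2 * ?l) + k)) + s k) * 2 ^ k)"
        by (intro sum_mono mult_right_mono) auto
      ultimately have "(\<Sum>i<m. Mv (?t i)) \<le> Mv ?N" by simp
      then show ?thesis by (intro divide_right_mono of_nat_mono) auto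
    qed
    also have "\<dots> = fraction ?c" using ratio[OF goodN] by simp
    finally show ?thesis using ws(5) unfolding threading_within_def by blast
  qed
  ultimately show ?thesis unfolding DECISION_THREADING_def by (intro CollectI exI[of _ n] exI[of _ ?E] exI[of _ \<alpha>] exI[of _ ?c]) auto
qed

section \<open>Completeness of the verifier\<close>

lemma slice_split:
  assumes "slice x p r = as @ bs" "p \<le> r" "r \<le> length x"
  shows "slice x p (p + length as) = as" "slice x (p + length as) r = bs"
proof -
  have len: "length as + length bs = r - p" using assms length_slice[of p r x] by simp
  have "take (length as) (slice x p r) = as" "drop (length as) (slice x p r) = bs" using assms(1) by simp_all
  then show "slice x p (p + length as) = as" "slice x (p + length as) r = bs"
    using len assms(2) by (simp_all add: slice_def drop_take min_def add.commute split: if_splits)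
qed

lemma block_div_mod: "i < k \<Longrightarrow> (t * k + i) div k = t \<and> (t * k + i) mod k = (i::nat)"
  by simp

lemma balanced_cong:
  "(\<And>k. k \<le> l \<Longrightarrow> c k = c' k) \<Longrightarrow> balanced l b f g c = balanced l b f g c'"
  by (auto simp: balanced_def)

definition supported :: "nat \<Rightarrow> nat \<Rightarrow> (nat \<Rightarrow> nat) \<Rightarrow> bool" where
  "supported k b f \<longleftrightarrow> (\<forall>i. f i \<le> b) \<and> (\<forall>i\<ge>k. f i = 0)"

lemma supported_mono: "supported k b f \<Longrightarrow> k \<le> k' \<Longrightarrow> b \<le> b' \<Longrightarrow> supported k' b' f"
  unfolding supported_def by (meson order_trans)

lemma verify_complete:
  assumes x: "x = encode n E \<alpha> c0"
    and pos: "\<And>t. t \<in> turns {..<n} E \<Longrightarrow> 0 < snd (\<alpha> t)" "0 < snd c0"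
    and inst: "threadable_graph {..<n} E"
    and within: "threading_within {..<n} E (\<lambda>t. fraction (\<alpha> t)) (fraction c0)"
  obtains m w P Q r M D c s d where
    "verify (length x) (bit_at x) n m w P Q r M D c s d"
    "n < length x" "m \<le> n ^ 2 * (n ^ 3 + 1)"
    "supported (m + 2) n w" "supported (n * n * n + 2) (length x) P" "supported (n * n * n + 1) (length x) Q"
    "supported (n * n) n r" "supported ((n * n * n + 1) * (2 * length x)) 1 M" "supported (2 * length x) 1 D"
    "supported ((n * n * n + 1) * (3 * length x + 1)) (4 * length x * length x) c"
    "supported (2 * length x) 1 s" "supported (2 * length x + 1) (2 * (m + 1)) d"
proof -
  let ?l = "length x" and ?b = "bit_at x" and ?N = "n * n * n"
  let ?e = "edge ?b n"
  let ?seg = "cost_segment n E \<alpha> c0"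
  let ?mat = "concat (map (\<lambda>v. map (\<lambda>u. {u, v} \<in> E) [0..<v]) [0..<n])"
  define p0 where "p0 = n + 1 + (\<Sum>j<n. j)"
  have enc: "x = (replicate n True @ [False]) @ ?mat @ concat (map ?seg [0..<?N + 1])"
    unfolding x encode_segments by simp
  have lmat: "length ?mat = (\<Sum>j<n. j)"
  proof -
    have "length (concat (map (\<lambda>v. map (\<lambda>u. {u, v} \<in> E) [0..<v]) [0..<k])) = (\<Sum>j<k. j)" for k
      by (induction k) auto
    then show ?thesis .
  qed
  have p0le: "p0 \<le> ?l" unfolding enc p0_def using lmat by simp
  have nl: "n < ?l" using p0le by (simp add: p0_def)
  have bits: "i < n \<Longrightarrow> ?b i" "\<not> ?b n" for i
    by (subst enc, simp add: bit_at_def nth_append, subst enc, simp add: bit_at_def nth_append)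
  have "slice x 0 ?l = x" by (simp add: slice_def)
  then have sl1: "slice x (n + 1) ?l = ?mat @ concat (map ?seg [0..<?N + 1])"
    using slice_split(2)[of x 0 ?l "replicate n True @ [False]"] enc by simp
  have smat: "slice x (n + 1) p0 = ?mat" and sseg: "slice x p0 ?l = concat (map ?seg [0..<?N + 1])"
    using slice_split[OF sl1] nl lmat by (simp_all add: p0_def)
  have E2: "f \<subseteq> {..<n} \<and> card f = 2" if "f \<in> E" for f using inst that by (auto simp: threadable_graph_def)
  have En: "u < n \<and> v < n \<and> u \<noteq> v" if "{u, v} \<in> E" for u v
    using E2[OF that] by (auto simp: card_insert_if split: if_splits)
  have adj: "?b (n + 1 + (\<Sum>j<v. j) + u) \<longleftrightarrow> {u, v} \<in> E" if "u < v" "v < n" for u v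
  proof -
    have "slice x (n + 1 + (\<Sum>k<v. length (map (\<lambda>u. {u, k} \<in> E) [0..<k]))) (n + 1 + (\<Sum>k<v + 1. length (map (\<lambda>u. {u, k} \<in> E) [0..<k])))
       = map (\<lambda>u. {u, v} \<in> E) [0..<v]"
      by (rule slice_concat(2)[OF smat _ p0le that(2)]) (simp add: p0_def)
    then have sl: "slice x (n + 1 + (\<Sum>k<v. k)) (n + 1 + (\<Sum>k<v + 1. k)) = map (\<lambda>u. {u, v} \<in> E) [0..<v]" by simp
    have "(\<Sum>k<v + 1. k) \<le> (\<Sum>k<n. k)" using that(2) by (intro sum_mono2) auto
    then have le: "n + 1 + (\<Sum>k<v + 1. k) \<le> ?l" using p0le unfolding p0_def by linarith
    have lt: "n + 1 + (\<Sum>k<v. k) + u < n + 1 + (\<Sum>k<v + 1. k)" using that(1) by simp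
    have "slice x (n + 1 + (\<Sum>k<v. k)) (n + 1 + (\<Sum>k<v + 1. k)) ! u = x ! (n + 1 + (\<Sum>k<v. k) + u)"
      by (rule nth_slice[OF lt le])
    then have "x ! (n + 1 + (\<Sum>k<v. k) + u) \<longleftrightarrow> {u, v} \<in> E" unfolding sl using that(1) by simp
    then show ?thesis using lt le by (simp add: bit_at_def)
  qed
  have edge_iff: "?e u v \<longleftrightarrow> {u, v} \<in> E" for u v
  proof (cases "u < n \<and> v < n \<and> u \<noteq> v")
    case True
    then have "u < v \<or> v < u" by linarith
    then show ?thesis using True adj[of u v] adj[of v u] by (auto simp: edge_def adjacent_def insert_commute)
  next
    case False
    then show ?thesis using En[of u v] edge_irrefl[of ?b n u] by (auto simp: edge_def)
  qed
  \<comment> \<open>The indices whose segment is not empty: turns with sorted outer vertices, and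
    the bound at \<open>?N\<close>.\<close>
  define good where "good = (\<lambda>t. t = ?N \<or> (\<exists>v b a. v < n \<and> b < n \<and> a < n \<and> t = (v * n + b) * n + a \<and> a < b \<and> {a, v} \<in> E \<and> {v, b} \<in> E))"
  \<comment> \<open>Below \<open>?N\<close>, quotients and remainders recover \<open>v\<close>,
    \<open>b\<close> and \<open>a\<close> from the index.\<close>
  define fr where "fr = (\<lambda>t. if t = ?N then c0 else \<alpha> {{t mod n, t div n div n}, {t div n div n, t div n mod n}})"
  have fr_triple: "fr ((v * n + b) * n + a) = \<alpha> {{a, v}, {v, b}}" if "v < n" "b < n" "a < n" for v b a
    using triple_index_less[OF that] that by (simp add: fr_def)
  have good_triple: "good ((v * n + b) * n + a)" if "v < n" "b < n" "a < n" "a < b" "{a, v} \<in> E" "{v, b} \<in> E" for v b a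
    using that unfolding good_def by blast
  have good_cases [consumes 1]: thesis if "good t" "t = ?N \<Longrightarrow> thesis"
      "\<And>v b a. v < n \<Longrightarrow> b < n \<Longrightarrow> a < n \<Longrightarrow> t = (v * n + b) * n + a \<Longrightarrow> a < b \<Longrightarrow> {a, v} \<in> E \<Longrightarrow> {v, b} \<in> E \<Longrightarrow> thesis"
    for t thesis using that unfolding good_def by blast
  have goodle: "t \<le> ?N" if "good t" for t
    using that triple_index_less unfolding good_def by (auto intro: less_imp_le)
  have fin: "finite (Collect good)" by (rule finite_subset[of _ "{..?N}"]) (use goodle in auto)
  have seg_good: "?seg t = encode_fraction (fr t)" if "good t" for t
    using that
  proof (cases rule: good_cases)
    case 1 then show ?thesis by (simp add: cost_segment_def fr_def)
  next
    case h: (2 v b a)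
    then show ?thesis using cost_segment_triple[OF h(1-3)] fr_triple[OF h(1-3)] by simp
  qed
  have den_pos: "0 < snd (fr t)" if "good t" for t
    using that
  proof (cases rule: good_cases)
    case 1 then show ?thesis using pos(2) by (simp add: fr_def)
  next
    case h: (2 v b a)
    have "{{a, v}, {v, b}} \<in> turns_at E v"
      unfolding turns_at_def incident_def using h by (intro CollectI exI[of _ "{a, v}"] exI[of _ "{v, b}"]) (auto simp: doubleton_eq_iff)
    then have "{{a, v}, {v, b}} \<in> turns {..<n} E" using h(1) by (auto simp: turns_def)
    then show ?thesis using pos(1) fr_triple[OF h(1-3)] h(4) by simp
  qed
  define P0 where "P0 = (\<lambda>t. p0 + (\<Sum>k<t. length (?seg k)))"
  have P0N: "P0 (?N + 1) = ?l" and P0s: "\<And>t. t < ?N + 1 \<Longrightarrow> slice x (P0 t) (P0 (t + 1)) = ?seg t"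
    unfolding P0_def using slice_concat[OF sseg p0le order_refl] by blast+
  have P0le: "P0 t \<le> ?l" if "t \<le> ?N + 1" for t
  proof -
    have "(\<Sum>k<t. length (?seg k)) \<le> (\<Sum>k<?N + 1. length (?seg k))" using that by (intro sum_mono2) auto
    then show ?thesis using P0N unfolding P0_def by linarith
  qed
  define P where "P = (\<lambda>t. if t \<le> ?N + 1 then P0 t else 0)"
  define Q where "Q = (\<lambda>t. if good t then P t + length (encode_nat (fst (fr t))) else 0)"
  have code: "nat_code ?b (P t) (Q t)" "nat_code ?b (Q t) (P (t + 1))" "Q t + 1 < P (t + 1)" "Q t \<le> ?l"
    "code_value ?l ?b (P t) (Q t) = fst (fr t)" "code_value ?l ?b (Q t) (P (t + 1)) = snd (fr t)" if "good t" for t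
  proof -
    have t: "t \<le> ?N" using goodle[OF that] .
    have PP: "P t = P0 t" "P (t + 1) = P0 (t + 1)" using t by (simp_all add: P_def)
    have le: "P t \<le> P (t + 1)" "P (t + 1) \<le> ?l" unfolding PP using P0le[of "t + 1"] t by (auto simp: P0_def)
    have Qt: "Q t = P t + length (encode_nat (fst (fr t)))" using that by (simp add: Q_def)
    have "slice x (P t) (P (t + 1)) = encode_nat (fst (fr t)) @ encode_nat (snd (fr t))"
      unfolding PP using P0s[of t] t seg_good[OF that] by (simp add: encode_fraction_def)
    from slice_split[OF this le] have s: "slice x (P t) (Q t) = encode_nat (fst (fr t))"
      "slice x (Q t) (P (t + 1)) = encode_nat (snd (fr t))" unfolding Qt by blast+
    note c2 = nat_code_complete[OF s(2) le(2)]
    show Ql: "Q t \<le> ?l" using c2(4) le(2) by simp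
    show "nat_code ?b (P t) (Q t)" "nat_code ?b (Q t) (P (t + 1))" "Q t + 1 < P (t + 1)"
      "code_value ?l ?b (P t) (Q t) = fst (fr t)" "code_value ?l ?b (Q t) (P (t + 1)) = snd (fr t)"
      using nat_code_complete[OF s(1) Ql] c2 den_pos[OF that] by auto
  qed
  \<comment> \<open>The plain product of all denominators is a short enough common denominator, by
    \<open>Dless\<close>.\<close>
  define Dv where "Dv = (\<Prod>t\<in>Collect good. snd (fr t))"
  define Mv where "Mv = (\<lambda>t. fst (fr t) * (Dv div snd (fr t)))"
  have Dpos: "0 < Dv" unfolding Dv_def using den_pos by (intro prod_pos) auto
  have dvd: "snd (fr t) dvd Dv" if "good t" for t unfolding Dv_def using fin that by (intro dvd_prodI) auto
  have MD: "Mv t * snd (fr t) = fst (fr t) * Dv" if "good t" for t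
    using dvd[OF that] by (simp add: Mv_def mult.assoc)
  \<comment> \<open>Strict, because the prefix contains at least the zero that ends the unary
    part.\<close>
  have total_seg: "(\<Sum>t\<le>?N. length (?seg t)) < ?l"
  proof -
    have "(\<Sum>t\<le>?N. length (?seg t)) + p0 = ?l" using P0N by (simp add: P0_def lessThan_Suc_atMost)
    then show ?thesis by (simp add: p0_def)
  qed
  have fr_less: "fst (fr t) < 2 ^ length (?seg t)" "snd (fr t) \<le> 2 ^ length (?seg t)" if "good t" for t
  proof -
    have "length (nat_bits (fst (fr t))) \<le> length (?seg t)" "length (nat_bits (snd (fr t))) \<le> length (?seg t)"
      by (simp_all add: seg_good[OF that] encode_fraction_def length_encode_nat)
    then have le: "(2::nat) ^ length (nat_bits (fst (fr t))) \<le> 2 ^ length (?seg t)"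
      "(2::nat) ^ length (nat_bits (snd (fr t))) \<le> 2 ^ length (?seg t)" by simp_all
    show "fst (fr t) < 2 ^ length (?seg t)" using less_nat_bits le(1) by (rule less_le_trans)
    show "snd (fr t) \<le> 2 ^ length (?seg t)" using less_imp_le[OF less_nat_bits] le(2) by (rule order_trans)
  qed
  \<comment> \<open>Each denominator is at most 2 to the length of its own segment, and the segments
    are disjoint parts of the word.\<close>
  have Dless: "Dv < 2 ^ ?l"
  proof -
    have "Dv \<le> (\<Prod>t\<in>Collect good. 2 ^ length (?seg t))" unfolding Dv_def using fr_less(2) by (intro prod_mono) auto
    also have "\<dots> = 2 ^ (\<Sum>t\<in>Collect good. length (?seg t))" by (simp add: power_sum)
    also have "\<dots> \<le> 2 ^ (\<Sum>t\<le>?N. length (?seg t))"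
      using goodle by (intro power_increasing sum_mono2) auto
    also have "\<dots> < 2 ^ ?l" using total_seg by simp
    finally show ?thesis .
  qed
  \<comment> \<open>A numerator and the common denominator have at most \<open>?l\<close> bits each,
    which is the origin of the digit blocks of length \<open>2 * ?l\<close>.\<close>
  have Mless: "Mv t < 2 ^ (2 * ?l)" if "good t" for t
  proof -
    have "length (?seg t) \<le> (\<Sum>t\<le>?N. length (?seg t))" using goodle[OF that] by (intro member_le_sum) auto
    then have "length (?seg t) \<le> ?l" using total_seg by simp
    then have "(2::nat) ^ length (?seg t) \<le> 2 ^ ?l" by simp
    then have f: "fst (fr t) < 2 ^ ?l" using fr_less(1)[OF that] by (rule less_le_trans[rotated])
    have "Mv t \<le> fst (fr t) * Dv" unfolding Mv_def by (intro mult_le_mono div_le_dividend) auto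
    also have "\<dots> < 2 ^ ?l * 2 ^ ?l" using f Dless by (intro mult_strict_mono) auto
    finally show ?thesis by (simp add: mult_2 power_add)
  qed
  define D where "D = (\<lambda>i. if i < 2 * ?l then Dv div 2 ^ i mod 2 else 0)"
  define M where "M = (\<lambda>i. if i < (?N + 1) * (2 * ?l) then Mv (i div (2 * ?l)) div 2 ^ (i mod (2 * ?l)) mod 2 else 0)"
  have Mi: "M (t * (2 * ?l) + i) = Mv t div 2 ^ i mod 2" if "t \<le> ?N" "i < 2 * ?l" for t i
  proof -
    have "t * (2 * ?l) + i < (t + 1) * (2 * ?l)" using that(2) by simp
    also have "\<dots> \<le> (?N + 1) * (2 * ?l)" using that(1) by (intro mult_le_mono1) simp
    finally have lt: "t * (2 * ?l) + i < (?N + 1) * (2 * ?l)" .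
    have "(t * (2 * ?l) + i) div (2 * ?l) = t" "(t * (2 * ?l) + i) mod (2 * ?l) = i" using block_div_mod[OF that(2)] by simp_all
    then show ?thesis using lt unfolding M_def by simp
  qed
  have Dsum: "(\<Sum>i<2 * ?l. D i * 2 ^ i) = Dv"
  proof -
    have "Dv < 2 ^ (2 * ?l)" using Dless by (rule less_le_trans) (intro power_increasing, auto)
    then show ?thesis using binary_digits[of Dv "2 * ?l"] by (simp add: D_def)
  qed
  have Msum: "(\<Sum>i<2 * ?l. M (t * (2 * ?l) + i) * 2 ^ i) = Mv t" if "good t" for t
    using binary_digits[of "Mv t" "2 * ?l"] Mless[OF that] Mi[OF goodle[OF that]] by simp
  have digit: "k mod 2 \<le> (1::nat)" for k by simp
  have D1: "D i \<le> 1" for i unfolding D_def using digit by (auto simp del: One_nat_def)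
  have M1: "M i \<le> 1" for i unfolding M_def using digit by (auto simp del: One_nat_def)
  have cd1: "code_digit ?b p q j \<le> 1" for p q j by (simp add: code_digit_def)
  have "\<exists>c. balanced (2 * ?l + ?l) (2 * ?l * ?l)
       (convolution (2 * ?l) ?l (\<lambda>i. M (t * (2 * ?l) + i)) (code_digit ?b (Q t) (P (t + 1))))
       (convolution (2 * ?l) ?l D (code_digit ?b (P t) (Q t))) c \<and> (\<forall>k. c k \<le> 2 * (2 * ?l * ?l))" if "good t" for t
  proof -
    have "(\<Sum>j<?l. code_digit ?b (Q t) (P (t + 1)) j * 2 ^ j) = snd (fr t)" "(\<Sum>j<?l. code_digit ?b (P t) (Q t) j * 2 ^ j) = fst (fr t)"
      using code(5,6)[OF that] by (simp_all add: code_value_def)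
    then have "(\<Sum>k<2 * ?l + ?l. convolution (2 * ?l) ?l (\<lambda>i. M (t * (2 * ?l) + i)) (code_digit ?b (Q t) (P (t + 1))) k * 2 ^ k)
      = (\<Sum>k<2 * ?l + ?l. convolution (2 * ?l) ?l D (code_digit ?b (P t) (Q t)) k * 2 ^ k)"
      unfolding convolution_value Dsum Msum[OF that] using MD[OF that] by (simp add: mult.commute)
    then show ?thesis
      by (rule balanced_complete[where b = "2 * ?l * ?l"])
        (rule convolution_le[OF M1 cd1], rule convolution_le[OF D1 cd1], blast)
  qed
  then obtain cc where cc: "\<And>t. good t \<Longrightarrow> balanced (2 * ?l + ?l) (2 * ?l * ?l)
       (convolution (2 * ?l) ?l (\<lambda>i. M (t * (2 * ?l) + i)) (code_digit ?b (Q t) (P (t + 1))))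
       (convolution (2 * ?l) ?l D (code_digit ?b (P t) (Q t))) (cc t)"
     "\<And>t k. good t \<Longrightarrow> cc t k \<le> 2 * (2 * ?l * ?l)" by metis
  \<comment> \<open>One block per index: \<open>2 * ?l + ?l\<close> columns have one more carry than
    columns, hence the block length \<open>3 * ?l + 1\<close>.\<close>
  define c where "c = (\<lambda>i. if good (i div (3 * ?l + 1)) then cc (i div (3 * ?l + 1)) (i mod (3 * ?l + 1)) else 0)"
  have ci: "c (t * (3 * ?l + 1) + k) = cc t k" if "good t" "k \<le> 2 * ?l + ?l" for t k
  proof -
    have k: "k < 3 * ?l + 1" using that(2) by simp
    have "(t * (3 * ?l + 1) + k) div (3 * ?l + 1) = t" "(t * (3 * ?l + 1) + k) mod (3 * ?l + 1) = k" using block_div_mod[OF k] by blast+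
    then show ?thesis unfolding c_def using that(1) by simp
  qed
  have check: "fraction_check ?l ?b P Q M D c t" if "good t" for t
    unfolding fraction_check_def
    using code(1-3)[OF that] cc(1)[OF that] balanced_cong[of "2 * ?l + ?l" "\<lambda>k. c (t * (3 * ?l + 1) + k)" "cc t"] ci[OF that]
    by blast
  have costs: "costs_check ?l ?b n P Q M D c"
    unfolding costs_check_def
  proof (intro conjI allI impI)
    show "P 0 = n + 1 + (\<Sum>j<n. j)" by (simp add: P_def P0_def p0_def)
    show "P (?N + 1) = ?l" using P0N by (simp add: P_def)
    show "\<exists>k<2 * ?l. D k \<noteq> 0"
    proof (rule ccontr)
      assume "\<not> (\<exists>k<2 * ?l. D k \<noteq> 0)"
      then have "(\<Sum>i<2 * ?l. D i * 2 ^ i) = 0" by simp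
      then show False using Dsum Dpos by simp
    qed
    show "fraction_check ?l ?b P Q M D c ?N" by (rule check) (simp add: good_def)
    fix v b a assume h: "v < n" "b < n" "a < n"
    show "if a < b \<and> ?e a v \<and> ?e v b then fraction_check ?l ?b P Q M D c ((v * n + b) * n + a)
        else P ((v * n + b) * n + a + 1) = P ((v * n + b) * n + a)"
    proof (cases "a < b \<and> ?e a v \<and> ?e v b")
      case True
      then have "good ((v * n + b) * n + a)" using h unfolding good_def edge_iff by blast
      then show ?thesis using True check by simp
    next
      case False
      then have "?seg ((v * n + b) * n + a) = []" unfolding cost_segment_triple[OF h] edge_iff by auto
      then have "P ((v * n + b) * n + a + 1) = P ((v * n + b) * n + a)"
        using triple_index_less[OF h] by (simp add: P_def P0_def)
      then show ?thesis unfolding if_not_P[OF False] .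
    qed
  qed
  obtain W where W: "threading {..<n} E W" "turn_cost (\<lambda>t. fraction (\<alpha> t)) W \<le> fraction c0"
    using within unfolding threading_within_def by blast
  have "0 \<le> fraction (\<alpha> t)" for t by (simp add: fraction_def)
  from walk_check_complete[OF inst W(1), of "\<lambda>t. fraction (\<alpha> t)", OF this]
  obtain m w r where m: "m \<le> n ^ 2 * (n ^ 3 + 1)" and walk: "walk_check n (\<lambda>u v. {u, v} \<in> E) m w r"
    and r: "\<And>i. r i \<le> n" "\<And>i. n * n \<le> i \<Longrightarrow> r i = 0" and w0: "\<And>i. m + 1 < i \<Longrightarrow> w i = 0"
    and cost: "(\<Sum>k<m. fraction (\<alpha> {{w k, w (k + 1)}, {w (k + 1), w (k + 2)}})) \<le> turn_cost (\<lambda>t. fraction (\<alpha> t)) W"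
    by blast
  have "?e = (\<lambda>u v. {u, v} \<in> E)" by (simp add: fun_eq_iff edge_iff)
  then have walk': "walk_check n ?e m w r" using walk by simp
  note ws = walk_check_sound[of n ?e, OF walk' edge_sym edge_irrefl]
  let ?t = "\<lambda>i. turn_index n (w i) (w (i + 1)) (w (i + 2))"
  have turn: "good (?t i) \<and> fr (?t i) = \<alpha> {{w i, w (i + 1)}, {w (i + 1), w (i + 2)}}" if "i < m" for i
  proof -
    have e: "{w i, w (i + 1)} \<in> E" "{w (i + 1), w (i + 2)} \<in> E"
      using ws(3)[of i] ws(3)[of "i + 1"] that by (auto simp: edge_iff)
    have lt: "w i < n" "w (i + 1) < n" "w (i + 2) < n" using En e by blast+
    have "w i \<noteq> w (i + 2)" using walk that unfolding walk_check_def by blast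
    then consider "w i < w (i + 2)" | "w (i + 2) < w i" by linarith
    then show ?thesis
    proof cases
      case 1
      then show ?thesis using good_triple[OF lt(2,3,1) 1 e] fr_triple[OF lt(2,3,1)] by (simp add: turn_index_def)
    next
      case 2
      have e': "{w (i + 2), w (i + 1)} \<in> E" "{w (i + 1), w i} \<in> E" using e by (simp_all add: insert_commute)
      have "{{w (i + 2), w (i + 1)}, {w (i + 1), w i}} = {{w i, w (i + 1)}, {w (i + 1), w (i + 2)}}" by auto
      then show ?thesis using good_triple[OF lt(2,1,3) 2 e'] fr_triple[OF lt(2,1,3)] 2 by (simp add: turn_index_def)
    qed
  qed
  have ratio: "fraction (fr t) = real (Mv t) / real Dv" if "good t" for t
    by (rule fraction_eq_ratio[OF MD[OF that] den_pos[OF that] Dpos])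
  have goodN: "good ?N" by (simp add: good_def)
  have sum_le: "(\<Sum>i<m. Mv (?t i)) \<le> Mv ?N"
  proof -
    have "real (\<Sum>i<m. Mv (?t i)) / real Dv = (\<Sum>i<m. fraction (\<alpha> {{w i, w (i + 1)}, {w (i + 1), w (i + 2)}}))"
      using turn ratio by (simp add: sum_divide_distrib) (metis (no_types, lifting) lessThan_iff sum.cong)
    also have "\<dots> \<le> fraction (fr ?N)" using cost W(2) by (simp add: fr_def)
    also have "\<dots> = real (Mv ?N) / real Dv" using ratio[OF goodN] .
    finally have "real (\<Sum>i<m. Mv (?t i)) \<le> real (Mv ?N)" using Dpos by (simp add: divide_le_cancel del: of_nat_sum)
    then show ?thesis by (simp only: of_nat_le_iff)
  qed
  \<comment> \<open>The slack between cost and bound; the subtraction is exact by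
    \<open>sum_le\<close>.\<close>
  define S where "S = Mv ?N - (\<Sum>i<m. Mv (?t i))"
  define s where "s = (\<lambda>i. if i < 2 * ?l then S div 2 ^ i mod 2 else 0)"
  have s1: "s i \<le> 1" for i unfolding s_def using digit by (auto simp del: One_nat_def)
  have "S < 2 ^ (2 * ?l)" using Mless[OF goodN] by (simp add: S_def)
  then have Ssum: "(\<Sum>i<2 * ?l. s i * 2 ^ i) = S" using binary_digits[of S "2 * ?l"] by (simp add: s_def)
  have "(\<Sum>k<2 * ?l. ((\<Sum>i<m. M (?t i * (2 * ?l) + k)) + s k) * 2 ^ k) = (\<Sum>i<m. Mv (?t i)) + S"
  proof -
    have "(\<Sum>k<2 * ?l. ((\<Sum>i<m. M (?t i * (2 * ?l) + k)) + s k) * 2 ^ k)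
      = (\<Sum>k<2 * ?l. \<Sum>i<m. M (?t i * (2 * ?l) + k) * 2 ^ k) + S"
      unfolding Ssum[symmetric] by (simp add: add_mult_distrib sum.distrib sum_distrib_right)
    also have "(\<Sum>k<2 * ?l. \<Sum>i<m. M (?t i * (2 * ?l) + k) * 2 ^ k) = (\<Sum>i<m. Mv (?t i))"
      using turn Msum by (subst sum.swap) (intro sum.cong, auto)
    finally show ?thesis .
  qed
  also have "\<dots> = (\<Sum>k<2 * ?l. M (?N * (2 * ?l) + k) * 2 ^ k)"
    using sum_le Msum[OF goodN] by (simp add: S_def)
  finally have total: "(\<Sum>k<2 * ?l. ((\<Sum>i<m. M (?t i * (2 * ?l) + k)) + s k) * 2 ^ k) = (\<Sum>k<2 * ?l. M (?N * (2 * ?l) + k) * 2 ^ k)" .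
  have col: "(\<Sum>i<m. M (?t i * (2 * ?l) + k)) + s k \<le> m + 1" for k
  proof -
    have "(\<Sum>i<m. M (?t i * (2 * ?l) + k)) \<le> (\<Sum>i<m. 1)" using M1 by (intro sum_mono)
    then show ?thesis using s1[of k] by simp
  qed
  obtain d where d: "balanced (2 * ?l) (m + 1) (\<lambda>k. (\<Sum>i<m. M (?t i * (2 * ?l) + k)) + s k) (\<lambda>k. M (?N * (2 * ?l) + k)) d"
    "\<And>k. d k \<le> 2 * (m + 1)" "\<And>k. 2 * ?l < k \<Longrightarrow> d k = 0"
    by (rule balanced_complete[OF total, of "m + 1"])
      (rule col, rule order_trans[OF M1], simp, rule that, assumption, blast+)
  have ver: "verify ?l ?b n m w P Q r M D c s d"
    unfolding verify_def using nl bits costs walk' d(1) by blast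
  show thesis
  proof (rule that[OF ver nl m])
    have "w i \<le> n" for i using ws(2)[of i] w0[of i] by (cases "i \<le> m + 1") auto
    then show "supported (m + 2) n w" using w0 by (simp add: supported_def)
    show "supported (?N + 2) ?l P" using P0le by (simp add: supported_def P_def)
    have "Q i = 0" if "?N + 1 \<le> i" for i using goodle[of i] that by (auto simp: Q_def)
    moreover have "Q i \<le> ?l" for i using code(4) by (auto simp: Q_def)
    ultimately show "supported (?N + 1) ?l Q" by (simp add: supported_def)
    have "c i = 0" if "(?N + 1) * (3 * ?l + 1) \<le> i" for i
    proof -
      have "?N + 1 \<le> i div (3 * ?l + 1)" using that by (simp add: less_eq_div_iff_mult_less_eq)
      then show ?thesis using goodle[of "i div (3 * ?l + 1)"] by (auto simp: c_def)
    qed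
    moreover have "c i \<le> 4 * ?l * ?l" for i using cc(2) by (auto simp: c_def mult.assoc)
    ultimately show "supported ((?N + 1) * (3 * ?l + 1)) (4 * ?l * ?l) c" unfolding supported_def by blast
  qed (use r M1 D1 s1 d(2,3) in \<open>auto simp: supported_def M_def D_def s_def\<close>)
qed

text \<open>With \<open>?z = length x + 2\<close>, the walk has at most \<open>?z ^ 5 + 2\<close>
  entries and the blocks of digits and carries have at most \<open>?z ^ 3 * ?z ^ 2\<close>; all
  sequences stay within \<open>?z ^ 6\<close>, and the values within \<open>?z ^ 7\<close>.
  Interleaving ten sequences costs a factor 10, which is at most \<open>?z ^ 4\<close>.\<close>

lemma DECISION_THREADING_certificate:
  assumes "x \<in> DECISION_THREADING"
  shows "\<exists>f. (\<forall>i. f i \<le> (length x + 2) ^ 7) \<and> (\<forall>i\<ge>(length x + 2) ^ 10. f i = 0) \<and>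
    verifier (length x) (bit_at x) f"
proof -
  let ?l = "length x" and ?z = "length x + 2"
  obtain n E \<alpha> c0 where x: "x = encode n E \<alpha> c0" "\<And>t. t \<in> turns {..<n} E \<Longrightarrow> 0 < snd (\<alpha> t)" "0 < snd c0"
    "threadable_graph {..<n} E" "threading_within {..<n} E (\<lambda>t. fraction (\<alpha> t)) (fraction c0)"
    using assms unfolding DECISION_THREADING_def threading_instance_def by blast
  let ?N = "n * n * n"
  obtain m w P Q r M D c s d where ver: "verify (?l) (bit_at x) n m w P Q r M D c s d"
    and n: "n < ?l" and m: "m \<le> n ^ 2 * (n ^ 3 + 1)"
    and supp: "supported (m + 2) n w" "supported (?N + 2) (?l) P" "supported (?N + 1) (?l) Q"
    "supported (n * n) n r" "supported ((?N + 1) * (2 * ?l)) 1 M" "supported (2 * ?l) 1 D"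
    "supported ((?N + 1) * (3 * ?l + 1)) (4 * ?l * ?l) c"
    "supported (2 * ?l) 1 s" "supported (2 * ?l + 1) (2 * (m + 1)) d"
    by (rule verify_complete[OF x], assumption) (rule that, assumption+)
  \<comment> \<open>Entries 0 and 1 of this sequence are read as \<open>f 8\<close> and
    \<open>f 18\<close>.\<close>
  let ?scalars = "\<lambda>i. if i = 0 then n else if i = 1 then m else 0 :: nat"
  let ?tracks = "[w, P, Q, r, M, D, c, s, ?scalars, d]"
  define f where "f = (\<lambda>j. (?tracks ! (j mod 10)) (j div 10))"
  have z: "2 \<le> ?z" by simp
  have pow: "?z ^ a \<le> ?z ^ b" if "a \<le> b" for a b using that by (intro power_increasing) auto
  have two: "2 * ?z ^ a \<le> ?z ^ (a + 1)" for a using mult_le_mono1[OF z, of "?z ^ a"] by simp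
  have n3: "?N + 1 \<le> ?z ^ 3"
  proof -
    have "?N + 1 \<le> (n + 1) * (n + 1) * (n + 1)" by (simp add: algebra_simps)
    also have "\<dots> \<le> ?z * ?z * ?z" using n by (intro mult_le_mono) auto
    finally show ?thesis by (simp add: power3_eq_cube)
  qed
  have n2: "n * n \<le> ?z ^ 2" unfolding power2_eq_square using n by (intro mult_le_mono) auto
  have m5: "m \<le> ?z ^ 5"
  proof -
    have "m \<le> n * n * (?N + 1)" using m by (simp add: power3_eq_cube power2_eq_square)
    also have "\<dots> \<le> ?z ^ 2 * ?z ^ 3" by (intro mult_le_mono n2 n3)
    finally show ?thesis by (simp add: power_add[symmetric])
  qed
  have l2: "2 * ?l + 1 \<le> ?z ^ 2" "3 * ?l + 1 \<le> ?z ^ 2"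
    by (simp_all add: power2_eq_square algebra_simps)
  have c4: "4 * ?l * ?l \<le> ?z ^ 4"
  proof -
    have "4 * ?l * ?l \<le> (2 * ?z) * (2 * ?z)" by (simp add: algebra_simps)
    also have "\<dots> \<le> ?z ^ 2 * ?z ^ 2" using two[of 1] by (intro mult_le_mono) (simp_all add: power2_eq_square)
    finally show ?thesis by (simp add: power_add[symmetric])
  qed
  have blocks: "(?N + 1) * k \<le> ?z ^ 6" if "k \<le> ?z ^ 2" for k
  proof -
    have "(?N + 1) * k \<le> ?z ^ 3 * ?z ^ 2" by (intro mult_le_mono n3 that)
    also have "\<dots> = ?z ^ 5" by (simp add: power_add[symmetric])
    also have "\<dots> \<le> ?z ^ 6" by (rule pow) simp
    finally show ?thesis .
  qed
  have p6: "?z \<le> ?z ^ 2" "?z ^ 2 \<le> ?z ^ 6" "?z ^ 3 + 1 \<le> ?z ^ 6" "?z ^ 5 + 2 \<le> ?z ^ 6"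
  proof -
    have p: "?z ^ 1 \<le> ?z ^ 2" "?z ^ 2 \<le> ?z ^ 6" "?z ^ 1 \<le> ?z ^ 5" "?z ^ 3 \<le> ?z ^ 5" by (rule pow, simp)+
    have "2 * ?z ^ 5 \<le> ?z ^ 6" using two[of 5] by simp
    then show "?z \<le> ?z ^ 2" "?z ^ 2 \<le> ?z ^ 6" "?z ^ 3 + 1 \<le> ?z ^ 6" "?z ^ 5 + 2 \<le> ?z ^ 6"
      using p unfolding power_one_right by linarith+
  qed
  have p7: "?z ^ 4 \<le> ?z ^ 7" "?z ^ 6 \<le> ?z ^ 7" "2 * ?z ^ 6 \<le> ?z ^ 7" "1 \<le> ?z ^ 7"
    using two[of 6] by (auto intro: pow simp del: power_Suc)
  have "supported (?z ^ 6) (?z ^ 7) g" if "g \<in> set ?tracks" for g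
  proof -
    have "supported (?z ^ 6) (?z ^ 7) w" "supported (?z ^ 6) (?z ^ 7) P" "supported (?z ^ 6) (?z ^ 7) Q"
      "supported (?z ^ 6) (?z ^ 7) r" "supported (?z ^ 6) (?z ^ 7) D" "supported (?z ^ 6) (?z ^ 7) s"
      by (rule supp[THEN supported_mono]; use m5 n n2 n3 l2 p6 p7 in linarith)+
    moreover have "supported (?z ^ 6) (?z ^ 7) d"
    proof (rule supported_mono[OF supp(9)])
      show "2 * ?l + 1 \<le> ?z ^ 6" using l2(1) p6(2) by (rule order_trans)
      have "m + 1 \<le> ?z ^ 6" using m5 p6(4) by linarith
      then have "2 * (m + 1) \<le> 2 * ?z ^ 6" by (rule mult_le_mono2)
      then show "2 * (m + 1) \<le> ?z ^ 7" using p7(3) by (rule order_trans)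
    qed
    moreover have "supported (?z ^ 6) (?z ^ 7) M" "supported (?z ^ 6) (?z ^ 7) c"
      by (rule supported_mono[OF supp(5) blocks]; use l2 p7 in linarith)
         (rule supported_mono[OF supp(7) blocks]; use l2 c4 p7 in linarith)
    moreover have "supported (?z ^ 6) (?z ^ 7) ?scalars"
    proof -
      have "m \<le> ?z ^ 7" using m5 p6(4) p7(2) by linarith
      moreover have "n \<le> ?z" using n by simp
      then have "n \<le> ?z ^ 7" using p6(1,2) p7(2) by linarith
      moreover have "\<not> ?z ^ 6 \<le> 0" "\<not> ?z ^ 6 \<le> 1" using p6(4) by linarith+
      ultimately show ?thesis unfolding supported_def by auto
    qed
    ultimately show ?thesis using that by auto
  qed
  moreover have "?tracks ! (i mod 10) \<in> set ?tracks" for i by (rule nth_mem) simp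
  ultimately have track: "supported (?z ^ 6) (?z ^ 7) (?tracks ! (i mod 10))" for i by blast
  have "f i \<le> ?z ^ 7" for i using track[of i] unfolding f_def supported_def by blast
  moreover have "f i = 0" if "?z ^ 10 \<le> i" for i
  proof -
    have "?z ^ 6 * 10 \<le> ?z ^ 6 * ?z ^ 4"
    proof (rule mult_le_mono2)
      have "(2::nat) ^ 4 \<le> ?z ^ 4" by (rule power_mono) auto
      then show "10 \<le> ?z ^ 4" by simp
    qed
    also have "\<dots> = ?z ^ 10" by (simp add: power_add[symmetric])
    finally have "?z ^ 6 \<le> i div 10" using that by (simp add: less_eq_div_iff_mult_less_eq)
    then show ?thesis using track[of i] unfolding f_def supported_def by blast
  qed
  moreover have "verifier (?l) (bit_at x) f"
  proof -
    have fk: "f (10 * i + k) = (?tracks ! k) i" if "k < 10" for i k using that by (simp add: f_def)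
    have "(\<lambda>i. f (10 * i)) = w" "(\<lambda>i. f (10 * i + 1)) = P" "(\<lambda>i. f (10 * i + 2)) = Q" "(\<lambda>i. f (10 * i + 3)) = r"
      "(\<lambda>i. f (10 * i + 4)) = M" "(\<lambda>i. f (10 * i + 5)) = D" "(\<lambda>i. f (10 * i + 6)) = c" "(\<lambda>i. f (10 * i + 7)) = s"
      "(\<lambda>i. f (10 * i + 9)) = d"
      using fk[of 0] fk[of 1] fk[of 2] fk[of 3] fk[of 4] fk[of 5] fk[of 6] fk[of 7] fk[of 9] by simp_all
    moreover have "f 8 = n" "f 18 = m" by (simp_all add: f_def)
    ultimately show ?thesis unfolding verifier_def using ver by simp
  qed
  ultimately show ?thesis by blast
qed

theorem theorem4: "DECISION_THREADING \<in> NP"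
proof (rule NP_by_certificate[OF decidable_verifier])
  show "x \<in> DECISION_THREADING" if "verifier (length x) (bit_at x) f" for x f
    using that unfolding verifier_def by (rule verify_sound)
qed (rule DECISION_THREADING_certificate)

end
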